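(* Let $X\subseteq\mathbb{C}$ be a continuum, that is, $X$ is non-empty, closed, connected and bounded. The following are equivalent: (a) $X$ has empty interior; (b) there is a meromorphic function $f\colon\mathbb{C}\to\widehat{\mathbb{C}}$ such that $X$ is a Julia component of $f$.
   Context: $\widehat{\mathbb{C}}=\mathbb{C}\cup\{\infty\}$ is the Riemann sphere. For a meromorphic function $f\colon\mathbb{C}\to\widehat{\mathbb{C}}$ (rational or transcendental), the Fatou set $F(f)$ is the largest open set on which all iterates $f^n$ are defined and form a normal family (with respect to the spherical metric). When $f$ is rational it is regarded as a self-map of $\widehat{\mathbb{C}}$, so all iterates are defined everywhere; when $f$ is transcendental, $f$ is not defined at $\infty$. The Julia set is $J(f)=\mathbb{C}\setminus F(f)$. A Julia component of $f$ is a connected component of $J(f)$. *)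

theory Defs
  imports "HOL-Complex_Analysis.Complex_Analysis"
begin

section \<open>The Riemann sphere\<close>

datatype riemann_sphere = Fin complex | Infinity

text \<open>
  Stereographic projection onto the unit sphere in \<open>\<complex> \<times> \<real>\<close>.  The metric it induces is the chordal
  metric, which is uniformly equivalent to the geodesic one; both go by the name spherical metric,
  and they give the same normal families.
\<close>

primrec stereographic :: "riemann_sphere \<Rightarrow> complex \<times> real" where
  "stereographic (Fin z) =
     ((2 / (1 + (cmod z)\<^sup>2)) *\<^sub>R z, ((cmod z)\<^sup>2 - 1) / ((cmod z)\<^sup>2 + 1))"
| "stereographic Infinity = (0, 1)"

lemma one_plus_cmod_sq_pos: "1 + (cmod z)\<^sup>2 > 0"
  by (simp add: add_pos_nonneg)

lemma norm_stereographic: "norm (stereographic x) = 1"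
proof (cases x)
  case (Fin z)
  define a where "a = (cmod z)\<^sup>2"
  have a: "1 + a > 0" "a + 1 > 0"
    using one_plus_cmod_sq_pos[of z] by (simp_all add: a_def)
  have "(norm ((2 / (1 + a)) *\<^sub>R z))\<^sup>2 + ((a - 1) / (a + 1))\<^sup>2 = 1"
  proof -
    have "(norm ((2 / (1 + a)) *\<^sub>R z))\<^sup>2 = 4 * a / (a + 1)\<^sup>2"
      using a by (simp add: power_divide power_mult_distrib a_def add.commute)
    moreover have "4 * a / (a + 1)\<^sup>2 + ((a - 1) / (a + 1))\<^sup>2 = (4 * a + (a - 1)\<^sup>2) / (a + 1)\<^sup>2"
      by (simp add: power_divide add_divide_distrib)
    moreover have "4 * a + (a - 1)\<^sup>2 = (a + 1)\<^sup>2"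
      by (simp add: power2_eq_square algebra_simps)
    ultimately show ?thesis
      using a by simp
  qed
  then show ?thesis
    by (simp add: Fin norm_Pair a_def power_divide)
next
  case Infinity
  then show ?thesis by (simp add: norm_Pair)
qed

lemma inj_stereographic: "inj stereographic"
proof (rule injI)
  fix x y :: riemann_sphere
  assume eq: "stereographic x = stereographic y"
  have ne1: "((cmod z)\<^sup>2 - 1) / ((cmod z)\<^sup>2 + 1) \<noteq> 1" for z
    using one_plus_cmod_sq_pos[of z] by (auto simp: divide_simps)
  show "x = y"
  proof (cases x; cases y)
    fix z w assume xy: "x = Fin z" "y = Fin w"
    have "((cmod z)\<^sup>2 - 1) / ((cmod z)\<^sup>2 + 1) = ((cmod w)\<^sup>2 - 1) / ((cmod w)\<^sup>2 + 1)"
      using eq by (simp add: xy)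
    then have sq: "(cmod z)\<^sup>2 = (cmod w)\<^sup>2"
      using one_plus_cmod_sq_pos[of z] one_plus_cmod_sq_pos[of w]
      by (simp add: field_simps split: if_splits)
    have "(2 / (1 + (cmod z)\<^sup>2)) *\<^sub>R z = (2 / (1 + (cmod z)\<^sup>2)) *\<^sub>R w"
      using eq by (simp add: xy sq)
    then show ?thesis
      using one_plus_cmod_sq_pos[of z] by (simp add: xy)
  qed (use eq ne1 in \<open>auto dest: sym\<close>)
qed

instantiation riemann_sphere :: metric_space
begin

definition dist_riemann_sphere :: "riemann_sphere \<Rightarrow> riemann_sphere \<Rightarrow> real" where
  "dist x y = dist (stereographic x) (stereographic y)"

definition uniformity_riemann_sphere_def:
  "(uniformity :: (riemann_sphere \<times> riemann_sphere) filter) = (INF e\<in>{0<..}. principal {(x, y). dist x y < e})"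

definition open_riemann_sphere_def:
  "open (U :: riemann_sphere set) \<longleftrightarrow> (\<forall>x\<in>U. \<forall>\<^sub>F (x', y) in uniformity. x' = x \<longrightarrow> y \<in> U)"

instance
proof
  show "uniformity = (INF e\<in>{0<..}. principal {(x :: riemann_sphere, y). dist x y < e})"
    by (rule uniformity_riemann_sphere_def)
  show "open U \<longleftrightarrow> (\<forall>x\<in>U. \<forall>\<^sub>F (x', y) in uniformity. x' = x \<longrightarrow> y \<in> U)"
    for U :: "riemann_sphere set"
    by (rule open_riemann_sphere_def)
  show "dist x y = 0 \<longleftrightarrow> x = y" for x y :: riemann_sphere
    by (simp add: dist_riemann_sphere_def inj_eq[OF inj_stereographic])
  show "dist x y \<le> dist x z + dist y z" for x y z :: riemann_sphere
    by (simp add: dist_riemann_sphere_def dist_triangle2)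
qed

end

section \<open>Meromorphic functions and their iterates\<close>

text \<open>
  The library models a meromorphic function by a function into \<open>\<complex>\<close>; \<open>nicely_meromorphic_on\<close> fixes its
  values at removable singularities and (by the dummy value \<open>0\<close>) at poles.  Here the value at a pole is
  the point at infinity.  The constant function with value \<open>Infinity\<close> is not meromorphic.
\<close>

definition meromorphic_fun :: "(complex \<Rightarrow> riemann_sphere) \<Rightarrow> bool" where
  "meromorphic_fun f \<longleftrightarrow>
     (\<exists>g. g nicely_meromorphic_on UNIV \<and>
          (\<forall>z. f z = (if is_pole g z then Infinity else Fin (g z))))"

definition rational_fun :: "(complex \<Rightarrow> riemann_sphere) \<Rightarrow> bool" where
  "rational_fun f \<longleftrightarrow> meromorphic_fun f \<and>
     (\<exists>p q. q \<noteq> 0 \<and> (\<forall>z. poly q z \<noteq> 0 \<longrightarrow> f z = Fin (poly p z / poly q z)))"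

text \<open>
  A meromorphic function as a partial self-map of the sphere, \<open>None\<close> meaning ``not defined''.
\<close>

primrec sphere_map :: "(complex \<Rightarrow> riemann_sphere) \<Rightarrow> riemann_sphere \<rightharpoonup> riemann_sphere" where
  "sphere_map f (Fin z) = Some (f z)"
| "sphere_map f Infinity = (if rational_fun f then Some (Lim at_infinity f) else None)"

primrec iterate :: "(complex \<Rightarrow> riemann_sphere) \<Rightarrow> nat \<Rightarrow> riemann_sphere \<rightharpoonup> riemann_sphere" where
  "iterate f 0 = Some"
| "iterate f (Suc n) = sphere_map f \<circ>\<^sub>m iterate f n"

section \<open>Normal families, Fatou and Julia sets\<close>

text \<open>
  Every sequence in the family has a subsequence that converges uniformly on compact subsets of \<open>U\<close>.
\<close>

definition normal_family_on :: "'a::topological_space set \<Rightarrow> ('a \<Rightarrow> 'b::metric_space) set \<Rightarrow> bool" where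
  "normal_family_on U \<F> \<longleftrightarrow>
     (\<forall>s :: nat \<Rightarrow> 'a \<Rightarrow> 'b. range s \<subseteq> \<F> \<longrightarrow>
        (\<exists>r l. strict_mono r \<and>
           (\<forall>K. compact K \<and> K \<subseteq> U \<longrightarrow> uniform_limit K (s \<circ> r) l sequentially)))"

definition iterates_normal_on :: "(complex \<Rightarrow> riemann_sphere) \<Rightarrow> riemann_sphere set \<Rightarrow> bool" where
  "iterates_normal_on f U \<longleftrightarrow>
     (\<forall>n. U \<subseteq> dom (iterate f n)) \<and>
     normal_family_on U (range (\<lambda>n x. the (iterate f n x)))"

text \<open>
  Normality is a local property, so the union below is the largest open set with this property.
\<close>

definition Fatou_set :: "(complex \<Rightarrow> riemann_sphere) \<Rightarrow> riemann_sphere set" where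
  "Fatou_set f = \<Union>{U. open U \<and> iterates_normal_on f U}"

definition Julia_set :: "(complex \<Rightarrow> riemann_sphere) \<Rightarrow> complex set" where
  "Julia_set f = {z. Fin z \<notin> Fatou_set f}"

end

theory Submission
  imports Defs
begin

text \<open>
  A Julia set with interior is the whole plane, and the plane has no bounded component; so a Julia component
  that is a continuum has empty interior.  Here the Fatou set is backward invariant, so the orbit of a disc in
  the Julia set omits the Fatou set, and Montel's theorem applies (\<open>interior_Julia_set\<close>).  For a transcendental
  function the orbit may run into the point at infinity; then it covers a punctured neighbourhood
  of infinity, where the function would omit an open set, contrary to the theorem of Casorati and Weierstrass
  (\<open>rational_if_omits_near_infinity\<close>).

  Conversely, let \<open>X\<close> be a continuum with empty interior.  The function is built so that \<open>X\<close> wanders: its \<open>n\<close>-th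
  image lies in the \<open>n\<close>-th disc of a sequence of disjoint discs that tends to infinity.  The \<open>n\<close>-th iterate is
  injective near \<open>X\<close>, and the next application of the function sends the image of a thin shell
  around \<open>X\<close> to a disc that is mapped into itself, while a smaller neighbourhood of \<open>X\<close> continues its journey.
  The shells are in the Fatou set, shrink to \<open>X\<close> and cut \<open>X\<close> off from the rest of the plane.  Because \<open>X\<close> has empty
  interior, every point of \<open>X\<close> is a limit of points on shells; their orbits are eventually trapped, while the orbits
  in \<open>X\<close> escape, so that no neighbourhood of a point of \<open>X\<close> is in the Fatou set
  (\<open>Julia_component_if_empty_interior\<close>).

  Such a function is a sum of successive corrections (\<open>wandering_step\<close>, \<open>wandering_function\<close>).  Each correction
  is small outside one disc and prescribed, up to a small error, on a compact set in that disc.  It exists by a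
  version of Runge's theorem with sums of simple poles (\<open>Runge_pole_sums\<close>); the poles may lie
  anywhere in the disc, also in the bounded complementary components of the compact set, so that \<open>X\<close> may separate
  the plane.
\<close>

section \<open>Approximation by sums of simple poles\<close>

text \<open>
  Sums of simple poles are the building blocks of all functions constructed below.  Unlike polynomials they
  decay at infinity, so that infinitely many of them, with poles in disjoint discs, can be added up.
\<close>

definition pole_sum :: "(complex \<times> complex) list \<Rightarrow> complex \<Rightarrow> complex" where
  "pole_sum l z = (\<Sum>(c, w)\<leftarrow>l. c / (w - z))"

lemma pole_sum_simps [simp]:
  "pole_sum [] z = 0"
  "pole_sum (p # l) z = fst p / (snd p - z) + pole_sum l z"
  "pole_sum (l @ m) z = pole_sum l z + pole_sum m z"
  by (auto simp: pole_sum_def split: prod.splits)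

lemma holomorphic_pole_sum:
  assumes "A \<inter> snd ` set l = {}"
  shows "pole_sum l holomorphic_on A"
  using assms
proof (induction l)
  case Nil
  have "pole_sum [] = (\<lambda>z. 0)" by (simp add: fun_eq_iff)
  then show ?case by simp
next
  case (Cons p l)
  have eq: "pole_sum (p # l) = (\<lambda>z. fst p / (snd p - z) + pole_sum l z)"
    by (simp add: fun_eq_iff)
  show ?case
    unfolding eq using Cons by (intro holomorphic_intros) auto
qed

lemma meromorphic_pole_sum: "pole_sum l meromorphic_on A"
proof (induction l)
  case Nil
  have eq: "pole_sum [] = (\<lambda>z. 0)" by (simp add: fun_eq_iff)
  show ?case unfolding eq by (rule meromorphic_on_const)
next
  case (Cons p l)
  have eq: "pole_sum (p # l) = (\<lambda>z. fst p / (snd p - z) + pole_sum l z)"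
    by (simp add: fun_eq_iff)
  show ?case
    unfolding eq using Cons by (intro meromorphic_intros)
qed

lemma pole_sum_scale: "pole_sum (map (\<lambda>(c, w). (k * c, w)) l) z = k * pole_sum l z"
  by (induction l) (auto simp: algebra_simps)

text \<open>
  A Riemann sum of a Cauchy integral is a sum of simple poles.  The integrand depends on \<open>z\<close>, but its modulus of
  continuity in \<open>w\<close> is uniform over all \<open>z\<close> at distance at least \<open>\<delta>\<close> from the segment, including arbitrarily
  large \<open>z\<close>.  Repeated bisection avoids any bookkeeping of partitions.
\<close>

lemma segment_integral_approx:
  assumes f: "continuous_on (closed_segment a b) f" and "\<epsilon> > 0" "\<delta> > 0"
  obtains l where "snd ` set l \<subseteq> closed_segment a b"
    "\<And>z. (\<And>w. w \<in> closed_segment a b \<Longrightarrow> \<delta> \<le> dist w z) \<Longrightarrow>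
       cmod (contour_integral (linepath a b) (\<lambda>w. f w / (w - z)) - pole_sum l z) \<le> \<epsilon>"
proof -
  let ?S = "closed_segment a b"
  define far where "far z \<longleftrightarrow> (\<forall>w\<in>?S. \<delta> \<le> dist w z)" for z
  define \<mu> where "\<mu> = \<epsilon> / (1 + dist a b)"
  have mu: "\<mu> > 0" using \<open>\<epsilon> > 0\<close> by (simp add: \<mu>_def add_pos_nonneg)
  obtain B where B: "\<And>w. w \<in> ?S \<Longrightarrow> cmod (f w) \<le> B" and "B > 0"
    using compact_imp_bounded[OF compact_continuous_image[OF f compact_segment]]
    by (auto simp: bounded_pos)
  have "uniformly_continuous_on ?S f"
    using f compact_segment compact_uniformly_continuous by blast
  then obtain \<eta>1 where \<eta>1: "\<eta>1 > 0" "\<And>v w. v \<in> ?S \<Longrightarrow> w \<in> ?S \<Longrightarrow> dist w v < \<eta>1 \<Longrightarrow> dist (f w) (f v) < \<mu> * \<delta> / 2"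
    unfolding uniformly_continuous_on_def using mu \<open>\<delta> > 0\<close>
    by (metis half_gt_zero mult_pos_pos)
  define \<eta> where "\<eta> = min (\<eta>1 / 2) (\<mu> * \<delta>\<^sup>2 / (2 * B))"
  have eta: "\<eta> > 0" using \<eta>1 mu \<open>\<delta> > 0\<close> \<open>B > 0\<close> by (simp add: \<eta>_def)
  have osc: "cmod (f w / (w - z) - f v / (v - z)) \<le> \<mu>"
    if vw: "v \<in> ?S" "w \<in> ?S" "dist w v \<le> \<eta>" and z: "far z" for v w z
  proof -
    have d: "\<delta> \<le> cmod (w - z)" "\<delta> \<le> cmod (v - z)"
      using z vw by (auto simp: far_def dist_norm)
    then have nz: "w - z \<noteq> 0" "v - z \<noteq> 0" using \<open>\<delta> > 0\<close> by auto
    have eq: "f w / (w - z) - f v / (v - z)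
        = (f w - f v) / (w - z) + f v * (v - w) / ((w - z) * (v - z))"
      using nz by (simp add: divide_simps) (simp add: algebra_simps)
    have 1: "cmod ((f w - f v) / (w - z)) \<le> (\<mu> * \<delta> / 2) / \<delta>"
      unfolding norm_divide
      using \<eta>1(2)[OF vw(1,2)] vw(3) \<eta>1(1) d \<open>\<delta> > 0\<close> mu
      by (intro frac_le) (auto simp: \<eta>_def dist_norm)
    have "cmod (f v * (v - w)) \<le> B * (\<mu> * \<delta>\<^sup>2 / (2 * B))"
      unfolding norm_mult using B[OF vw(1)] vw(3) \<open>B > 0\<close>
      by (intro mult_mono) (auto simp: \<eta>_def dist_norm norm_minus_commute)
    moreover have "\<delta> * \<delta> \<le> cmod ((w - z) * (v - z))"
      unfolding norm_mult using d \<open>\<delta> > 0\<close> by (intro mult_mono) auto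
    ultimately have 2: "cmod (f v * (v - w) / ((w - z) * (v - z))) \<le> (B * (\<mu> * \<delta>\<^sup>2 / (2 * B))) / (\<delta> * \<delta>)"
      unfolding norm_divide using \<open>\<delta> > 0\<close> \<open>B > 0\<close> mu
      by (intro frac_le) auto
    show ?thesis
      unfolding eq using norm_triangle_le[OF add_mono[OF 1 2]] \<open>\<delta> > 0\<close> \<open>B > 0\<close>
      by (auto simp: power2_eq_square intro: norm_triangle_le)
  qed
  have int: "(\<lambda>w. f w / (w - z)) contour_integrable_on linepath p q"
    if "closed_segment p q \<subseteq> ?S" "far z" for p q z
  proof (rule contour_integrable_continuous_linepath)
    have "\<And>w. w \<in> closed_segment p q \<Longrightarrow> w - z \<noteq> 0"
      using that \<open>\<delta> > 0\<close> by (force simp: far_def)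
    then show "continuous_on (closed_segment p q) (\<lambda>w. f w / (w - z))"
      using that by (intro continuous_intros continuous_on_subset[OF f]) auto
  qed
  have main: "\<exists>l. snd ` set l \<subseteq> ?S \<and>
      (\<forall>z. far z \<longrightarrow> cmod (contour_integral (linepath p q) (\<lambda>w. f w / (w - z)) - pole_sum l z) \<le> \<mu> * dist p q)"
    if "closed_segment p q \<subseteq> ?S" "dist p q \<le> 2 ^ n * \<eta>" for n p q
    using that
  proof (induction n arbitrary: p q)
    case 0
    let ?l = "[((q - p) * f p, p)]"
    have "cmod (contour_integral (linepath p q) (\<lambda>w. f w / (w - z)) - pole_sum ?l z) \<le> \<mu> * dist p q"
      if z: "far z" for z
    proof -
      have "((\<lambda>w. f w / (w - z) - f p / (p - z)) has_contour_integral
          (contour_integral (linepath p q) (\<lambda>w. f w / (w - z)) - f p / (p - z) * (q - p))) (linepath p q)"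
        by (intro has_contour_integral_diff has_contour_integral_integral int[OF 0(1) z]
            has_contour_integral_const_linepath)
      moreover have "cmod (f w / (w - z) - f p / (p - z)) \<le> \<mu>" if "w \<in> closed_segment p q" for w
        using that 0 z by (intro osc) (auto simp: dist_commute dest: dist_in_closed_segment(1))
      ultimately have "cmod (contour_integral (linepath p q) (\<lambda>w. f w / (w - z)) - f p / (p - z) * (q - p))
          \<le> \<mu> * cmod (q - p)"
        using mu by (intro has_contour_integral_bound_linepath) auto
      then show ?thesis
        by (simp add: dist_norm norm_minus_commute mult.commute)
    qed
    moreover have "p \<in> ?S" using 0(1) by auto
    ultimately show ?case by (intro exI[of _ ?l]) auto
  next
    case (Suc n)
    let ?m = "midpoint p q"
    have m: "?m \<in> closed_segment p q" by simp
    then have sub: "closed_segment p ?m \<subseteq> ?S" "closed_segment ?m q \<subseteq> ?S"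
      using Suc.prems(1) by (meson closed_segment_subset convex_closed_segment ends_in_segment(1,2) order_trans)+
    have d: "dist p ?m = dist p q / 2" "dist ?m q = dist p q / 2"
      by (auto simp: dist_midpoint)
    obtain l1 where l1: "snd ` set l1 \<subseteq> ?S" 
      "\<And>z. far z \<Longrightarrow> cmod (contour_integral (linepath p ?m) (\<lambda>w. f w / (w - z)) - pole_sum l1 z) \<le> \<mu> * dist p ?m"
      using Suc.IH[OF sub(1)] Suc.prems(2) d by auto
    obtain l2 where l2: "snd ` set l2 \<subseteq> ?S" 
      "\<And>z. far z \<Longrightarrow> cmod (contour_integral (linepath ?m q) (\<lambda>w. f w / (w - z)) - pole_sum l2 z) \<le> \<mu> * dist ?m q"
      using Suc.IH[OF sub(2)] Suc.prems(2) d by auto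
    have "cmod (contour_integral (linepath p q) (\<lambda>w. f w / (w - z)) - pole_sum (l1 @ l2) z) \<le> \<mu> * dist p q"
      if z: "far z" for z
    proof -
      have eq: "contour_integral (linepath p q) (\<lambda>w. f w / (w - z)) =
         contour_integral (linepath p ?m) (\<lambda>w. f w / (w - z)) + contour_integral (linepath ?m q) (\<lambda>w. f w / (w - z))"
        by (intro contour_integral_unique has_contour_integral_midpoint has_contour_integral_integral
            int sub z)
      show ?thesis
        using l1(2)[OF z] l2(2)[OF z] norm_triangle_ineq unfolding eq d
        by (smt (verit) add_diff_add field_sum_of_halves distrib_left pole_sum_simps(3))
    qed
    then show ?case
      using l1 l2 by (intro exI[of _ "l1 @ l2"]) auto
  qed
  obtain n where "dist a b / \<eta> < 2 ^ n"
    using real_arch_pow[of 2 "dist a b / \<eta>"] by auto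
  then have "dist a b \<le> 2 ^ n * \<eta>" using eta by (simp add: divide_less_eq)
  from main[OF _ this] obtain l where l: "snd ` set l \<subseteq> ?S"
      "\<And>z. far z \<Longrightarrow> cmod (contour_integral (linepath a b) (\<lambda>w. f w / (w - z)) - pole_sum l z) \<le> \<mu> * dist a b"
    by auto
  have "\<mu> * dist a b \<le> \<epsilon>"
  proof -
    have "dist a b / (1 + dist a b) \<le> 1"
      by (simp add: divide_le_eq add_pos_nonneg)
    then have "\<epsilon> * (dist a b / (1 + dist a b)) \<le> \<epsilon> * 1"
      using \<open>\<epsilon> > 0\<close> by (intro mult_left_mono) auto
    then show ?thesis by (simp add: \<mu>_def)
  qed
  then have "cmod (contour_integral (linepath a b) (\<lambda>w. f w / (w - z)) - pole_sum l z) \<le> \<epsilon>"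
    if "\<And>w. w \<in> closed_segment a b \<Longrightarrow> \<delta> \<le> dist w z" for z
    using l(2)[of z] that by (force simp: far_def)
  with l(1) show ?thesis by (rule that)
qed

lemma polygon_integral_approx:
  assumes "\<forall>(a, b)\<in>set es. continuous_on (closed_segment a b) f" and "\<epsilon> > 0" "\<delta> > 0"
  shows "\<exists>l. snd ` set l \<subseteq> (\<Union>(a, b)\<in>set es. closed_segment a b) \<and>
    (\<forall>z. (\<forall>(a, b)\<in>set es. \<forall>w\<in>closed_segment a b. \<delta> \<le> dist w z) \<longrightarrow>
       cmod ((\<Sum>(a, b)\<leftarrow>es. contour_integral (linepath a b) (\<lambda>w. f w / (w - z))) - pole_sum l z) \<le> \<epsilon>)"
  using assms
proof (induction es arbitrary: \<epsilon>)
  case Nil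
  show ?case by (rule exI[of _ "[]"]) (use Nil in auto)
next
  case (Cons e es)
  obtain a b where e: "e = (a, b)" by force
  have "continuous_on (closed_segment a b) f" "\<epsilon> / 2 > 0"
    using Cons.prems by (auto simp: e)
  from segment_integral_approx[OF this \<open>\<delta> > 0\<close>]
  obtain l1 where l1: "snd ` set l1 \<subseteq> closed_segment a b"
    "\<And>z. (\<And>w. w \<in> closed_segment a b \<Longrightarrow> \<delta> \<le> dist w z) \<Longrightarrow>
       cmod (contour_integral (linepath a b) (\<lambda>w. f w / (w - z)) - pole_sum l1 z) \<le> \<epsilon> / 2"
    by metis
  obtain l2 where l2: "snd ` set l2 \<subseteq> (\<Union>(a, b)\<in>set es. closed_segment a b)"
    "\<And>z. (\<forall>(a, b)\<in>set es. \<forall>w\<in>closed_segment a b. \<delta> \<le> dist w z) \<Longrightarrow>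
       cmod ((\<Sum>(a, b)\<leftarrow>es. contour_integral (linepath a b) (\<lambda>w. f w / (w - z))) - pole_sum l2 z) \<le> \<epsilon> / 2"
    using Cons.IH[of "\<epsilon> / 2"] Cons.prems by auto
  show ?case
  proof (intro exI[of _ "l1 @ l2"] conjI allI impI)
    fix z assume z: "\<forall>(a, b)\<in>set (e # es). \<forall>w\<in>closed_segment a b. \<delta> \<le> dist w z"
    have 1: "cmod (contour_integral (linepath a b) (\<lambda>w. f w / (w - z)) - pole_sum l1 z) \<le> \<epsilon> / 2"
      using z by (intro l1) (auto simp: e)
    have 2: "cmod ((\<Sum>(a, b)\<leftarrow>es. contour_integral (linepath a b) (\<lambda>w. f w / (w - z))) - pole_sum l2 z) \<le> \<epsilon> / 2"
      using z by (intro l2) auto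
    have "(\<Sum>(a, b)\<leftarrow>e # es. contour_integral (linepath a b) (\<lambda>w. f w / (w - z))) - pole_sum (l1 @ l2) z
      = (contour_integral (linepath a b) (\<lambda>w. f w / (w - z)) - pole_sum l1 z)
       + ((\<Sum>(a, b)\<leftarrow>es. contour_integral (linepath a b) (\<lambda>w. f w / (w - z))) - pole_sum l2 z)"
      by (simp add: e)
    then show "cmod ((\<Sum>(a, b)\<leftarrow>e # es. contour_integral (linepath a b) (\<lambda>w. f w / (w - z))) - pole_sum (l1 @ l2) z) \<le> \<epsilon>"
      using norm_triangle_ineq 1 2 by (smt (verit) field_sum_of_halves)
  qed (use l1 l2 in \<open>auto simp: e\<close>)
qed

text \<open>
  To surround a compact set by a cycle, take the squares of a fine mesh that meet it.  Summing the boundary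
  integrals of these squares, each edge between two of them cancels.  The cancellation is a reindexing
  along the shift \<open>\<tau>\<close> to the neighbouring square.
\<close>

lemma sum_shift_diff:
  fixes H :: "'a \<Rightarrow> complex"
  assumes "finite G" "bij \<tau>"
  shows "(\<Sum>g\<in>G. H g) - (\<Sum>g\<in>G. H (\<tau> g)) = (\<Sum>g\<in>G - \<tau> ` G. H g) - (\<Sum>g\<in>\<tau> ` G - G. H g)"
proof -
  have inj: "inj_on \<tau> G" using \<open>bij \<tau>\<close> by (meson bij_def inj_on_subset subset_UNIV)
  have "(\<Sum>g\<in>G. H (\<tau> g)) = (\<Sum>g\<in>\<tau> ` G. H g)"
    by (simp add: sum.reindex[OF inj])
  moreover have "(\<Sum>g\<in>G. H g) = (\<Sum>g\<in>G \<inter> \<tau> ` G. H g) + (\<Sum>g\<in>G - \<tau> ` G. H g)"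
    using \<open>finite G\<close> by (simp add: sum.Int_Diff)
  moreover have "(\<Sum>g\<in>\<tau> ` G. H g) = (\<Sum>g\<in>G \<inter> \<tau> ` G. H g) + (\<Sum>g\<in>\<tau> ` G - G. H g)"
    using sum.Int_Diff[of "\<tau> ` G" H G] \<open>finite G\<close> by (simp add: Int_commute)
  ultimately show ?thesis by simp
qed

definition grid_pt :: "real \<Rightarrow> int \<times> int \<Rightarrow> complex" where
  "grid_pt \<eta> g = Complex (\<eta> * of_int (fst g)) (\<eta> * of_int (snd g))"

definition grid_sq :: "real \<Rightarrow> int \<times> int \<Rightarrow> complex set" where
  "grid_sq \<eta> g = cbox (grid_pt \<eta> g) (grid_pt \<eta> (fst g + 1, snd g + 1))"

definition right_nb :: "int \<times> int \<Rightarrow> int \<times> int" where "right_nb g = (fst g + 1, snd g)"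
definition upper_nb :: "int \<times> int \<Rightarrow> int \<times> int" where "upper_nb g = (fst g, snd g + 1)"

lemma bij_nb: "bij right_nb" "bij upper_nb"
proof -
  show "bij right_nb"
    by (rule bij_betw_byWitness[where f' = "\<lambda>g. (fst g - 1, snd g)"]) (auto simp: right_nb_def)
  show "bij upper_nb"
    by (rule bij_betw_byWitness[where f' = "\<lambda>g. (fst g, snd g - 1)"]) (auto simp: upper_nb_def)
qed

lemma grid_edges_subset:
  assumes "\<eta> > 0"
  shows "closed_segment (grid_pt \<eta> g) (grid_pt \<eta> (right_nb g)) \<subseteq> grid_sq \<eta> g"
    "closed_segment (grid_pt \<eta> (upper_nb g)) (grid_pt \<eta> (right_nb (upper_nb g))) \<subseteq> grid_sq \<eta> g"
    "closed_segment (grid_pt \<eta> g) (grid_pt \<eta> (upper_nb g)) \<subseteq> grid_sq \<eta> g"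
    "closed_segment (grid_pt \<eta> (right_nb g)) (grid_pt \<eta> (upper_nb (right_nb g))) \<subseteq> grid_sq \<eta> g"
  using assms unfolding grid_sq_def
  by (intro closed_segment_subset convex_box;
      auto simp: grid_pt_def right_nb_def upper_nb_def in_cbox_complex_iff)+

lemma contour_integral_rectpath:
  assumes "f contour_integrable_on (rectpath a b)"
  shows "contour_integral (rectpath a b) f =
     contour_integral (linepath a (Complex (Re b) (Im a))) f
   + contour_integral (linepath (Complex (Re b) (Im a)) b) f
   - contour_integral (linepath (Complex (Re a) (Im b)) b) f
   - contour_integral (linepath a (Complex (Re a) (Im b))) f"
proof -
  let ?p = "Complex (Re b) (Im a)" and ?q = "Complex (Re a) (Im b)"
  have rp: "rectpath a b = linepath a ?p +++ linepath ?p b +++ linepath b ?q +++ linepath ?q a"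
    by (simp add: rectpath_def Let_def)
  have i: "f contour_integrable_on linepath a ?p" "f contour_integrable_on linepath ?p b"
      "f contour_integrable_on linepath b ?q" "f contour_integrable_on linepath ?q a"
    using assms unfolding rp by (auto dest: contour_integrable_joinD1 contour_integrable_joinD2)
  have "contour_integral (rectpath a b) f = contour_integral (linepath a ?p) f
     + (contour_integral (linepath ?p b) f + (contour_integral (linepath b ?q) f + contour_integral (linepath ?q a) f))"
    unfolding rp using i by (simp add: contour_integrable_join)
  moreover have "contour_integral (linepath b ?q) f = - contour_integral (linepath ?q b) f"
    using contour_integral_reversepath[of "linepath ?q b" f] by simp
  moreover have "contour_integral (linepath ?q a) f = - contour_integral (linepath a ?q) f"
    using contour_integral_reversepath[of "linepath a ?q" f] by simp
  ultimately show ?thesis by simp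
qed

text \<open>
  The four edges are written as two pairs of parallel edges, each a difference along a shift, which is
  the form in which \<open>sum_shift_diff\<close> applies.
\<close>

lemma Cauchy_grid_sq:
  fixes f :: "complex \<Rightarrow> complex"
  assumes "\<eta> > 0" and hol: "f holomorphic_on grid_sq \<eta> g"
    and z: "z \<in> box (grid_pt \<eta> g) (grid_pt \<eta> (fst g + 1, snd g + 1)) \<or> z \<notin> grid_sq \<eta> g"
  defines "I \<equiv> \<lambda>a b. contour_integral (linepath a b) (\<lambda>w. f w / (w - z))"
  shows "I (grid_pt \<eta> g) (grid_pt \<eta> (right_nb g)) - I (grid_pt \<eta> (upper_nb g)) (grid_pt \<eta> (right_nb (upper_nb g)))
     - (I (grid_pt \<eta> g) (grid_pt \<eta> (upper_nb g)) - I (grid_pt \<eta> (right_nb g)) (grid_pt \<eta> (upper_nb (right_nb g))))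
     = (if z \<in> grid_sq \<eta> g then 2 * of_real pi * \<i> * f z else 0)"
proof -
  let ?a = "grid_pt \<eta> g" and ?b = "grid_pt \<eta> (fst g + 1, snd g + 1)"
  have ab: "Re ?a < Re ?b" "Im ?a < Im ?b" using \<open>\<eta> > 0\<close> by (auto simp: grid_pt_def)
  have sub: "path_image (rectpath ?a ?b) \<subseteq> grid_sq \<eta> g"
    unfolding grid_sq_def using ab by (intro path_image_rectpath_subset_cbox) auto
  have *: "((\<lambda>w. f w / (w - z)) has_contour_integral (if z \<in> grid_sq \<eta> g then 2 * of_real pi * \<i> * f z else 0)) (rectpath ?a ?b)"
  proof (cases "z \<in> grid_sq \<eta> g")
    case True
    then have zb: "z \<in> box ?a ?b" using z by simp
    have "((\<lambda>w. f w / (w - z)) has_contour_integral (2 * pi * \<i> * winding_number (rectpath ?a ?b) z * f z)) (rectpath ?a ?b)"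
    proof (rule Cauchy_integral_formula_convex_simple[where S = "grid_sq \<eta> g"])
      show "z \<in> interior (grid_sq \<eta> g)" using zb by (simp add: grid_sq_def interior_cbox)
      show "path_image (rectpath ?a ?b) \<subseteq> grid_sq \<eta> g - {z}"
        using sub zb ab path_image_rectpath_inter_box[of ?a ?b] by auto
    qed (use hol in \<open>auto simp: grid_sq_def\<close>)
    with True show ?thesis by (simp add: winding_number_rectpath[OF zb])
  next
    case False
    have "((\<lambda>w. f w / (w - z)) has_contour_integral 0) (rectpath ?a ?b)"
    proof (rule Cauchy_theorem_convex_simple[where S = "grid_sq \<eta> g"])
      show "(\<lambda>w. f w / (w - z)) holomorphic_on grid_sq \<eta> g"
        using False by (intro holomorphic_intros hol) auto
    qed (use sub in \<open>auto simp: grid_sq_def\<close>)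
    with False show ?thesis by simp
  qed
  have pts: "Complex (Re ?b) (Im ?a) = grid_pt \<eta> (right_nb g)" "Complex (Re ?a) (Im ?b) = grid_pt \<eta> (upper_nb g)"
    "grid_pt \<eta> (upper_nb (right_nb g)) = ?b" "grid_pt \<eta> (right_nb (upper_nb g)) = ?b"
    by (auto simp: grid_pt_def right_nb_def upper_nb_def)
  show ?thesis
    using contour_integral_rectpath[OF has_contour_integral_integrable[OF *]] contour_integral_unique[OF *]
    unfolding I_def pts by simp
qed

lemma grid_sq_dist:
  assumes "w \<in> grid_sq \<eta> g" "z \<in> grid_sq \<eta> g"
  shows "dist w z \<le> 2 * \<eta>"
proof -
  have "\<bar>Re (w - z)\<bar> \<le> \<eta>" "\<bar>Im (w - z)\<bar> \<le> \<eta>"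
    using assms by (auto simp: grid_sq_def in_cbox_complex_iff grid_pt_def algebra_simps)
  then show ?thesis using cmod_le[of "w - z"] by (simp add: dist_norm)
qed

lemma finite_grid_meeting:
  assumes "\<eta> > 0" "bounded K"
  shows "finite {g. grid_sq \<eta> g \<inter> K \<noteq> {}}"
proof -
  obtain M where M: "\<And>z. z \<in> K \<Longrightarrow> cmod z \<le> M" using \<open>bounded K\<close> by (auto simp: bounded_iff)
  define N where "N = \<lceil>M / \<eta>\<rceil> + 1"
  have *: "\<bar>k\<bar> \<le> N" if "\<eta> * of_int k \<le> x" "x \<le> \<eta> * (of_int k + 1)" "\<bar>x\<bar> \<le> M" for k x
  proof -
    have "of_int k \<le> M / \<eta>" "- (M / \<eta>) \<le> of_int k + 1"
      using that \<open>\<eta> > 0\<close> by (auto simp: field_simps abs_le_iff)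
    then show ?thesis unfolding N_def by linarith
  qed
  have "{g. grid_sq \<eta> g \<inter> K \<noteq> {}} \<subseteq> {-N..N} \<times> {-N..N}"
  proof
    fix g assume "g \<in> {g. grid_sq \<eta> g \<inter> K \<noteq> {}}"
    then obtain z where z: "z \<in> grid_sq \<eta> g" "z \<in> K" by auto
    have "\<bar>Re z\<bar> \<le> M" "\<bar>Im z\<bar> \<le> M"
      using M[OF z(2)] abs_Re_le_cmod[of z] abs_Im_le_cmod[of z] by auto
    moreover have "\<eta> * of_int (fst g) \<le> Re z" "Re z \<le> \<eta> * (of_int (fst g) + 1)"
      "\<eta> * of_int (snd g) \<le> Im z" "Im z \<le> \<eta> * (of_int (snd g) + 1)"
      using z(1) by (auto simp: grid_sq_def in_cbox_complex_iff grid_pt_def)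
    ultimately have "\<bar>fst g\<bar> \<le> N" "\<bar>snd g\<bar> \<le> N" using * by blast+
    then show "g \<in> {-N..N} \<times> {-N..N}" by (cases g) auto
  qed
  then show ?thesis by (rule finite_subset) auto
qed

text \<open>
  Points on the grid lines are limits of points in the interior of a square that contains them; moving
  diagonally upwards leads into the square given by the two floors.
\<close>

lemma eventually_in_grid_box:
  fixes z :: complex
  assumes "\<eta> > 0"
  defines "g \<equiv> (\<lfloor>Re z / \<eta>\<rfloor>, \<lfloor>Im z / \<eta>\<rfloor>)"
  shows "z \<in> grid_sq \<eta> g"
    "\<forall>\<^sub>F t in at_right 0. z + of_real t * (1 + \<i>) \<in> box (grid_pt \<eta> g) (grid_pt \<eta> (fst g + 1, snd g + 1))"
proof -
  have *: "\<eta> * of_int \<lfloor>x / \<eta>\<rfloor> \<le> x" "x < \<eta> * (of_int \<lfloor>x / \<eta>\<rfloor> + 1)" for x :: real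
  proof -
    have scale: "r \<le> x / \<eta> \<longleftrightarrow> \<eta> * r \<le> x" "x / \<eta> < r \<longleftrightarrow> x < \<eta> * r" for r
      using \<open>\<eta> > 0\<close> by (auto simp: field_simps)
    show "\<eta> * of_int \<lfloor>x / \<eta>\<rfloor> \<le> x" "x < \<eta> * (of_int \<lfloor>x / \<eta>\<rfloor> + 1)"
      unfolding scale[symmetric] by linarith+
  qed
  show "z \<in> grid_sq \<eta> g"
    using *[of "Re z"] *[of "Im z"] by (auto simp: g_def grid_sq_def in_cbox_complex_iff grid_pt_def)
  define d where "d = min (\<eta> * (of_int (fst g) + 1) - Re z) (\<eta> * (of_int (snd g) + 1) - Im z)"
  have "d > 0" using *[of "Re z"] *[of "Im z"] by (auto simp: d_def g_def)
  have "\<forall>\<^sub>F t in at_right 0. t \<in> {0<..<d}"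
    using eventually_at_right_field \<open>d > 0\<close> by (metis greaterThanLessThan_iff)
  then show "\<forall>\<^sub>F t in at_right 0. z + of_real t * (1 + \<i>) \<in> box (grid_pt \<eta> g) (grid_pt \<eta> (fst g + 1, snd g + 1))"
  proof eventually_elim
    case (elim t)
    then show ?case
      using *[of "Re z"] *[of "Im z"]
      by (auto simp: in_box_complex_iff grid_pt_def g_def d_def)
  qed
qed

lemma box_disjoint_grid_sq:
  assumes "\<eta> > 0" "z \<in> box (grid_pt \<eta> g) (grid_pt \<eta> (fst g + 1, snd g + 1))" "z \<in> grid_sq \<eta> h"
  shows "h = g"
proof -
  have *: "k = j" if "\<eta> * of_int k < x" "x < \<eta> * (of_int k + 1)" "\<eta> * of_int j \<le> x" "x \<le> \<eta> * (of_int j + 1)" for k j :: int and x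
  proof -
    have "of_int k < x / \<eta>" "x / \<eta> < of_int k + 1" "of_int j \<le> x / \<eta>" "x / \<eta> \<le> of_int j + 1"
      using that \<open>\<eta> > 0\<close> by (auto simp: field_simps)
    then show ?thesis by linarith
  qed
  have "fst g = fst h" 
    by (rule *[of _ "Re z"]) (use assms in \<open>auto simp: grid_sq_def in_cbox_complex_iff in_box_complex_iff grid_pt_def\<close>)
  moreover have "snd g = snd h"
    by (rule *[of _ "Im z"]) (use assms in \<open>auto simp: grid_sq_def in_cbox_complex_iff in_box_complex_iff grid_pt_def\<close>)
  ultimately show ?thesis by (simp add: prod_eq_iff)
qed

text \<open>
  An edge that survives the cancellation separates a square in \<open>G\<close> from one outside \<open>G\<close>.  If \<open>G\<close> consists of the
  squares that meet a set, such an edge therefore misses that set.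
\<close>

lemma grid_boundary_edges:
  assumes "\<eta> > 0" "finite G" and hol: "\<forall>g\<in>G. f holomorphic_on grid_sq \<eta> g"
  shows "\<exists>es.
    (\<forall>(a, b)\<in>set es. \<exists>g\<in>G. \<exists>h. h \<notin> G \<and> closed_segment a b \<subseteq> grid_sq \<eta> g \<inter> grid_sq \<eta> h) \<and>
    (\<forall>z. (\<forall>g\<in>G. z \<in> box (grid_pt \<eta> g) (grid_pt \<eta> (fst g + 1, snd g + 1)) \<or> z \<notin> grid_sq \<eta> g) \<longrightarrow>
       (\<Sum>(a, b)\<leftarrow>es. contour_integral (linepath a b) (\<lambda>w. f w / (w - z)))
        = (\<Sum>g\<in>G. if z \<in> grid_sq \<eta> g then 2 * of_real pi * \<i> * f z else 0))"
proof -
  define hor where "hor g = (grid_pt \<eta> g, grid_pt \<eta> (right_nb g))" for g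
  define ver where "ver g = (grid_pt \<eta> g, grid_pt \<eta> (upper_nb g))" for g
  define seg where "seg e = closed_segment (fst e) (snd e)" for e :: "complex \<times> complex"
  have seg_swap: "seg (prod.swap e) = seg e" for e
    by (simp add: seg_def closed_segment_commute)
  have fin: "finite (upper_nb ` G)" "finite (right_nb ` G)" using \<open>finite G\<close> by auto
  obtain as where as: "set as = G - upper_nb ` G" "distinct as" 
    using finite_distinct_list \<open>finite G\<close> by (metis finite_Diff)
  obtain bs where bs: "set bs = upper_nb ` G - G" "distinct bs" 
    using finite_distinct_list fin by (metis finite_Diff)
  obtain cs where cs: "set cs = G - right_nb ` G" "distinct cs" 
    using finite_distinct_list \<open>finite G\<close> by (metis finite_Diff)
  obtain ds where ds: "set ds = right_nb ` G - G" "distinct ds" 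
    using finite_distinct_list fin by (metis finite_Diff)
  define es where "es = map hor as @ map (prod.swap \<circ> hor) bs @ map (prod.swap \<circ> ver) cs @ map ver ds"
  have edges: "seg (hor g) \<subseteq> grid_sq \<eta> g" "seg (hor (upper_nb g)) \<subseteq> grid_sq \<eta> g"
     "seg (ver g) \<subseteq> grid_sq \<eta> g" "seg (ver (right_nb g)) \<subseteq> grid_sq \<eta> g" for g
    using grid_edges_subset[OF \<open>\<eta> > 0\<close>, of g] by (auto simp: seg_def hor_def ver_def)
  have sep: "\<exists>g\<in>G. \<exists>h. h \<notin> G \<and> seg e \<subseteq> grid_sq \<eta> g \<inter> grid_sq \<eta> h" if e: "e \<in> set es" for e
  proof -
    consider g where "e = hor g" "g \<in> G" "g \<notin> upper_nb ` G"
      | g where "e = prod.swap (hor (upper_nb g))" "g \<in> G" "upper_nb g \<notin> G"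
      | g where "e = prod.swap (ver g)" "g \<in> G" "g \<notin> right_nb ` G"
      | g where "e = ver (right_nb g)" "g \<in> G" "right_nb g \<notin> G"
      using e as bs cs ds unfolding es_def by (auto simp del: split_paired_Ex split_paired_All)
    then show ?thesis
    proof cases
      case 1
      obtain h where h: "g = upper_nb h" using bij_nb(2) by (metis bij_pointE)
      show ?thesis using 1 h edges(1)[of g] edges(2)[of h] by (intro bexI[of _ g] exI[of _ h]) auto
    next
      case 2
      show ?thesis unfolding 2(1) seg_swap
        using 2 edges(1)[of "upper_nb g"] edges(2)[of g] by (intro bexI[of _ g] exI[of _ "upper_nb g"]) auto
    next
      case 3
      obtain h where h: "g = right_nb h" using bij_nb(1) by (metis bij_pointE)
      show ?thesis unfolding 3(1) seg_swap 
        using 3 h edges(3)[of g] edges(4)[of h] by (intro bexI[of _ g] exI[of _ h]) auto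
    next
      case 4
      show ?thesis unfolding 4(1)
        using 4 edges(3)[of "right_nb g"] edges(4)[of g] by (intro bexI[of _ g] exI[of _ "right_nb g"]) auto
    qed
  qed
  show ?thesis
  proof (intro exI[of _ es] conjI ballI allI impI)
    fix e assume "e \<in> set es"
    from sep[OF this] show "case e of (a, b) \<Rightarrow> \<exists>g\<in>G. \<exists>h. h \<notin> G \<and> closed_segment a b \<subseteq> grid_sq \<eta> g \<inter> grid_sq \<eta> h"
      by (simp add: seg_def case_prod_unfold)
  next
    fix z
    assume z: "\<forall>g\<in>G. z \<in> box (grid_pt \<eta> g) (grid_pt \<eta> (fst g + 1, snd g + 1)) \<or> z \<notin> grid_sq \<eta> g"
    define J where "J e = contour_integral (linepath (fst e) (snd e)) (\<lambda>w. f w / (w - z))" for e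
    have swap: "J (prod.swap e) = - J e" for e
      using contour_integral_reversepath[of "linepath (fst e) (snd e)" "\<lambda>w. f w / (w - z)"]
      by (simp add: J_def)
    have "(\<Sum>(a, b)\<leftarrow>es. contour_integral (linepath a b) (\<lambda>w. f w / (w - z))) = sum_list (map J es)"
      by (intro arg_cong[where f = sum_list] map_cong) (auto simp: J_def)
    also have "\<dots> = (\<Sum>g\<in>set as. J (hor g)) + ((\<Sum>g\<in>set bs. - J (hor g)) + ((\<Sum>g\<in>set cs. - J (ver g)) + (\<Sum>g\<in>set ds. J (ver g))))"
      using as bs cs ds by (simp add: es_def o_def swap sum_list_distinct_conv_sum_set)
    also have "\<dots> = ((\<Sum>g\<in>G. J (hor g)) - (\<Sum>g\<in>G. J (hor (upper_nb g)))) - ((\<Sum>g\<in>G. J (ver g)) - (\<Sum>g\<in>G. J (ver (right_nb g))))"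
      unfolding sum_shift_diff[OF \<open>finite G\<close> bij_nb(2), of "\<lambda>g. J (hor g)"]
        sum_shift_diff[OF \<open>finite G\<close> bij_nb(1), of "\<lambda>g. J (ver g)"]
      by (simp add: as bs cs ds sum_negf)
    also have "\<dots> = (\<Sum>g\<in>G. J (hor g) - J (hor (upper_nb g)) - (J (ver g) - J (ver (right_nb g))))"
      by (simp add: sum_subtractf)
    also have "\<dots> = (\<Sum>g\<in>G. if z \<in> grid_sq \<eta> g then 2 * of_real pi * \<i> * f z else 0)"
    proof (rule sum.cong[OF refl])
      fix g assume g: "g \<in> G"
      show "J (hor g) - J (hor (upper_nb g)) - (J (ver g) - J (ver (right_nb g)))
        = (if z \<in> grid_sq \<eta> g then 2 * of_real pi * \<i> * f z else 0)"
        using Cauchy_grid_sq[OF \<open>\<eta> > 0\<close> bspec[OF hol g] bspec[OF z g]] by (simp add: J_def hor_def ver_def)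
    qed
    finally show "(\<Sum>(a, b)\<leftarrow>es. contour_integral (linepath a b) (\<lambda>w. f w / (w - z)))
        = (\<Sum>g\<in>G. if z \<in> grid_sq \<eta> g then 2 * of_real pi * \<i> * f z else 0)" .
  qed
qed

text \<open>
  Runge's theorem without control over the components of the complement.  The Cauchy integral over the
  surviving edges reproduces \<open>f\<close> on \<open>K\<close> and vanishes outside \<open>\<Omega>\<close>, and the edges have positive distance from
  both; so one Riemann sum approximates \<open>f\<close> on \<open>K\<close> and \<open>0\<close> off \<open>\<Omega>\<close>.  For \<open>f\<close> that is locally given by different
  formulas on the parts of a disconnected \<open>\<Omega>\<close> this glues unrelated behaviour together.
\<close>

theorem Runge_pole_sums:
  assumes "open \<Omega>" "compact K" "K \<subseteq> \<Omega>" "f holomorphic_on \<Omega>" "\<epsilon> > 0"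
  obtains l where "snd ` set l \<subseteq> \<Omega> - K"
    "\<And>z. z \<in> K \<Longrightarrow> cmod (f z - pole_sum l z) \<le> \<epsilon>"
    "\<And>z. z \<notin> \<Omega> \<Longrightarrow> cmod (pole_sum l z) \<le> \<epsilon>"
proof -
  obtain e where e: "e > 0" "(\<Union>x\<in>K. cball x e) \<subseteq> \<Omega>"
    using compact_subset_open_imp_cball_epsilon_subset[OF assms(2,1,3)] by blast
  define \<eta> where "\<eta> = e / 2"
  have eta: "\<eta> > 0" using e by (simp add: \<eta>_def)
  define G where "G = {g. grid_sq \<eta> g \<inter> K \<noteq> {}}"
  have finG: "finite G" unfolding G_def using eta assms compact_imp_bounded by (intro finite_grid_meeting)
  have sqO: "grid_sq \<eta> g \<subseteq> \<Omega>" if g: "g \<in> G" for g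
  proof
    fix w assume w: "w \<in> grid_sq \<eta> g"
    obtain x where x: "x \<in> K" "x \<in> grid_sq \<eta> g" using g by (auto simp: G_def)
    have "dist x w \<le> e" using grid_sq_dist[OF x(2) w] by (simp add: \<eta>_def)
    then have "w \<in> (\<Union>x\<in>K. cball x e)" using x by auto
    then show "w \<in> \<Omega>" using e(2) by blast
  qed
  have "\<forall>g\<in>G. f holomorphic_on grid_sq \<eta> g"
    using sqO holomorphic_on_subset[OF assms(4)] by blast
  from grid_boundary_edges[OF eta finG this] obtain es where es:
    "\<And>a b. (a, b) \<in> set es \<Longrightarrow> \<exists>g\<in>G. \<exists>h. h \<notin> G \<and> closed_segment a b \<subseteq> grid_sq \<eta> g \<inter> grid_sq \<eta> h"
    "\<And>z. (\<forall>g\<in>G. z \<in> box (grid_pt \<eta> g) (grid_pt \<eta> (fst g + 1, snd g + 1)) \<or> z \<notin> grid_sq \<eta> g) \<Longrightarrow>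
       (\<Sum>(a, b)\<leftarrow>es. contour_integral (linepath a b) (\<lambda>w. f w / (w - z)))
        = (\<Sum>g\<in>G. if z \<in> grid_sq \<eta> g then 2 * of_real pi * \<i> * f z else 0)"
    by blast
  define E where "E = (\<Union>(a, b)\<in>set es. closed_segment a b)"
  have "compact E" unfolding E_def by (intro compact_UN) auto
  have segO: "closed_segment a b \<subseteq> \<Omega> - K" if ab: "(a, b) \<in> set es" for a b
  proof -
    obtain g h where gh: "g \<in> G" "h \<notin> G" "closed_segment a b \<subseteq> grid_sq \<eta> g \<inter> grid_sq \<eta> h"
      using es(1)[OF ab] by blast
    have "grid_sq \<eta> h \<inter> K = {}" using gh(2) by (simp add: G_def)
    with gh sqO[OF gh(1)] show ?thesis by blast
  qed
  then have "E \<subseteq> \<Omega> - K" unfolding E_def by auto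
  moreover have "open (\<Omega> - K)" using assms by (simp add: compact_imp_closed open_Diff)
  ultimately obtain \<delta> where \<delta>: "\<delta> > 0" "(\<Union>x\<in>E. cball x \<delta>) \<subseteq> \<Omega> - K"
    using compact_subset_open_imp_cball_epsilon_subset[OF \<open>compact E\<close>] by metis
  have cont: "\<forall>(a, b)\<in>set es. continuous_on (closed_segment a b) f"
    using segO holomorphic_on_imp_continuous_on[OF assms(4)] by (auto intro: continuous_on_subset)
  have "2 * pi * \<epsilon> > 0" "\<delta> / 2 > 0" using \<open>\<epsilon> > 0\<close> \<delta> by auto
  from polygon_integral_approx[where es = es, OF cont this]
  obtain l0 where l0: "snd ` set l0 \<subseteq> E" and
    l0': "\<forall>z. (\<forall>(a, b)\<in>set es. \<forall>w\<in>closed_segment a b. \<delta> / 2 \<le> dist w z) \<longrightarrow>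
       cmod ((\<Sum>(a, b)\<leftarrow>es. contour_integral (linepath a b) (\<lambda>w. f w / (w - z))) - pole_sum l0 z) \<le> 2 * pi * \<epsilon>"
    unfolding E_def[symmetric] by (elim exE conjE) (rule that)
  have l0_approx: "cmod ((\<Sum>(a, b)\<leftarrow>es. contour_integral (linepath a b) (\<lambda>w. f w / (w - z))) - pole_sum l0 z) \<le> 2 * pi * \<epsilon>"
    if "\<And>w. w \<in> E \<Longrightarrow> \<delta> / 2 \<le> dist w z" for z
  proof -
    have "\<forall>(a, b)\<in>set es. \<forall>w\<in>closed_segment a b. \<delta> / 2 \<le> dist w z"
      using that by (auto simp: E_def)
    then show ?thesis using l0' by (elim allE impE)
  qed
  define l where "l = map (\<lambda>(c, w). (1 / (2 * of_real pi * \<i>) * c, w)) l0"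
  have snd_l: "snd ` set l = snd ` set l0" by (force simp: l_def)
  have l: "pole_sum l z = pole_sum l0 z / (2 * of_real pi * \<i>)" for z
    using pole_sum_scale[of "1 / (2 * of_real pi * \<i>)" l0] by (simp add: l_def)
  \<comment> \<open>off the grid lines this is Cauchy's formula; on them it follows by continuity\<close>
  have main: "cmod ((if z \<in> K then f z else 0) - pole_sum l z) \<le> \<epsilon>" if z: "z \<in> K \<or> z \<notin> \<Omega>" for z
  proof -
    define g where "g = (\<lfloor>Re z / \<eta>\<rfloor>, \<lfloor>Im z / \<eta>\<rfloor>)"
    define zt where "zt t = z + of_real t * (1 + \<i>)" for t
    have zg: "z \<in> grid_sq \<eta> g" "\<forall>\<^sub>F t in at_right 0. zt t \<in> box (grid_pt \<eta> g) (grid_pt \<eta> (fst g + 1, snd g + 1))"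
      using eventually_in_grid_box[OF eta, of z] by (auto simp: g_def zt_def)
    have gG: "g \<in> G \<longleftrightarrow> z \<in> K" using z zg(1) sqO[of g] by (auto simp: G_def)
    have far: "\<delta> < dist w z" if "w \<in> E" for w
      using \<delta>(2) that z \<open>K \<subseteq> \<Omega>\<close> by force
    have lim: "(zt \<longlongrightarrow> z) (at_right 0)"
      unfolding zt_def by (auto intro!: tendsto_eq_intros)
    have "\<forall>\<^sub>F t in at_right 0. dist (zt t) z < \<delta> / 2"
      using lim \<delta> by (intro tendstoD) auto
    with zg(2) have ev: "\<forall>\<^sub>F t in at_right 0. cmod ((if z \<in> K then f (zt t) else 0) - pole_sum l (zt t)) \<le> \<epsilon>"
    proof eventually_elim
      case (elim t)
      have 1: "h = g" if "zt t \<in> grid_sq \<eta> h" for h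
        using box_disjoint_grid_sq[OF eta elim(1) that] .
      have "\<delta> / 2 \<le> dist w (zt t)" if "w \<in> E" for w
        using far[OF that] elim(2) dist_triangle[of w z "zt t"] by linarith
      then have 2: "cmod ((\<Sum>(a, b)\<leftarrow>es. contour_integral (linepath a b) (\<lambda>w. f w / (w - zt t))) - pole_sum l0 (zt t)) \<le> 2 * pi * \<epsilon>"
        by (rule l0_approx)
      have "(\<Sum>(a, b)\<leftarrow>es. contour_integral (linepath a b) (\<lambda>w. f w / (w - zt t)))
        = (\<Sum>h\<in>G. if zt t \<in> grid_sq \<eta> h then 2 * of_real pi * \<i> * f (zt t) else 0)"
        using elim(1) 1 by (intro es(2)) auto
      also have "\<dots> = (\<Sum>h\<in>G. if h = g then 2 * of_real pi * \<i> * f (zt t) else 0)"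
        proof (rule sum.cong[OF refl])
        fix h
        have "zt t \<in> grid_sq \<eta> g" using elim(1) box_subset_cbox by (force simp: grid_sq_def)
        then have "zt t \<in> grid_sq \<eta> h \<longleftrightarrow> h = g" using 1 by blast
        then show "(if zt t \<in> grid_sq \<eta> h then 2 * of_real pi * \<i> * f (zt t) else 0)
          = (if h = g then 2 * of_real pi * \<i> * f (zt t) else 0)" by simp
      qed
      also have "\<dots> = 2 * of_real pi * \<i> * (if z \<in> K then f (zt t) else 0)"
        using finG gG by simp
      finally have "(\<Sum>(a, b)\<leftarrow>es. contour_integral (linepath a b) (\<lambda>w. f w / (w - zt t))) - pole_sum l0 (zt t)
         = 2 * of_real pi * \<i> * ((if z \<in> K then f (zt t) else 0) - pole_sum l (zt t))"
        by (simp add: l algebra_simps)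
      with 2 have "2 * pi * cmod ((if z \<in> K then f (zt t) else 0) - pole_sum l (zt t)) \<le> 2 * pi * \<epsilon>"
        by (simp only: norm_mult) simp
      then show ?case by simp
    qed
    have "z \<notin> snd ` set l" using snd_l l0 far \<delta>(1) by fastforce
    then have "isCont (pole_sum l) z"
      using holomorphic_pole_sum[of "- snd ` set l" l]
      by (intro continuous_on_interior[of "- snd ` set l"] holomorphic_on_imp_continuous_on)
         (auto simp: interior_open open_Compl finite_imp_closed)
    then have "((\<lambda>t. pole_sum l (zt t)) \<longlongrightarrow> pole_sum l z) (at_right 0)"
      by (rule isCont_tendsto_compose[OF _ lim])
    moreover have "((\<lambda>t. if z \<in> K then f (zt t) else 0) \<longlongrightarrow> (if z \<in> K then f z else 0)) (at_right 0)"
    proof (cases "z \<in> K")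
      case True
      then have "isCont f z"
        using assms by (meson continuous_on_eq_continuous_at holomorphic_on_imp_continuous_on subsetD)
      then show ?thesis using True by (simp add: isCont_tendsto_compose[OF _ lim])
    qed auto
    ultimately have "((\<lambda>t. cmod ((if z \<in> K then f (zt t) else 0) - pole_sum l (zt t))) \<longlongrightarrow>
        cmod ((if z \<in> K then f z else 0) - pole_sum l z)) (at_right 0)"
      by (intro tendsto_intros)
    then show ?thesis
      by (rule tendsto_upperbound[OF _ ev]) simp
  qed
  show ?thesis
  proof (rule that[of l])
    show "snd ` set l \<subseteq> \<Omega> - K" using snd_l l0 \<open>E \<subseteq> \<Omega> - K\<close> by auto
    show "cmod (f z - pole_sum l z) \<le> \<epsilon>" if "z \<in> K" for z using main[of z] that by simp
    show "cmod (pole_sum l z) \<le> \<epsilon>" if "z \<notin> \<Omega>" for z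
      using main[of z] that \<open>K \<subseteq> \<Omega>\<close> by (auto simp: subset_iff split: if_splits)
  qed
qed

section \<open>A function with a wandering copy of a given continuum\<close>

text \<open>
  If \<open>G\<close> is uniformly close to the affine map \<open>w \<mapsto> c + w/2\<close>, then the error is Lipschitz with a small
  constant by Cauchy's estimate, so \<open>G\<close> is still injective.  No convexity of \<open>V\<close> is available, hence the
  separate treatment of points that are far from each other.
\<close>

lemma inj_on_near_affine:
  assumes hol: "G holomorphic_on (\<Union>x\<in>V. ball x \<delta>)" and "\<delta> > 0"
    and near: "\<And>w. w \<in> (\<Union>x\<in>V. ball x \<delta>) \<Longrightarrow> cmod (G w - (c + w / 2)) \<le> \<delta> / 16"
  shows "inj_on G V"
proof (rule inj_onI)
  fix v w assume v: "v \<in> V" and w: "w \<in> V" and eq: "G v = G w"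
  define h where "h z = G z - (c + z / 2)" for z
  let ?U = "\<Union>x\<in>V. ball x \<delta>"
  have holh: "h holomorphic_on ?U" unfolding h_def by (intro holomorphic_intros hol) auto
  have hd: "cmod (h z) \<le> \<delta> / 16" if "z \<in> ?U" for z using near[OF that] by (simp add: h_def)
  have vw: "(v - w) / 2 = h w - h v" using eq by (simp add: h_def field_simps)
  have "v \<in> ?U" "w \<in> ?U" using v w \<open>\<delta> > 0\<close> by (blast intro: centre_in_ball[THEN iffD2])+
  then have "cmod (h w - h v) \<le> \<delta> / 8"
    using hd[of v] hd[of w] norm_triangle_ineq4[of "h w" "h v"] by simp
  moreover have "cmod (v - w) / 2 = cmod (h w - h v)"
    unfolding vw[symmetric] by (simp add: norm_divide)
  ultimately have close: "cmod (v - w) \<le> \<delta> / 2" using \<open>\<delta> > 0\<close> by linarith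
  have lip: "cmod (h w - h v) \<le> 1/4 * cmod (w - v)"
  proof (rule field_differentiable_bound[where S = "cball v (\<delta> / 2)" and f' = "deriv h"])
    fix z assume z: "z \<in> cball v (\<delta> / 2)"
    have subU: "cball z (\<delta> / 2 - e) \<subseteq> ?U" if "e > 0" for e
    proof
      fix y assume "y \<in> cball z (\<delta> / 2 - e)"
      then have "dist v y < \<delta>"
        using z that dist_triangle[of v y z] by (auto simp: dist_commute)
      with v show "y \<in> ?U" by auto
    qed
    have "z \<in> ?U" using z v \<open>\<delta> > 0\<close> by (force simp: dist_commute)
    moreover have "open ?U" by auto
    ultimately show "(h has_field_derivative deriv h z) (at z within cball v (\<delta> / 2))"
      using holh by (meson DERIV_subset holomorphic_derivI subset_UNIV)
    let ?r = "\<delta> / 2 - \<delta> / 100"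
    have "cmod ((deriv ^^ 1) h z) \<le> fact 1 * (\<delta> / 16) / ?r ^ 1"
    proof (rule Cauchy_inequality)
      show "h holomorphic_on ball z ?r"
        using subU[of "\<delta> / 100"] \<open>\<delta> > 0\<close> by (intro holomorphic_on_subset[OF holh]) (auto intro: subset_trans[OF ball_subset_cball])
      show "continuous_on (cball z ?r) h"
        using subU[of "\<delta> / 100"] \<open>\<delta> > 0\<close> 
        by (intro holomorphic_on_imp_continuous_on holomorphic_on_subset[OF holh]) auto
      show "cmod (h x) \<le> \<delta> / 16" if "cmod (z - x) = ?r" for x
      proof (rule hd)
        have "x \<in> cball z ?r" using that by (simp add: dist_norm)
        then show "x \<in> ?U" using subsetD[OF subU[of "\<delta> / 100"]] \<open>\<delta> > 0\<close> by simp
      qed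
    qed (use \<open>\<delta> > 0\<close> in auto)
    also have "\<dots> \<le> 1 / 4" using \<open>\<delta> > 0\<close> by (simp add: field_simps)
    finally show "cmod (deriv h z) \<le> 1/4" by simp
  qed (use close \<open>\<delta> > 0\<close> in \<open>auto simp: dist_norm\<close>)
  have "cmod (v - w) / 2 \<le> 1/4 * cmod (w - v)"
    using lip unfolding vw[symmetric] by (simp add: norm_divide)
  then have "cmod (v - w) = 0" by (simp add: norm_minus_commute)
  then show "v = w" by simp
qed

text \<open>
  Only finitely many iterations are involved, so a small perturbation of \<open>F\<close> moves the orbits little.  The
  perturbed orbits have to stay in \<open>K\<close>, where \<open>F\<close> is uniformly continuous; that is the hypothesis \<open>orb\<close>.
\<close>

lemma iterates_close:
  fixes F :: "complex \<Rightarrow> complex"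
  assumes "compact K" and F: "F analytic_on K" and "\<delta> > 0" "\<eta> > 0"
    and orb: "\<And>G. G analytic_on K \<Longrightarrow> (\<And>z. z \<in> K \<Longrightarrow> dist (G z) (F z) \<le> \<eta>) \<Longrightarrow>
        \<forall>j<n. (G ^^ j) ` N \<subseteq> K"
  shows "\<exists>\<eta>'>0. \<eta>' \<le> \<eta> \<and> (\<forall>G. G analytic_on K \<longrightarrow> (\<forall>z\<in>K. dist (G z) (F z) \<le> \<eta>') \<longrightarrow>
     (\<forall>z\<in>N. dist ((G ^^ n) z) ((F ^^ n) z) \<le> \<delta>))"
  using orb \<open>\<delta> > 0\<close>
proof (induction n arbitrary: \<delta>)
  case 0
  then show ?case using \<open>\<eta> > 0\<close> by (intro exI[of _ \<eta>]) auto
next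
  case (Suc n)
  have "uniformly_continuous_on K F" 
    by (intro compact_uniformly_continuous holomorphic_on_imp_continuous_on analytic_imp_holomorphic assms)
  then obtain d where d: "d > 0" "\<And>x y. x \<in> K \<Longrightarrow> y \<in> K \<Longrightarrow> dist y x < d \<Longrightarrow> dist (F y) (F x) < \<delta> / 2"
    unfolding uniformly_continuous_on_def using \<open>\<delta> > 0\<close> by (metis half_gt_zero)
  have "\<And>G. G analytic_on K \<Longrightarrow> (\<And>z. z \<in> K \<Longrightarrow> dist (G z) (F z) \<le> \<eta>) \<Longrightarrow> \<forall>j<n. (G ^^ j) ` N \<subseteq> K"
    using Suc.prems(1) less_SucI by blast
  from Suc.IH[OF this, of "d / 2"] obtain \<eta>1 where \<eta>1: "\<eta>1 > 0" "\<eta>1 \<le> \<eta>"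
    "\<And>G z. G analytic_on K \<Longrightarrow> \<forall>z\<in>K. dist (G z) (F z) \<le> \<eta>1 \<Longrightarrow> z \<in> N \<Longrightarrow> dist ((G ^^ n) z) ((F ^^ n) z) \<le> d / 2"
    using d by auto
  define \<eta>' where "\<eta>' = min \<eta>1 (\<delta> / 2)"
  have orbF: "(F ^^ n) z \<in> K" if "z \<in> N" for z
    using Suc.prems(1)[OF F] \<open>\<eta> > 0\<close> that by (auto simp: image_subset_iff)
  show ?case
  proof (intro exI[of _ \<eta>'] conjI allI impI ballI)
    fix G z assume G: "G analytic_on K" "\<forall>z\<in>K. dist (G z) (F z) \<le> \<eta>'" and z: "z \<in> N"
    have "dist (G z) (F z) \<le> \<eta>" if "z \<in> K" for z
      using G(2) that \<eta>1(2) by (force simp: \<eta>'_def)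
    then have GK: "(G ^^ n) z \<in> K"
      using Suc.prems(1)[OF G(1)] z by (auto simp: image_subset_iff)
    have "dist ((G ^^ n) z) ((F ^^ n) z) \<le> d / 2"
      using G z by (intro \<eta>1(3)) (auto simp: \<eta>'_def)
    then have "dist (F ((G ^^ n) z)) (F ((F ^^ n) z)) < \<delta> / 2"
      using GK orbF[OF z] d by (intro d(2)) auto
    moreover have "dist (G ((G ^^ n) z)) (F ((G ^^ n) z)) \<le> \<delta> / 2"
      using G(2) GK by (force simp: \<eta>'_def)
    ultimately show "dist ((G ^^ Suc n) z) ((F ^^ Suc n) z) \<le> \<delta>"
      using dist_triangle[of "G ((G ^^ n) z)" "F ((F ^^ n) z)" "F ((G ^^ n) z)"] by simp
  qed (use \<eta>1 Suc.prems(2) in \<open>auto simp: \<eta>'_def\<close>)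
qed


text \<open>
  The continuum travels through the disjoint discs \<open>wander_disc \<rho> n\<close>, starting in the first one; the disc
  \<open>trap_disc \<rho>\<close> will be mapped into itself.  Centres are \<open>3 \<rho>\<close> apart, which leaves gaps between the discs.
\<close>

definition centre :: "real \<Rightarrow> int \<Rightarrow> complex" where "centre \<rho> n = of_real (3 * \<rho> * of_int n)"
definition wander_disc :: "real \<Rightarrow> nat \<Rightarrow> complex set" where "wander_disc \<rho> n = ball (centre \<rho> (int n)) \<rho>"
definition trap_disc :: "real \<Rightarrow> complex set" where "trap_disc \<rho> = ball (centre \<rho> (- 1)) \<rho>"

lemma centre_dist: "i \<noteq> j \<Longrightarrow> \<rho> > 0 \<Longrightarrow> dist (centre \<rho> i) (centre \<rho> j) \<ge> 3 * \<rho>"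
proof -
  assume "i \<noteq> j" "\<rho> > 0"
  then have "1 \<le> \<bar>real_of_int i - real_of_int j\<bar>" by linarith
  moreover have "dist (centre \<rho> i) (centre \<rho> j) = 3 * \<rho> * \<bar>real_of_int i - real_of_int j\<bar>"
    using \<open>\<rho> > 0\<close> unfolding centre_def dist_of_real
    by (simp add: dist_real_def abs_mult flip: right_diff_distrib)
  ultimately show ?thesis using \<open>\<rho> > 0\<close> by simp
qed

lemma disjoint_discs:
  assumes "\<rho> > 0"
  shows "m \<noteq> n \<Longrightarrow> wander_disc \<rho> m \<inter> wander_disc \<rho> n = {}"
    and "trap_disc \<rho> \<inter> wander_disc \<rho> n = {}"
proof -
  have *: "ball (centre \<rho> i) \<rho> \<inter> ball (centre \<rho> j) \<rho> = {}" if "i \<noteq> j" for i j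
    using centre_dist[OF that assms] assms by (intro disjoint_ballI) linarith
  show "m \<noteq> n \<Longrightarrow> wander_disc \<rho> m \<inter> wander_disc \<rho> n = {}" "trap_disc \<rho> \<inter> wander_disc \<rho> n = {}"
    unfolding wander_disc_def trap_disc_def by (rule *; simp)+
qed

definition nbhd :: "complex set \<Rightarrow> real \<Rightarrow> complex set" where
  "nbhd X r = {z. infdist z X \<le> r}"

definition shell :: "complex set \<Rightarrow> real \<Rightarrow> real \<Rightarrow> complex set" where
  "shell X s t = {z. s \<le> infdist z X \<and> infdist z X \<le> t}"

lemma compact_nbhd:
  assumes "compact X" "X \<noteq> {}" "r > 0"
  shows "compact (nbhd X r)"
  unfolding nbhd_def by (rule compact_infdist_le) (use assms in auto)

lemma compact_shell:
  assumes "compact X" "X \<noteq> {}" "t > 0"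
  shows "compact (shell X s t)"
proof -
  have "closed {z. s \<le> infdist z X}" by (intro closed_Collect_le continuous_intros)
  then have "compact (nbhd X t \<inter> {z. s \<le> infdist z X})"
    using compact_nbhd[OF assms] by (rule compact_Int_closed[rotated])
  moreover have "nbhd X t \<inter> {z. s \<le> infdist z X} = shell X s t" by (auto simp: nbhd_def shell_def)
  ultimately show ?thesis by simp
qed

text \<open>
  Every later correction changes the map on the sets that were dealt with before.  Hence a property achieved at
  some stage is recorded as holding for all \<open>G\<close> with \<open>near K \<eta> F G\<close>, where \<open>\<eta>\<close> bounds the sum of all corrections
  to come.
\<close>

definition near :: "complex set \<Rightarrow> real \<Rightarrow> (complex \<Rightarrow> complex) \<Rightarrow> (complex \<Rightarrow> complex) \<Rightarrow> bool" where
  "near K \<eta> F G \<longleftrightarrow> G analytic_on K \<and> (\<forall>z\<in>K. dist (G z) (F z) \<le> \<eta>)"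

text \<open>
  The state after \<open>n\<close> stages.  Injectivity of the \<open>n\<close>-th iterate keeps the image of a shell disjoint from
  the image of the smaller neighbourhood inside it, so that the next stage can treat them differently.
\<close>

definition good :: "complex set \<Rightarrow> real \<Rightarrow> nat \<Rightarrow> real \<Rightarrow> complex set \<Rightarrow> (complex \<Rightarrow> complex) \<Rightarrow> bool" where
  "good X \<rho> n r K G \<longleftrightarrow> (\<forall>j<n. (G ^^ j) ` nbhd X r \<subseteq> K) \<and> inj_on (G ^^ n) (nbhd X r) \<and>
     (\<forall>j\<le>n. (G ^^ j) ` nbhd X r \<subseteq> wander_disc \<rho> j)"

definition trapped :: "complex set \<Rightarrow> real \<Rightarrow> nat \<Rightarrow> real \<Rightarrow> real \<Rightarrow> complex set \<Rightarrow> (complex \<Rightarrow> complex) \<Rightarrow> bool" where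
  "trapped X \<rho> n s t K G \<longleftrightarrow>
     (\<forall>z\<in>shell X s t. (\<forall>i\<le>n. (G ^^ i) z \<in> K) \<and> (G ^^ Suc n) z \<in> trap_disc \<rho>)"


lemma near_self: "F analytic_on K \<Longrightarrow> \<eta> > 0 \<Longrightarrow> near K \<eta> F F"
  by (simp add: near_def)

lemma continuous_on_funpow:
  fixes F :: "complex \<Rightarrow> complex"
  assumes "continuous_on K F" "\<And>j. j < n \<Longrightarrow> (F ^^ j) ` N \<subseteq> K"
  shows "continuous_on N (F ^^ n)"
  using assms(2)
proof (induction n)
  case (Suc n)
  have "continuous_on N (F \<circ> (F ^^ n))"
    using Suc by (intro continuous_on_compose) (auto intro: continuous_on_subset[OF assms(1)])
  then show ?case by (simp add: o_def)
qed auto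

text \<open>
  One stage of the construction.  The \<open>n\<close>-th iterate carries a small neighbourhood \<open>N\<close> of \<open>X\<close> and a shell \<open>R\<close>
  around it to disjoint compact subsets \<open>L\<close> and \<open>S\<close> of the \<open>n\<close>-th disc.  A correction with poles in that disc makes
  the map close to an affine map into the next disc near \<open>L\<close>, close to the centre of the trap near \<open>S\<close>, and
  changes it very little elsewhere.  The affine maps contract by the factor \<open>1/2\<close>, which absorbs the errors:
  the images stay in discs of constant radius.
\<close>

lemma wandering_step:
  assumes X: "compact X" "X \<noteq> {}" and "\<rho> > 0" "r > 0" "\<eta> > 0" "\<zeta> > 0"
    and \<eta>\<rho>: "\<eta> \<le> \<rho> / 2"
    and K: "compact K" "K \<subseteq> (\<Union>j<n. wander_disc \<rho> j)"
    and F: "F analytic_on K" "F holomorphic_on wander_disc \<rho> n"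
    and good: "\<And>G. near K \<eta> F G \<Longrightarrow> good X \<rho> n r K G"
  shows "\<exists>l r' s t K' \<eta>'.
    snd ` set l \<subseteq> wander_disc \<rho> n \<and> (\<forall>z. z \<notin> wander_disc \<rho> n \<longrightarrow> cmod (pole_sum l z) \<le> \<eta> / 2) \<and>
    0 < r' \<and> 0 < s \<and> s < t \<and> t \<le> \<zeta> \<and>
    compact K' \<and> K \<subseteq> K' \<and> K' \<subseteq> (\<Union>j<Suc n. wander_disc \<rho> j) \<and> 0 < \<eta>' \<and> \<eta>' \<le> \<eta> / 2 \<and>
    (\<lambda>z. F z + pole_sum l z) analytic_on K' \<and>
    (\<forall>G. near K' \<eta>' (\<lambda>z. F z + pole_sum l z) G \<longrightarrow> good X \<rho> (Suc n) r' K' G \<and> trapped X \<rho> n s t K' G)"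
proof -
  let ?D = "wander_disc \<rho> n" and ?c = "centre \<rho> (int n)" and ?c' = "centre \<rho> (int (Suc n))"
  have openD: "open ?D" by (simp add: wander_disc_def)
  have contF: "continuous_on K F"
    by (intro holomorphic_on_imp_continuous_on analytic_imp_holomorphic F)
  have goodF: "good X \<rho> n r K F" by (intro good near_self F \<open>\<eta> > 0\<close>)
  have cont: "continuous_on (nbhd X r) (F ^^ n)"
    using goodF by (intro continuous_on_funpow[OF contF]) (auto simp: good_def)
  define t where "t = min (r / 2) \<zeta>"
  have t: "0 < t" "t < r" "t \<le> \<zeta>" using \<open>r > 0\<close> \<open>\<zeta> > 0\<close> by (auto simp: t_def)
  define N where "N = nbhd X (t / 4)"
  define R where "R = shell X (t / 2) t"
  have sub: "N \<subseteq> nbhd X r" "R \<subseteq> nbhd X r" and "N \<inter> R = {}"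
    using t by (auto simp: N_def R_def nbhd_def shell_def)
  define L where "L = (F ^^ n) ` N"
  define S where "S = (F ^^ n) ` R"
  have comp: "compact L" "compact S"
    unfolding L_def S_def using compact_nbhd[OF X, of "t / 4"] compact_shell[OF X t(1), of "t / 2"] t(1)
    by (auto intro!: compact_continuous_image continuous_on_subset[OF cont] sub simp: N_def[symmetric] R_def[symmetric])
  have "(F ^^ n) ` nbhd X r \<subseteq> ?D" and injF: "inj_on (F ^^ n) (nbhd X r)"
    using goodF by (simp_all add: good_def)
  then have LD: "L \<subseteq> ?D" and SD: "S \<subseteq> ?D"
    unfolding L_def S_def using sub by (meson image_mono subset_trans)+
  have "L \<inter> S = {}"
    unfolding L_def S_def using inj_on_image_Int[OF injF sub] \<open>N \<inter> R = {}\<close> by simp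
  then obtain d where d: "d > 0" "\<And>x y. x \<in> L \<Longrightarrow> y \<in> S \<Longrightarrow> d \<le> dist x y"
    using separate_compact_closed[OF comp(1) compact_imp_closed[OF comp(2)]] by metis
  obtain e1 where e1: "e1 > 0" "(\<Union>x\<in>L. cball x e1) \<subseteq> ?D"
    using compact_subset_open_imp_cball_epsilon_subset[OF comp(1) openD LD] by metis
  obtain e2 where e2: "e2 > 0" "(\<Union>x\<in>S. cball x e2) \<subseteq> ?D"
    using compact_subset_open_imp_cball_epsilon_subset[OF comp(2) openD SD] by metis
  define \<delta> where "\<delta> = min (d / 9) (min (e1 / 3) (e2 / 3))"
  have \<delta>: "\<delta> > 0" "9 * \<delta> \<le> d" "3 * \<delta> \<le> e1" "3 * \<delta> \<le> e2"
    using d e1 e2 by (auto simp: \<delta>_def)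
  define \<Omega>1 where "\<Omega>1 = (\<Union>x\<in>L. ball x (3 * \<delta>))"
  define \<Omega>2 where "\<Omega>2 = (\<Union>x\<in>S. ball x (3 * \<delta>))"
  have open\<Omega>: "open \<Omega>1" "open \<Omega>2" by (auto simp: \<Omega>1_def \<Omega>2_def)
  have \<Omega>D: "\<Omega>1 \<subseteq> ?D" "\<Omega>2 \<subseteq> ?D"
  proof -
    have "\<Omega>1 \<subseteq> (\<Union>x\<in>L. cball x e1)" "\<Omega>2 \<subseteq> (\<Union>x\<in>S. cball x e2)"
      using \<delta> unfolding \<Omega>1_def \<Omega>2_def by (intro UN_mono subset_refl; auto)+
    then show "\<Omega>1 \<subseteq> ?D" "\<Omega>2 \<subseteq> ?D" using e1(2) e2(2) by blast+
  qed
  have disj: "\<Omega>1 \<inter> \<Omega>2 = {}"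
  proof -
    have False if "x \<in> L" "y \<in> S" "dist x z < 3 * \<delta>" "dist y z < 3 * \<delta>" for x y z
      using d(2)[OF that(1,2)] that(3,4) \<delta> dist_triangle2[of x y z] by linarith
    then show ?thesis by (auto simp: \<Omega>1_def \<Omega>2_def)
  qed
  define K1 where "K1 = (\<Union>x\<in>L. cball x (2 * \<delta>))"
  define K2 where "K2 = (\<Union>x\<in>S. cball x \<delta>)"
  have compK: "compact K1" "compact K2"
    unfolding K1_def K2_def by (intro compact_minkowski_sum_cball comp)+
  have K\<Omega>: "K1 \<subseteq> \<Omega>1" "K2 \<subseteq> \<Omega>2"
    using \<delta> unfolding K1_def K2_def \<Omega>1_def \<Omega>2_def by (fastforce simp: subset_iff)+
  have "\<And>G. G analytic_on K \<Longrightarrow> (\<And>z. z \<in> K \<Longrightarrow> dist (G z) (F z) \<le> \<eta>) \<Longrightarrow> \<forall>j<n. (G ^^ j) ` nbhd X r \<subseteq> K"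
    using good unfolding near_def good_def by blast
  from iterates_close[OF K(1) F(1) \<delta>(1) \<open>\<eta> > 0\<close> this]
  obtain \<eta>2 where \<eta>2: "\<eta>2 > 0" "\<eta>2 \<le> \<eta>"
    "\<And>G z. near K \<eta>2 F G \<Longrightarrow> z \<in> nbhd X r \<Longrightarrow> dist ((G ^^ n) z) ((F ^^ n) z) \<le> \<delta>"
    unfolding near_def by blast
  define \<epsilon> where "\<epsilon> = min (\<eta>2 / 2) (min (\<delta> / 32) (\<rho> / 8))"
  have \<epsilon>: "\<epsilon> > 0" "\<epsilon> \<le> \<eta>2 / 2" "\<epsilon> \<le> \<delta> / 32" "\<epsilon> \<le> \<rho> / 8"
    using \<eta>2 \<delta> \<open>\<rho> > 0\<close> by (auto simp: \<epsilon>_def)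
  \<comment> \<open>the prescribed map minus the previous sum \<open>F\<close>, which is holomorphic here because its poles lie in other discs\<close>
  define T where "T w = (if w \<in> \<Omega>1 then ?c' + (w - ?c) / 2 - F w else centre \<rho> (- 1) - F w)" for w
  have holT: "T holomorphic_on \<Omega>1 \<union> \<Omega>2"
    unfolding T_def using open\<Omega> disj F(2) \<Omega>D
    by (intro holomorphic_on_If_Un holomorphic_intros) (auto intro: holomorphic_on_subset)
  obtain l where l: "snd ` set l \<subseteq> (\<Omega>1 \<union> \<Omega>2) - (K1 \<union> K2)"
    "\<And>z. z \<in> K1 \<union> K2 \<Longrightarrow> cmod (T z - pole_sum l z) \<le> \<epsilon>"
    "\<And>z. z \<notin> \<Omega>1 \<union> \<Omega>2 \<Longrightarrow> cmod (pole_sum l z) \<le> \<epsilon>"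
    using Runge_pole_sums[OF open_Un[OF open\<Omega>] compact_Un[OF compK] Un_mono[OF K\<Omega>] holT \<epsilon>(1)] by metis
  define F' where "F' = (\<lambda>z. F z + pole_sum l z)"
  define K' where "K' = K \<union> (K1 \<union> K2)"
  have K12D: "K1 \<union> K2 \<subseteq> ?D" using K\<Omega> \<Omega>D by blast
  have lD: "snd ` set l \<subseteq> ?D" using l(1) \<Omega>D by blast
  have KD: "K \<inter> ?D = {}"
  proof -
    have "wander_disc \<rho> j \<inter> ?D = {}" if "j < n" for j
      using that by (intro disjoint_discs \<open>\<rho> > 0\<close>) auto
    then show ?thesis using K(2) by blast
  qed
  have anF': "F' analytic_on K'"
  proof -
    have "F' analytic_on K"
    proof -
      have "pole_sum l analytic_on - snd ` set l"
        by (subst analytic_on_open) (auto intro!: holomorphic_pole_sum open_Compl finite_imp_closed)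
      then have "pole_sum l analytic_on K"
        using KD lD by (elim analytic_on_subset) auto
      then show ?thesis unfolding F'_def using F(1) by (intro analytic_intros)
    qed
    moreover have "F' analytic_on K1 \<union> K2"
    proof -
      have "F' holomorphic_on ?D - snd ` set l"
        unfolding F'_def by (intro holomorphic_intros holomorphic_pole_sum holomorphic_on_subset[OF F(2)]) auto
      moreover have "open (?D - snd ` set l)"
        by (intro open_Diff openD finite_imp_closed) auto
      ultimately have "F' analytic_on ?D - snd ` set l" by (simp add: analytic_on_open)
      moreover have "K1 \<union> K2 \<subseteq> ?D - snd ` set l" using K12D l(1) by blast
      ultimately show ?thesis by (rule analytic_on_subset)
    qed
    ultimately show ?thesis unfolding K'_def by (simp add: analytic_on_Un)
  qed
  have aff: "cmod (F' w - (?c' + (w - ?c) / 2)) \<le> \<epsilon>" if "w \<in> K1" for w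
  proof -
    have "w \<in> \<Omega>1" using that K\<Omega> by auto
    then have "F' w - (?c' + (w - ?c) / 2) = - (T w - pole_sum l w)"
      by (simp add: T_def F'_def)
    then show ?thesis using l(2)[of w] that by (simp only: norm_minus_cancel) simp
  qed
  have trap: "cmod (F' w - centre \<rho> (- 1)) \<le> \<epsilon>" if "w \<in> K2" for w
  proof -
    have "w \<notin> \<Omega>1" using that K\<Omega> disj by auto
    then have "F' w - centre \<rho> (- 1) = - (T w - pole_sum l w)"
      by (simp add: T_def F'_def)
    then show ?thesis using l(2)[of w] that by (simp only: norm_minus_cancel) simp
  qed
  have main: "good X \<rho> (Suc n) (t / 4) K' G \<and> trapped X \<rho> n (t / 2) t K' G" if G: "near K' \<epsilon> F' G" for G
  proof -
    have anG: "G analytic_on K'" and dG: "\<And>z. z \<in> K' \<Longrightarrow> dist (G z) (F' z) \<le> \<epsilon>"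
      using G by (auto simp: near_def)
    have nearK: "near K \<eta>2 F G"
      unfolding near_def
    proof (intro conjI ballI)
      show "G analytic_on K" using anG by (rule analytic_on_subset) (auto simp: K'_def)
      fix z assume z: "z \<in> K"
      have "dist (G z) (F' z) \<le> \<epsilon>" using z by (intro dG) (auto simp: K'_def)
      moreover have "dist (F' z) (F z) \<le> \<epsilon>"
        using l(3)[of z] z KD \<Omega>D by (auto simp: F'_def dist_norm)
      ultimately show "dist (G z) (F z) \<le> \<eta>2"
        using dist_triangle[of "G z" "F z" "F' z"] \<epsilon>(2) by linarith
    qed
    then have "near K \<eta> F G" using \<eta>2(2) unfolding near_def by force
    then have goodG: "good X \<rho> n r K G" by (rule good)
    have GN: "(G ^^ n) z \<in> (\<Union>x\<in>L. cball x \<delta>)" if "z \<in> N" for z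
      using \<eta>2(3)[OF nearK] sub that by (force simp: L_def dist_commute)
    have GR: "(G ^^ n) z \<in> K2" if "z \<in> R" for z
      using \<eta>2(3)[OF nearK] sub that by (force simp: S_def K2_def dist_commute)
    have Gaff: "cmod (G w - (?c' + (w - ?c) / 2)) \<le> 2 * \<epsilon>" if "w \<in> K1" for w
    proof -
      have "dist (G w) (F' w) \<le> \<epsilon>" using that by (intro dG) (simp add: K'_def)
      with aff[OF that] show ?thesis
        using dist_triangle[of "G w" "?c' + (w - ?c) / 2" "F' w"] unfolding dist_norm by linarith
    qed
    have LK1: "(\<Union>x\<in>L. cball x \<delta>) \<subseteq> K1" using \<delta> unfolding K1_def by (fastforce simp: subset_iff)
    have GNK': "(G ^^ n) z \<in> K'" if "z \<in> N" for z
      using subsetD[OF LK1 GN[OF that]] by (simp add: K'_def)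
    have balls: "(\<Union>x\<in>(\<Union>x\<in>L. cball x \<delta>). ball x \<delta>) \<subseteq> K1"
    proof -
      have "dist x z \<le> 2 * \<delta>" if "dist x y \<le> \<delta>" "dist y z < \<delta>" for x y z :: complex
        using that dist_triangle[of x z y] by linarith
      then show ?thesis by (fastforce simp: K1_def)
    qed
    have inj: "inj_on G (\<Union>x\<in>L. cball x \<delta>)"
    proof (rule inj_on_near_affine[where \<delta> = \<delta> and c = "?c' - ?c / 2"])
      show "G holomorphic_on (\<Union>x\<in>(\<Union>x\<in>L. cball x \<delta>). ball x \<delta>)"
        using balls anG by (intro analytic_imp_holomorphic) (auto intro: analytic_on_subset simp: K'_def)
      show "cmod (G w - (?c' - ?c / 2 + w / 2)) \<le> \<delta> / 16" if "w \<in> (\<Union>x\<in>(\<Union>x\<in>L. cball x \<delta>). ball x \<delta>)" for w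
      proof -
        have eq: "?c' - ?c / 2 + w / 2 = ?c' + (w - ?c) / 2" by (simp add: field_simps)
        show ?thesis unfolding eq using Gaff[OF subsetD[OF balls that]] \<epsilon>(3) by linarith
      qed
    qed (use \<delta> in auto)
    have good': "good X \<rho> (Suc n) (t / 4) K' G"
      unfolding good_def N_def[symmetric]
    proof (intro conjI allI impI)
      fix j assume "j < Suc n"
      then consider "j < n" | "j = n" by linarith
      then show "(G ^^ j) ` N \<subseteq> K'"
      proof cases
        case 1
        then show ?thesis using goodG sub unfolding good_def K'_def by blast
      next
        case 2
        then show ?thesis using GNK' by blast
      qed
    next
      have "inj_on (G ^^ n) N" using goodG sub unfolding good_def by (meson inj_on_subset)
      moreover have "inj_on G ((G ^^ n) ` N)" using inj GN by (meson image_subsetI inj_on_subset)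
      ultimately have "inj_on (G \<circ> (G ^^ n)) N" by (rule comp_inj_on)
      then show "inj_on (G ^^ Suc n) N" by simp
    next
      fix j assume "j \<le> Suc n"
      then consider "j \<le> n" | "j = Suc n" by linarith
      then show "(G ^^ j) ` N \<subseteq> wander_disc \<rho> j"
      proof cases
        case 1
        then show ?thesis using goodG sub unfolding good_def by blast
      next
        case 2
        have "(G ^^ Suc n) z \<in> wander_disc \<rho> (Suc n)" if z: "z \<in> N" for z
        proof -
          define w where "w = (G ^^ n) z"
          have "w \<in> ?D" using goodG sub z unfolding good_def w_def by blast
          then have "cmod (w - ?c) < \<rho>" by (simp add: wander_disc_def dist_norm norm_minus_commute)
          moreover have "cmod (G w - (?c' + (w - ?c) / 2)) \<le> 2 * \<epsilon>"
            using subsetD[OF LK1 GN[OF z]] by (intro Gaff) (simp add: w_def)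
          moreover have "cmod (G w - ?c') \<le> cmod (G w - (?c' + (w - ?c) / 2)) + cmod ((w - ?c) / 2)"
            using norm_triangle_ineq[of "G w - (?c' + (w - ?c) / 2)" "(w - ?c) / 2"] by simp
          moreover have "cmod ((w - ?c) / 2) = cmod (w - ?c) / 2" by (simp add: norm_divide)
          ultimately have "cmod (G w - ?c') < \<rho>" using \<epsilon>(4) \<open>\<rho> > 0\<close> by linarith
          then show ?thesis by (simp add: wander_disc_def dist_norm norm_minus_commute w_def)
        qed
        then show ?thesis using 2 by blast
      qed
    qed
    have "trapped X \<rho> n (t / 2) t K' G"
      unfolding trapped_def R_def[symmetric]
    proof (intro ballI conjI allI impI)
      fix z i assume z: "z \<in> R" and "i \<le> n"
      then consider "i < n" | "i = n" by linarith
      then show "(G ^^ i) z \<in> K'"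
      proof cases
        case 1
        then show ?thesis using goodG sub z unfolding good_def K'_def by blast
      next
        case 2
        then show ?thesis using GR[OF z] by (simp add: K'_def)
      qed
    next
      fix z assume z: "z \<in> R"
      have "cmod (F' ((G ^^ n) z) - centre \<rho> (- 1)) \<le> \<epsilon>" by (intro trap GR z)
      moreover have "dist (G ((G ^^ n) z)) (F' ((G ^^ n) z)) \<le> \<epsilon>"
        using GR[OF z] by (intro dG) (auto simp: K'_def)
      ultimately have "dist (G ((G ^^ n) z)) (centre \<rho> (- 1)) < \<rho>"
        using dist_triangle[of "G ((G ^^ n) z)" "centre \<rho> (- 1)" "F' ((G ^^ n) z)"] \<epsilon>(4) \<open>\<rho> > 0\<close>
        unfolding dist_norm by linarith
      then show "(G ^^ Suc n) z \<in> trap_disc \<rho>" by (simp add: trap_disc_def dist_commute)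
    qed
    with good' show ?thesis by blast
  qed
  have "\<epsilon> \<le> \<eta> / 2" using \<epsilon>(2) \<eta>2 by linarith
  moreover have "cmod (pole_sum l z) \<le> \<eta> / 2" if "z \<notin> ?D" for z
    using l(3)[of z] that \<Omega>D \<open>\<epsilon> \<le> \<eta> / 2\<close> by force
  moreover have "compact K'" "K \<subseteq> K'" unfolding K'_def using K compK by auto
  moreover have "K' \<subseteq> (\<Union>j<Suc n. wander_disc \<rho> j)"
    using K(2) K12D unfolding K'_def lessThan_Suc by blast
  ultimately show ?thesis
    using lD t \<epsilon>(1) anF' main unfolding F'_def
    by (intro exI[of _ l] exI[of _ "t / 4"] exI[of _ "t / 2"] exI[of _ t] exI[of _ K'] exI[of _ \<epsilon>]) auto
qed


lemma cmod_in_wander_disc: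
  assumes "z \<in> wander_disc \<rho> n"
  shows "3 * \<rho> * real n - \<rho> < cmod z" "\<rho> \<ge> 0 \<Longrightarrow> cmod z < 3 * \<rho> * real n + \<rho>"
proof -
  have d: "cmod (z - centre \<rho> (int n)) < \<rho>"
    using assms by (simp add: wander_disc_def dist_norm norm_minus_commute)
  have c: "cmod (centre \<rho> (int n)) = \<bar>3 * \<rho> * real n\<bar>"
    unfolding centre_def norm_of_real by simp
  show "3 * \<rho> * real n - \<rho> < cmod z"
    using d c norm_triangle_ineq2[of "centre \<rho> (int n)" z] by (simp add: norm_minus_commute)
  show "cmod z < 3 * \<rho> * real n + \<rho>" if "\<rho> \<ge> 0"
    using d c norm_triangle_ineq2[of z "centre \<rho> (int n)"] that by simp
qed

text \<open>
  Iterating the step.  The tolerances at least halve from stage to stage, so that all corrections from stage \<open>n\<close> on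
  add up to at most \<open>\<eta> n\<close>.
\<close>

lemma wandering_sequence:
  assumes X: "compact X" "X \<noteq> {}" "X \<subseteq> ball 0 \<rho>" and "\<rho> > 0"
  obtains ls :: "nat \<Rightarrow> (complex \<times> complex) list" and K :: "nat \<Rightarrow> complex set" and r \<eta> s t :: "nat \<Rightarrow> real"
  where
    "\<And>n. snd ` set (ls n) \<subseteq> wander_disc \<rho> n"
    "\<And>n z. z \<notin> wander_disc \<rho> n \<Longrightarrow> cmod (pole_sum (ls n) z) \<le> \<eta> n / 2"
    "\<And>n. 0 < \<eta> n" "\<eta> 0 = \<rho> / 2" "\<And>n. \<eta> (Suc n) \<le> \<eta> n / 2"
    "\<And>n. K n \<subseteq> (\<Union>j<n. wander_disc \<rho> j)" "\<And>n. 0 < r n"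
    "\<And>n. 0 < s n" "\<And>n. s n < t n" "\<And>n. t n \<le> 1 / (real n + 1)"
    "\<And>n. (\<lambda>z. centre \<rho> (- 1) + (\<Sum>k<n. pole_sum (ls k) z)) analytic_on K n"
    "\<And>n G. near (K n) (\<eta> n) (\<lambda>z. centre \<rho> (- 1) + (\<Sum>k<n. pole_sum (ls k) z)) G \<Longrightarrow> good X \<rho> n (r n) (K n) G"
    "\<And>n G. near (K (Suc n)) (\<eta> (Suc n)) (\<lambda>z. centre \<rho> (- 1) + (\<Sum>k<Suc n. pole_sum (ls k) z)) G
       \<Longrightarrow> trapped X \<rho> n (s n) (t n) (K (Suc n)) G"
proof -
  define inv where "inv n x = (case x of (F, r, K, \<eta>) \<Rightarrow>
     0 < r \<and> 0 < \<eta> \<and> \<eta> \<le> \<rho> / 2 \<and> compact K \<and> K \<subseteq> (\<Union>j<n. wander_disc \<rho> j) \<and> F analytic_on K \<and>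
     (\<forall>m\<ge>n. F holomorphic_on wander_disc \<rho> m) \<and> (\<forall>G. near K \<eta> F G \<longrightarrow> good X \<rho> n r K G) \<and>
     (n = 0 \<longrightarrow> \<eta> = \<rho> / 2 \<and> F = (\<lambda>_. centre \<rho> (- 1))))"
    for n :: nat and x :: "(complex \<Rightarrow> complex) \<times> real \<times> complex set \<times> real"
  define nxt where "nxt n x y l s t = (case x of (F, r, K, \<eta>) \<Rightarrow> case y of (F', r', K', \<eta>') \<Rightarrow>
     F' = (\<lambda>z. F z + pole_sum l z) \<and> snd ` set l \<subseteq> wander_disc \<rho> n \<and>
     (\<forall>z. z \<notin> wander_disc \<rho> n \<longrightarrow> cmod (pole_sum l z) \<le> \<eta> / 2) \<and> 0 < s \<and> s < t \<and> t \<le> 1 / (real n + 1) \<and>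
     \<eta>' \<le> \<eta> / 2 \<and> (\<forall>G. near K' \<eta>' F' G \<longrightarrow> trapped X \<rho> n s t K' G))"
    for n :: nat and x y :: "(complex \<Rightarrow> complex) \<times> real \<times> complex set \<times> real"
      and l :: "(complex \<times> complex) list" and s t :: real
  have base: "\<exists>x. inv 0 x"
  proof -
    have "open (ball (0 :: complex) \<rho>)" by simp
    then obtain e where e: "e > 0" "(\<Union>x\<in>X. cball x e) \<subseteq> ball 0 \<rho>"
      using compact_subset_open_imp_cball_epsilon_subset[OF X(1) _ X(3)] by metis
    have "nbhd X e \<subseteq> ball 0 \<rho>"
    proof
      fix z assume "z \<in> nbhd X e"
      moreover obtain x where "x \<in> X" "infdist z X = dist z x"
        using infdist_attains_inf[OF compact_imp_closed[OF X(1)] X(2)] by metis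
      ultimately have "z \<in> (\<Union>x\<in>X. cball x e)" by (auto simp: nbhd_def dist_commute)
      then show "z \<in> ball 0 \<rho>" using e(2) by blast
    qed
    moreover have "wander_disc \<rho> 0 = ball 0 \<rho>" by (simp add: wander_disc_def centre_def)
    ultimately have "inv 0 (\<lambda>_. centre \<rho> (- 1), e, {}, \<rho> / 2)"
      using e(1) \<open>\<rho> > 0\<close> by (simp add: inv_def good_def)
    then show ?thesis by blast
  qed
  have step: "\<exists>y. inv (Suc n) y \<and> (\<exists>l s t. nxt n x y l s t)" if invx: "inv n x" for n x
  proof -
    obtain F r K \<eta> where x: "x = (F, r, K, \<eta>)" by (cases x) auto
    note inv = invx[unfolded inv_def x prod.case]
    have "1 / (real n + 1) > 0" by simp
    from wandering_step[of X \<rho> r \<eta> "1 / (real n + 1)" K n F, OF X(1,2) \<open>\<rho> > 0\<close> _ _ this] inv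
    obtain l r' s t K' \<eta>' where
      st: "snd ` set l \<subseteq> wander_disc \<rho> n" "\<forall>z. z \<notin> wander_disc \<rho> n \<longrightarrow> cmod (pole_sum l z) \<le> \<eta> / 2"
        "0 < r'" "0 < s" "s < t" "t \<le> 1 / (real n + 1)"
        "compact K'" "K \<subseteq> K'" "K' \<subseteq> (\<Union>j<Suc n. wander_disc \<rho> j)" "0 < \<eta>'" "\<eta>' \<le> \<eta> / 2"
        "(\<lambda>z. F z + pole_sum l z) analytic_on K'"
        "\<forall>G. near K' \<eta>' (\<lambda>z. F z + pole_sum l z) G \<longrightarrow> good X \<rho> (Suc n) r' K' G \<and> trapped X \<rho> n s t K' G"
      by (elim exE conjE) (auto elim!: exE conjE)
    have "(\<lambda>z. F z + pole_sum l z) holomorphic_on wander_disc \<rho> m" if "m \<ge> Suc n" for m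
    proof -
      have "wander_disc \<rho> m \<inter> snd ` set l = {}"
        using st(1) disjoint_discs(1)[OF \<open>\<rho> > 0\<close>, of m n] that by auto
      then show ?thesis using inv that by (intro holomorphic_intros holomorphic_pole_sum) auto
    qed
    then have "inv (Suc n) (\<lambda>z. F z + pole_sum l z, r', K', \<eta>')"
      using st inv unfolding inv_def by auto
    moreover have "nxt n x (\<lambda>z. F z + pole_sum l z, r', K', \<eta>') l s t"
      using st unfolding nxt_def x by auto
    ultimately show ?thesis by blast
  qed
  obtain x where x: "\<And>n. inv n (x n)" "\<And>n. \<exists>l s t. nxt n (x n) (x (Suc n)) l s t"
    using dependent_nat_choice[of inv "\<lambda>n x y. \<exists>l s t. nxt n x y l s t", OF base step] by metis
  obtain ls s t where nx: "\<And>n. nxt n (x n) (x (Suc n)) (ls n) (s n) (t n)"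
    using x(2) by metis
  define F where "F n = fst (x n)" for n
  define r where "r n = fst (snd (x n))" for n
  define K where "K n = fst (snd (snd (x n)))" for n
  define \<eta> where "\<eta> n = snd (snd (snd (x n)))" for n
  have xn: "x n = (F n, r n, K n, \<eta> n)" for n by (simp add: F_def r_def K_def \<eta>_def)
  note inv' = x(1)[unfolded xn inv_def prod.case]
  note nx' = nx[unfolded xn nxt_def prod.case]
  have F: "F n = (\<lambda>z. centre \<rho> (- 1) + (\<Sum>k<n. pole_sum (ls k) z))" for n
  proof (induction n)
    case 0
    show ?case using inv'[of 0] by simp
  next
    case (Suc n)
    show ?case using nx'[of n] by (simp add: Suc add.assoc)
  qed
  show ?thesis
    by (rule that[of ls \<eta> K r s t]) (use inv' nx' in \<open>auto simp del: sum.lessThan_Suc simp flip: F\<close>)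
qed


text \<open>
  The limit of the construction.  On the ball \<open>B n\<close>, which all discs from the \<open>n\<close>-th one on avoid, the tail of the
  series converges uniformly to a holomorphic function, so the sum is meromorphic there; these balls exhaust
  the plane.  The limit is within the tolerance of every partial sum and inherits all recorded properties.
\<close>

theorem wandering_function:
  assumes X: "compact X" "X \<noteq> {}" "X \<subseteq> ball 0 \<rho>" and "\<rho> > 0"
  obtains g s t where
    "g nicely_meromorphic_on UNIV"
    "g analytic_on trap_disc \<rho>" "g ` trap_disc \<rho> \<subseteq> trap_disc \<rho>"
    "\<And>n z. z \<in> X \<Longrightarrow> g analytic_on {(g ^^ n) z} \<and> (g ^^ n) z \<in> wander_disc \<rho> n"
    "\<And>n. 0 < s n" "\<And>n. s n < t n" "\<And>n. t n \<le> 1 / (real n + 1)"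
    "\<And>n z. z \<in> shell X (s n) (t n) \<Longrightarrow>
       (\<forall>i\<le>n. g analytic_on {(g ^^ i) z}) \<and> (g ^^ Suc n) z \<in> trap_disc \<rho>"
proof -
  obtain ls K r \<eta> s t where
    ls: "\<And>n. snd ` set (ls n) \<subseteq> wander_disc \<rho> n"
      "\<And>n z. z \<notin> wander_disc \<rho> n \<Longrightarrow> cmod (pole_sum (ls n) z) \<le> \<eta> n / 2" and
    \<eta>: "\<And>n. 0 < \<eta> n" "\<eta> 0 = \<rho> / 2" "\<And>n. \<eta> (Suc n) \<le> \<eta> n / 2" and
    KD: "\<And>n. K n \<subseteq> (\<Union>j<n. wander_disc \<rho> j)" and r: "\<And>n. 0 < r n" and
    st: "\<And>n. 0 < s n" "\<And>n. s n < t n" "\<And>n. t n \<le> 1 / (real n + 1)" and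
    anK: "\<And>n. (\<lambda>z. centre \<rho> (- 1) + (\<Sum>k<n. pole_sum (ls k) z)) analytic_on K n" and
    good: "\<And>n G. near (K n) (\<eta> n) (\<lambda>z. centre \<rho> (- 1) + (\<Sum>k<n. pole_sum (ls k) z)) G \<Longrightarrow> good X \<rho> n (r n) (K n) G" and
    trapped: "\<And>n G. near (K (Suc n)) (\<eta> (Suc n)) (\<lambda>z. centre \<rho> (- 1) + (\<Sum>k<Suc n. pole_sum (ls k) z)) G
       \<Longrightarrow> trapped X \<rho> n (s n) (t n) (K (Suc n)) G"
    by (rule wandering_sequence[OF assms]) (rule that; assumption)
  define p where "p k z = pole_sum (ls k) z" for k z
  define F where "F n z = centre \<rho> (- 1) + (\<Sum>k<n. p k z)" for n z
  define \<tau> where "\<tau> n z = (\<Sum>k. p (k + n) z)" for n z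
  define g0 where "g0 z = centre \<rho> (- 1) + (\<Sum>k. p k z)" for z
  define U where "U n = {z. \<forall>k\<ge>n. z \<notin> wander_disc \<rho> k}" for n
  have \<eta>_geom: "\<eta> (k + n) \<le> \<eta> n * (1 / 2) ^ k" for k n
  proof (induction k)
    case (Suc k)
    then show ?case using \<eta>(3)[of "k + n"] by simp
  qed auto
  have bound: "cmod (p (k + n) z) \<le> \<eta> n / 2 * (1 / 2) ^ k" if "z \<in> U n" for k n z
  proof -
    have "cmod (p (k + n) z) \<le> \<eta> (k + n) / 2" unfolding p_def using that by (intro ls(2)) (auto simp: U_def)
    then show ?thesis using \<eta>_geom[of k n] by linarith
  qed
  have geom: "summable (\<lambda>k. c / 2 * (1 / 2) ^ k)" "(\<Sum>k. c / 2 * (1 / 2) ^ k) = c" for c :: real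
    using sums_mult[OF geometric_sums[of "1 / 2 :: real"], of "c / 2"]
    by (auto simp: sums_iff)
  have in_U: "z \<in> U n" if "cmod z \<le> 3 * \<rho> * real n - \<rho>" for z n
  proof -
    have "z \<notin> wander_disc \<rho> k" if "k \<ge> n" for k
    proof
      assume "z \<in> wander_disc \<rho> k"
      from cmod_in_wander_disc(1)[OF this] have "3 * \<rho> * real k < 3 * \<rho> * real n"
        using \<open>cmod z \<le> _\<close> by linarith
      then show False using that \<open>\<rho> > 0\<close> by simp
    qed
    then show ?thesis by (simp add: U_def)
  qed
  have tail: "cmod (\<tau> n z) \<le> \<eta> n" "g0 z = F n z + \<tau> n z" if "z \<in> U n" for n z
  proof -
    have sn: "summable (\<lambda>k. cmod (p (k + n) z))"
      by (rule summable_comparison_test'[OF geom(1)[of "\<eta> n"]]) (use bound[OF that] in auto)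
    have "cmod (\<tau> n z) \<le> (\<Sum>k. cmod (p (k + n) z))" unfolding \<tau>_def by (rule summable_norm[OF sn])
    also have "\<dots> \<le> (\<Sum>k. \<eta> n / 2 * (1 / 2) ^ k)" by (intro suminf_le bound[OF that] sn geom)
    finally show "cmod (\<tau> n z) \<le> \<eta> n" by (simp only: geom)
    have "summable (\<lambda>k. p k z)" using summable_norm_cancel[OF sn] summable_iff_shift by blast
    from suminf_split_initial_segment[OF this, of n] show "g0 z = F n z + \<tau> n z"
      by (simp add: g0_def F_def \<tau>_def)
  qed
  define B where "B n = ball (0 :: complex) (3 * \<rho> * real n - \<rho>)" for n
  have openB: "open (B n)" for n by (simp add: B_def)
  have BU: "B n \<subseteq> U n" for n by (auto simp: B_def intro!: in_U)
  have hol\<tau>: "\<tau> n holomorphic_on B n" for n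
  proof (rule holomorphic_uniform_sequence)
    show "open (B n)" by (simp add: B_def)
    show "(\<lambda>z. \<Sum>k<m. p (k + n) z) holomorphic_on B n" for m
    proof (intro holomorphic_intros)
      fix k
      have "B n \<inter> wander_disc \<rho> (k + n) = {}" using BU[of n] by (auto simp: U_def)
      then have "B n \<inter> snd ` set (ls (k + n)) = {}" using ls(1)[of "k + n"] by blast
      then show "p (k + n) holomorphic_on B n" unfolding p_def by (rule holomorphic_pole_sum)
    qed
    fix x assume "x \<in> B n"
    then obtain d where d: "d > 0" "cball x d \<subseteq> B n"
      using open_contains_cball[of "B n"] openB by metis
    have "uniform_limit (cball x d) (\<lambda>m z. \<Sum>k<m. p (k + n) z) (\<tau> n) sequentially"
      unfolding \<tau>_def using d BU[of n] by (intro Weierstrass_m_test[OF _ geom(1)[of "\<eta> n"]] bound) auto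
    with d show "\<exists>d>0. cball x d \<subseteq> B n \<and> uniform_limit (cball x d) (\<lambda>m z. \<Sum>k<m. p (k + n) z) (\<tau> n) sequentially"
      by blast
  qed
  have an_tail: "\<tau> n analytic_on B n" for n using hol\<tau> openB by (simp add: analytic_on_open)
  have g0_eq: "\<forall>\<^sub>F w in nhds z. g0 w = F n w + \<tau> n w" if "z \<in> B n" for z n
    using eventually_nhds_in_open[OF openB that] by eventually_elim (use tail(2) BU in auto)
  have an_g0: "g0 analytic_on A" if "F n analytic_on A" "A \<subseteq> B n" for A n
  proof -
    have "g0 analytic_on {z}" if z: "z \<in> A" for z
    proof -
      have "F n analytic_on {z}" "\<tau> n analytic_on {z}"
        using z \<open>F n analytic_on A\<close> \<open>A \<subseteq> B n\<close> an_tail by (auto intro: analytic_on_subset)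
      then have "(\<lambda>w. F n w + \<tau> n w) analytic_on {z}" by (rule analytic_on_add)
      then show ?thesis using g0_eq[of z n] z \<open>A \<subseteq> B n\<close> by (subst analytic_at_cong) auto
    qed
    then show ?thesis using analytic_on_analytic_at by blast
  qed
  have mero: "g0 meromorphic_on UNIV"
  proof -
    have "g0 meromorphic_on {z}" for z
    proof -
      obtain n where "(cmod z + \<rho>) / (3 * \<rho>) < real n" using reals_Archimedean2 by blast
      then have "z \<in> B n" using \<open>\<rho> > 0\<close> by (simp add: B_def field_simps)
      have "(\<lambda>w. F n w + \<tau> n w) meromorphic_on {z}"
        unfolding F_def p_def using analytic_on_subset[OF an_tail] \<open>z \<in> B n\<close>
        by (intro meromorphic_intros meromorphic_pole_sum analytic_on_imp_meromorphic_on) auto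
      then show ?thesis
        using g0_eq[OF \<open>z \<in> B n\<close>] eventually_nhds_conv_at
        by (subst meromorphic_on_cong[where g = "\<lambda>w. F n w + \<tau> n w" and B = "{z}"]) auto
    qed
    then show ?thesis using meromorphic_on_meromorphic_at by blast
  qed
  define g where "g = remove_sings g0"
  have g_an: "g analytic_on A" "\<And>z. z \<in> A \<Longrightarrow> g z = g0 z" if "g0 analytic_on A" for A
  proof -
    show "g analytic_on A" unfolding g_def by (rule remove_sings_analytic_on[OF that])
    show "g z = g0 z" if "z \<in> A" for z
      using \<open>g0 analytic_on A\<close> that unfolding g_def
      by (intro remove_sings_at_analytic) (auto intro: analytic_on_subset)
  qed
  have near: "near (K n) (\<eta> n) (F n) g" for n
  proof -
    have KB: "K n \<subseteq> B n"
    proof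
      fix z assume "z \<in> K n"
      then obtain j where j: "j < n" "z \<in> wander_disc \<rho> j" using KD by blast
      then have "cmod z < 3 * \<rho> * real j + \<rho>" using cmod_in_wander_disc(2) \<open>\<rho> > 0\<close> by force
      moreover have "3 * \<rho> * real (Suc j) \<le> 3 * \<rho> * real n" using j(1) \<open>\<rho> > 0\<close> by (intro mult_left_mono) auto
      ultimately show "z \<in> B n" using \<open>\<rho> > 0\<close> by (simp add: B_def algebra_simps)
    qed
    have "F n analytic_on K n" using anK[of n] by (simp add: F_def[abs_def] p_def)
    then have an: "g0 analytic_on K n" using KB by (rule an_g0)
    show ?thesis unfolding near_def
    proof (intro conjI ballI)
      show "g analytic_on K n" by (rule g_an[OF an])
      fix z assume z: "z \<in> K n"
      then show "dist (g z) (F n z) \<le> \<eta> n"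
        using tail[of z n] KB BU[of n] g_an(2)[OF an z] by (auto simp: dist_norm)
    qed
  qed
  have goodg: "good X \<rho> n (r n) (K n) g" for n
    by (rule good) (use near[of n] in \<open>simp add: F_def[abs_def] p_def\<close>)
  have trappedg: "trapped X \<rho> n (s n) (t n) (K (Suc n)) g" for n
    by (rule trapped) (use near[of "Suc n"] in \<open>simp add: F_def[abs_def] p_def\<close>)
  have an_pt: "g analytic_on {z}" if "z \<in> K n" for z n
    using near[of n] that by (auto simp: near_def intro: analytic_on_subset)
  have trapU: "trap_disc \<rho> \<subseteq> U 0"
    using disjoint_discs(2)[OF \<open>\<rho> > 0\<close>] by (auto simp: U_def)
  have trapB: "trap_disc \<rho> \<subseteq> B 2"
  proof
    fix z assume "z \<in> trap_disc \<rho>"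
    then have "dist (centre \<rho> (- 1)) z < \<rho>" by (simp add: trap_disc_def)
    moreover have "cmod (centre \<rho> (- 1)) = 3 * \<rho>" using \<open>\<rho> > 0\<close> unfolding centre_def norm_of_real by simp
    ultimately have "cmod z < 4 * \<rho>" 
      using norm_triangle_ineq2[of z "centre \<rho> (- 1)"] by (simp add: dist_norm norm_minus_commute)
    then show "z \<in> B 2" using \<open>\<rho> > 0\<close> by (simp add: B_def)
  qed
  have an_trap: "g0 analytic_on trap_disc \<rho>"
  proof (rule an_g0[OF _ trapB])
    have "F 2 holomorphic_on trap_disc \<rho>"
      unfolding F_def p_def using disjoint_discs(2)[OF \<open>\<rho> > 0\<close>] ls(1)
      by (intro holomorphic_intros holomorphic_pole_sum) blast
    then show "F 2 analytic_on trap_disc \<rho>" by (simp add: analytic_on_open trap_disc_def)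
  qed
  show ?thesis
  proof (rule that[of g s t])
    show "g nicely_meromorphic_on UNIV" unfolding g_def by (rule remove_sings_nicely_meromorphic[OF mero])
    show "g analytic_on trap_disc \<rho>" by (rule g_an[OF an_trap])
    show "g ` trap_disc \<rho> \<subseteq> trap_disc \<rho>"
    proof
      fix w assume "w \<in> g ` trap_disc \<rho>"
      then obtain z where z: "z \<in> trap_disc \<rho>" "w = g0 z" using g_an(2)[OF an_trap] by auto
      have "dist w (centre \<rho> (- 1)) \<le> \<rho> / 2"
        using tail[of z 0] trapU z \<eta>(2) by (auto simp: F_def dist_norm)
      then show "w \<in> trap_disc \<rho>" using \<open>\<rho> > 0\<close> by (simp add: trap_disc_def dist_commute)
    qed
    show "g analytic_on {(g ^^ n) z} \<and> (g ^^ n) z \<in> wander_disc \<rho> n" if "z \<in> X" for n z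
    proof -
      have "z \<in> nbhd X (r (Suc n))" using that r[of "Suc n"] by (simp add: nbhd_def)
      then have "(g ^^ n) z \<in> K (Suc n)" "(g ^^ n) z \<in> wander_disc \<rho> n"
        using goodg[of "Suc n"] unfolding good_def image_subset_iff
        by (metis lessI, metis lessI less_imp_le_nat)
      then show ?thesis using an_pt by blast
    qed
    show "(\<forall>i\<le>n. g analytic_on {(g ^^ i) z}) \<and> (g ^^ Suc n) z \<in> trap_disc \<rho>"
      if "z \<in> shell X (s n) (t n)" for n z
      using trappedg[of n] that an_pt unfolding trapped_def by blast
  qed (use st in auto)
qed

section \<open>Charts of the sphere and normality\<close>

lemma dist_Fin_Infinity: "dist (Fin z) Infinity = 2 / sqrt (1 + (cmod z)\<^sup>2)"
proof -
  define a where "a = (cmod z)\<^sup>2"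
  have a: "1 + a > 0" using one_plus_cmod_sq_pos[of z] by (simp add: a_def)
  have 1: "(cmod ((2 / (1 + a)) *\<^sub>R z))\<^sup>2 = 4 * a / (1 + a)\<^sup>2"
  proof -
    have "cmod ((2 / (1 + a)) *\<^sub>R z) = 2 / (1 + a) * cmod z" using a by simp
    then have "(cmod ((2 / (1 + a)) *\<^sub>R z))\<^sup>2 = (2 / (1 + a) * cmod z)\<^sup>2" by (rule arg_cong)
    also have "\<dots> = (2 / (1 + a))\<^sup>2 * a" unfolding power_mult_distrib a_def ..
    also have "\<dots> = 4 * a / (1 + a)\<^sup>2" by (simp add: power_divide)
    finally show ?thesis .
  qed
  have 2: "((a - 1) / (a + 1) - 1)\<^sup>2 = 4 / (1 + a)\<^sup>2"
  proof -
    have "(a - 1) / (a + 1) - 1 = - 2 / (1 + a)" using a by (simp add: field_simps)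
    then show ?thesis by (simp only: power_divide) simp
  qed
  have "dist (Fin z) Infinity = sqrt (4 * a / (1 + a)\<^sup>2 + 4 / (1 + a)\<^sup>2)"
    unfolding dist_riemann_sphere_def stereographic.simps dist_Pair_Pair dist_real_def a_def[symmetric]
    unfolding dist_norm diff_zero power2_abs 1 2 ..
  also have "4 * a / (1 + a)\<^sup>2 + 4 / (1 + a)\<^sup>2 = 2\<^sup>2 / (1 + a)"
    using a by (simp add: divide_simps) (simp add: power2_eq_square algebra_simps)
  also have "sqrt (2\<^sup>2 / (1 + a)) = 2 / sqrt (1 + a)" by (simp only: real_sqrt_divide real_sqrt_abs abs_numeral)
  finally show ?thesis by (simp add: a_def)
qed

lemma continuous_on_stereographic: "continuous_on A stereographic"
  unfolding continuous_on_iff dist_riemann_sphere_def by blast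

lemma tendsto_sphere_iff: "(h \<longlongrightarrow> x) F \<longleftrightarrow> ((\<lambda>y. stereographic (h y)) \<longlongrightarrow> stereographic x) F"
  unfolding tendsto_iff dist_riemann_sphere_def by simp

lemma isCont_Fin: "isCont Fin z"
  unfolding isCont_def tendsto_sphere_iff
  by (auto intro!: tendsto_eq_intros simp: add_nonneg_eq_0_iff)

lemma continuous_on_Fin: "continuous_on A Fin"
  by (simp add: continuous_at_imp_continuous_on isCont_Fin)

text \<open>
  Inverse stereographic projection, which makes it evident that \<open>Fin\<close> is an open embedding.
\<close>

definition unFin :: "riemann_sphere \<Rightarrow> complex" where
  "unFin x = fst (stereographic x) / of_real (1 - snd (stereographic x))"

lemma unFin_Fin [simp]: "unFin (Fin z) = z"
proof -
  define a where "a = (cmod z)\<^sup>2"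
  have a: "1 + a > 0" using one_plus_cmod_sq_pos[of z] by (simp add: a_def)
  have *: "1 - (a - 1) / (a + 1) = 2 / (1 + a)" using a by (simp add: field_simps)
  have "unFin (Fin z) = (2 / (1 + a)) *\<^sub>R z / of_real (2 / (1 + a))"
    by (simp only: unFin_def stereographic.simps fst_conv snd_conv a_def[symmetric] *)
  also have "\<dots> = z" using a unfolding scaleR_conv_of_real
    by (intro nonzero_mult_div_cancel_left) (simp only: of_real_eq_0_iff; simp)
  finally show ?thesis .
qed

lemma snd_stereographic_ne_1: "x \<noteq> Infinity \<Longrightarrow> snd (stereographic x) \<noteq> 1"
proof (cases x)
  case (Fin z)
  then show ?thesis using one_plus_cmod_sq_pos[of z] by (auto simp: divide_simps)
qed auto

lemma continuous_on_unFin: "continuous_on (- {Infinity}) unFin"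
  unfolding unFin_def
  by (intro continuous_intros continuous_on_stereographic) (auto dest: snd_stereographic_ne_1)

lemma open_Fin_image:
  assumes "open W"
  shows "open (Fin ` W)"
proof -
  have "open (unFin -` W \<inter> - {Infinity})"
    using continuous_on_unFin \<open>open W\<close> by (intro continuous_open_preimage[OF _ _ assms, of "- {Infinity}" unFin, unfolded Int_commute[of "- {Infinity}"]]) auto
  moreover have "unFin -` W \<inter> - {Infinity} = Fin ` W"
  proof -
    have "x \<in> Fin ` W" if "unFin x \<in> W" "x \<noteq> Infinity" for x
      using that by (cases x) auto
    then show ?thesis by auto
  qed
  ultimately show ?thesis by simp
qed

lemma uniform_limit_continuous_compose:
  fixes M :: "complex \<Rightarrow> 'b::metric_space"
  assumes lim: "uniform_limit K h l sequentially" and M: "continuous_on UNIV M"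
    and bd: "\<And>n z. z \<in> K \<Longrightarrow> cmod (h n z) \<le> R"
  shows "uniform_limit K (\<lambda>n z. M (h n z)) (\<lambda>z. M (l z)) sequentially"
proof -
  have ld: "cmod (l z) \<le> R" if "z \<in> K" for z
    using tendsto_norm[OF tendsto_uniform_limitI[OF lim that]] bd[OF that]
    by (intro tendsto_upperbound[where f = "\<lambda>n. cmod (h n z)"]) auto
  have "uniformly_continuous_on (cball 0 R) M"
    by (intro compact_uniformly_continuous continuous_on_subset[OF M]) auto
  show ?thesis
    unfolding uniform_limit_iff
  proof (intro allI impI)
    fix e :: real assume "e > 0"
    then obtain d where d: "d > 0" "\<And>x y. x \<in> cball 0 R \<Longrightarrow> y \<in> cball 0 R \<Longrightarrow> dist y x < d \<Longrightarrow> dist (M y) (M x) < e"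
      using \<open>uniformly_continuous_on (cball 0 R) M\<close> unfolding uniformly_continuous_on_def by metis
    have "\<forall>\<^sub>F n in sequentially. \<forall>z\<in>K. dist (h n z) (l z) < d"
      using lim d(1) unfolding uniform_limit_iff by blast
    then show "\<forall>\<^sub>F n in sequentially. \<forall>z\<in>K. dist (M (h n z)) (M (l z)) < e"
      by eventually_elim (auto intro!: d(2) bd ld)
  qed
qed

text \<open>
  Montel's theorem in a chart: the iterates need not be finite, as long as they factor through one continuous
  map \<open>M\<close> from the plane to the sphere.  Below \<open>M\<close> is \<open>Fin\<close> or the chart \<open>inv_param\<close> around infinity.
\<close>

lemma iterates_normal_on_chart:
  assumes "open W" and M: "continuous_on UNIV M"
    and hol: "\<And>k. h k holomorphic_on W"
    and bd: "\<And>K. compact K \<Longrightarrow> K \<subseteq> W \<Longrightarrow> \<exists>B. \<forall>k. \<forall>z\<in>K. cmod (h k z) \<le> B"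
    and it: "\<And>k z. z \<in> W \<Longrightarrow> iterate f k (Fin z) = Some (M (h k z))"
  shows "iterates_normal_on f (Fin ` W)"
  unfolding iterates_normal_on_def
proof
  show "\<forall>n. Fin ` W \<subseteq> dom (iterate f n)" using it by auto
  show "normal_family_on (Fin ` W) (range (\<lambda>n x. the (iterate f n x)))"
    unfolding normal_family_on_def
  proof (intro allI impI)
    fix s :: "nat \<Rightarrow> riemann_sphere \<Rightarrow> riemann_sphere"
    assume "range s \<subseteq> range (\<lambda>n x. the (iterate f n x))"
    then have "\<forall>i. \<exists>k. s i = (\<lambda>x. the (iterate f k x))" by blast
    then obtain k where k: "\<And>i. s i = (\<lambda>x. the (iterate f (k i) x))" by metis
    have sM: "s i (Fin z) = M (h (k i) z)" if "z \<in> W" for i z using it[OF that] by (simp add: k)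
    obtain l r where lr: "strict_mono (r :: nat \<Rightarrow> nat)"
      "\<And>K. compact K \<Longrightarrow> K \<subseteq> W \<Longrightarrow> uniform_limit K ((\<lambda>i. h (k i)) \<circ> r) l sequentially"
    proof (rule Montel[of W "range h" "\<lambda>i. h (k i)"])
      show "\<exists>B. \<forall>h\<in>range h. \<forall>z\<in>K. cmod (h z) \<le> B" if "compact K" "K \<subseteq> W" for K
        using bd[OF that] by auto
    qed (use \<open>open W\<close> hol in auto)
    show "\<exists>r l. strict_mono r \<and> (\<forall>K. compact K \<and> K \<subseteq> Fin ` W \<longrightarrow> uniform_limit K (s \<circ> r) l sequentially)"
    proof (intro exI conjI allI impI)
      show "strict_mono r" by fact
      fix C assume C: "compact C \<and> C \<subseteq> Fin ` W"
      define K where "K = unFin ` C"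
      have "C \<subseteq> - {Infinity}" using C by auto
      then have K: "compact K" "K \<subseteq> W"
        using C unfolding K_def by (auto intro!: compact_continuous_image continuous_on_subset[OF continuous_on_unFin])
      obtain B where B: "\<And>k z. z \<in> K \<Longrightarrow> cmod (h k z) \<le> B" using bd[OF K] by blast
      have "uniform_limit K (\<lambda>i z. M (((\<lambda>i. h (k i)) \<circ> r) i z)) (\<lambda>z. M (l z)) sequentially"
        by (rule uniform_limit_continuous_compose[OF lr(2)[OF K] M]) (use B in auto)
      then show "uniform_limit C (s \<circ> r) (\<lambda>x. M (l (unFin x))) sequentially"
        unfolding uniform_limit_iff
      proof (intro allI impI, goal_cases)
        case (1 e)
        then have "\<forall>\<^sub>F n in sequentially. \<forall>z\<in>K. dist (M (((\<lambda>i. h (k i)) \<circ> r) n z)) (M (l z)) < e" by blast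
        then show ?case
        proof eventually_elim
          case (elim n)
          show ?case
          proof
            fix x assume "x \<in> C"
            then obtain z where z: "x = Fin z" "z \<in> W" using C by blast
            have "z \<in> K" using \<open>x \<in> C\<close> by (force simp: K_def z(1) image_iff)
            then show "dist ((s \<circ> r) n x) (M (l (unFin x))) < e"
              using elim sM[OF z(2)] by (simp add: z(1))
          qed
        qed
      qed
    qed
  qed
qed

lemma Fatou_setI: "open U \<Longrightarrow> iterates_normal_on f U \<Longrightarrow> x \<in> U \<Longrightarrow> x \<in> Fatou_set f"
  by (auto simp: Fatou_set_def)

lemma iterate_Fin:
  assumes f: "\<And>z. f z = (if is_pole g z then Infinity else Fin (g z))"
    and orb: "\<And>i. i < n \<Longrightarrow> g analytic_on {(g ^^ i) z}"
  shows "iterate f n (Fin z) = Some (Fin ((g ^^ n) z))"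
  using orb
proof (induction n)
  case (Suc n)
  have "\<not> is_pole g ((g ^^ n) z)"
    using Suc.prems[of n] by (auto simp: analytic_at dest: not_is_pole_holomorphic)
  then show ?case using Suc by (simp add: f)
qed auto

lemma holomorphic_funpow:
  assumes "open W" and orb: "\<And>i z. i < k \<Longrightarrow> z \<in> W \<Longrightarrow> g analytic_on {(g ^^ i) z}"
  shows "(g ^^ k) holomorphic_on W"
  using orb
proof (induction k)
  case (Suc k)
  have "(g ^^ k) analytic_on W" using Suc \<open>open W\<close> by (simp add: analytic_on_open)
  moreover have "g analytic_on (g ^^ k) ` W"
    using Suc.prems[of k] analytic_on_analytic_at by blast
  ultimately have "(g \<circ> (g ^^ k)) analytic_on W" by (rule analytic_on_compose)
  then show ?case by (simp add: analytic_imp_holomorphic o_def)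
qed auto

lemma isCont_funpow:
  fixes g :: "complex \<Rightarrow> complex"
  assumes "\<And>i. i < k \<Longrightarrow> g analytic_on {(g ^^ i) z}"
  shows "isCont (g ^^ k) z"
  using assms
proof (induction k)
  case (Suc k)
  then have "isCont (g \<circ> (g ^^ k)) z"
    by (intro continuous_at_compose) (auto intro: analytic_at_imp_isCont)
  then show ?case by (simp add: o_def)
qed auto

text \<open>
  Shells separate \<open>X\<close> from the points outside them, whatever the topology of \<open>X\<close>: a connected set that meets \<open>X\<close>
  and a point beyond the shell meets the shell, by the intermediate value theorem.
\<close>

lemma connected_attains_infdist:
  fixes C :: "complex set"
  assumes "connected C" "x \<in> C" "x \<in> X" "y \<in> C" "0 \<le> m" "m \<le> infdist y X"
  obtains z where "z \<in> C" "infdist z X = m"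
proof -
  have "connected ((\<lambda>z. infdist z X) ` C)"
    by (intro connected_continuous_image continuous_intros assms)
  moreover have "0 \<in> (\<lambda>z. infdist z X) ` C" using assms by (force simp: image_iff)
  moreover have "infdist y X \<in> (\<lambda>z. infdist z X) ` C" using assms by auto
  ultimately have "m \<in> (\<lambda>z. infdist z X) ` C"
    using assms unfolding connected_iff_interval by blast
  then show ?thesis using that by auto
qed

section \<open>Every continuum with empty interior is a Julia component\<close>

text \<open>
  The interiors of the shells lie in the Fatou set, since their orbits end in the trap; as the shells shrink to \<open>X\<close>,
  no connected subset of the Julia set properly contains \<open>X\<close>.  Conversely, every point \<open>x\<close> of \<open>X\<close> is in the Julia
  set: its orbit escapes to infinity, while arbitrarily close to \<open>x\<close> there are points of shells, with orbits that
  end in the trap.  This is where the empty interior is used, and it contradicts locally uniform convergence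
  of a subsequence of the iterates.  All these orbits stay in the plane, so the argument is the
  same for rational and for transcendental functions.
\<close>

theorem Julia_component_if_empty_interior:
  fixes X :: "complex set"
  assumes "X \<noteq> {}" "closed X" "connected X" "bounded X" "interior X = {}"
  shows "\<exists>f. meromorphic_fun f \<and> X \<in> components (Julia_set f)"
proof -
  have "compact X" using assms by (simp add: compact_eq_bounded_closed)
  obtain \<rho> where \<rho>: "\<rho> > 0" "X \<subseteq> ball 0 \<rho>" using bounded_subset_ballD[OF \<open>bounded X\<close>] by blast
  obtain g s t where g:
    "g nicely_meromorphic_on UNIV"
    "g analytic_on trap_disc \<rho>" "g ` trap_disc \<rho> \<subseteq> trap_disc \<rho>" and
    gX: "\<And>n z. z \<in> X \<Longrightarrow> g analytic_on {(g ^^ n) z} \<and> (g ^^ n) z \<in> wander_disc \<rho> n" and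
    st: "\<And>n. 0 < s n" "\<And>n. s n < t n" "\<And>n. t n \<le> 1 / (real n + 1)" and
    shell: "\<And>n z. z \<in> shell X (s n) (t n) \<Longrightarrow>
       (\<forall>i\<le>n. g analytic_on {(g ^^ i) z}) \<and> (g ^^ Suc n) z \<in> trap_disc \<rho>"
    using wandering_function[OF \<open>compact X\<close> \<open>X \<noteq> {}\<close> \<rho>(2,1)] by metis
  define f where "f z = (if is_pole g z then Infinity else Fin (g z))" for z
  have "meromorphic_fun f" unfolding meromorphic_fun_def f_def using g(1) by blast
  have trapped: "(g ^^ k) z \<in> trap_disc \<rho>" if "z \<in> shell X (s n) (t n)" "Suc n \<le> k" for n k z
    using that(2)
  proof (induction k rule: dec_induct)
    case base
    then show ?case using shell that(1) by blast
  next
    case (step k)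
    then show ?case using g(3) by auto
  qed
  have shell_an: "g analytic_on {(g ^^ i) z}" if "z \<in> shell X (s n) (t n)" for n i z
  proof (cases "i \<le> n")
    case False
    then show ?thesis using trapped[OF that, of i] g(2) by (auto intro: analytic_on_subset)
  qed (use shell that in blast)
  have it: "iterate f k (Fin z) = Some (Fin ((g ^^ k) z))"
    if "z \<in> X \<or> z \<in> shell X (s n) (t n)" for k z n
    by (rule iterate_Fin) (use that gX shell_an in \<open>auto simp: f_def\<close>)
  define R where "R = cmod (centre \<rho> (- 1)) + \<rho>"
  have R: "cmod z \<le> R" if "z \<in> trap_disc \<rho>" for z
    using that norm_triangle_ineq2[of z "centre \<rho> (- 1)"]
    by (simp add: trap_disc_def R_def dist_norm norm_minus_commute)
  have Fatou: "Fin z \<in> Fatou_set f" if "s n < infdist z X" "infdist z X < t n" for n z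
  proof -
    define W where "W = {z. s n < infdist z X} \<inter> {z. infdist z X < t n}"
    have "open W" unfolding W_def by (intro open_Int open_Collect_less continuous_intros)
    have W: "w \<in> shell X (s n) (t n)" if "w \<in> W" for w using that by (auto simp: W_def shell_def)
    have hol: "(g ^^ k) holomorphic_on W" for k
      by (rule holomorphic_funpow[OF \<open>open W\<close>]) (use W shell_an in blast)
    have "iterates_normal_on f (Fin ` W)"
    proof (rule iterates_normal_on_chart[where h = "\<lambda>k. g ^^ k", OF \<open>open W\<close> continuous_on_Fin hol])
      show "iterate f k (Fin z) = Some (Fin ((g ^^ k) z))" if "z \<in> W" for k z
        using it W that by blast
      fix K assume K: "compact K" "K \<subseteq> W"
      have "\<exists>B. \<forall>z\<in>K. cmod ((g ^^ k) z) \<le> B" for k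
      proof -
        have "compact ((g ^^ k) ` K)"
          using K by (intro compact_continuous_image holomorphic_on_imp_continuous_on holomorphic_on_subset[OF hol])
        then show ?thesis using compact_imp_bounded bounded_iff by (metis image_eqI)
      qed
      then obtain B where B: "\<And>k z. z \<in> K \<Longrightarrow> cmod ((g ^^ k) z) \<le> B k" by metis
      have "cmod ((g ^^ k) z) \<le> Max (insert R (B ` {..n}))" if "z \<in> K" for k z
      proof (cases "k \<le> n")
        case True
        then have "B k \<le> Max (insert R (B ` {..n}))" by (intro Max_ge) auto
        with B[OF that, of k] show ?thesis by linarith
      next
        case False
        then have "cmod ((g ^^ k) z) \<le> R" using that K W by (intro R trapped[of _ n]) auto
        also have "R \<le> Max (insert R (B ` {..n}))" by (intro Max_ge) auto
        finally show ?thesis .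
      qed
      then show "\<exists>B. \<forall>k. \<forall>z\<in>K. cmod ((g ^^ k) z) \<le> B" by blast
    qed
    then show ?thesis
      using that by (intro Fatou_setI[OF open_Fin_image[OF \<open>open W\<close>]]) (auto simp: W_def)
  qed
  have small: "\<exists>n. t n < m" if "m > 0" for m
  proof -
    obtain n where "1 / m < real n" using reals_Archimedean2 by blast
    then have "1 / (real n + 1) < m" using that by (simp add: field_simps)
    then show ?thesis using st(3)[of n] by (intro exI[of _ n]) linarith
  qed
  have "X \<subseteq> Julia_set f"
  proof
    fix x assume x: "x \<in> X"
    show "x \<in> Julia_set f"
    proof (rule ccontr)
      assume "x \<notin> Julia_set f"
      then obtain U where U: "open U" "Fin x \<in> U" "iterates_normal_on f U"
        by (auto simp: Julia_set_def Fatou_set_def)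
      have "range (\<lambda>k x. the (iterate f k x)) \<subseteq> range (\<lambda>k x. the (iterate f k x))" by simp
      then obtain r l where r: "strict_mono (r :: nat \<Rightarrow> nat)" and
        l: "\<And>K. compact K \<Longrightarrow> K \<subseteq> U \<Longrightarrow> uniform_limit K ((\<lambda>k x. the (iterate f k x)) \<circ> r) l sequentially"
        using U(3) unfolding iterates_normal_on_def normal_family_on_def by metis
      have "open (Fin -` U)"
        using continuous_open_vimage[OF U(1)] isCont_Fin by blast
      then obtain \<delta> where \<delta>: "\<delta> > 0" "cball x \<delta> \<subseteq> Fin -` U"
        using U(2) open_contains_cball by (metis vimageI)
      define c where "c = 2 / sqrt (1 + R\<^sup>2)"
      have "c > 0" unfolding c_def using one_plus_cmod_sq_pos[of "of_real R"] by simp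
      have c: "c \<le> dist (Fin z) Infinity" if "cmod z \<le> R" for z
        using that one_plus_cmod_sq_pos[of z] unfolding dist_Fin_Infinity c_def
        by (intro divide_left_mono mult_pos_pos real_sqrt_le_mono add_left_mono power_mono) (auto simp: add_pos_nonneg)
      have "\<forall>\<^sub>F n in sequentially. \<forall>y\<in>Fin ` cball x \<delta>. dist (the (iterate f (r n) y)) (l y) < c / 4"
      proof -
        have "uniform_limit (Fin ` cball x \<delta>) ((\<lambda>k x. the (iterate f k x)) \<circ> r) l sequentially"
          using \<delta>(2) by (intro l compact_continuous_image continuous_on_Fin) auto
        from uniform_limitD[OF this, of "c / 4"] show ?thesis using \<open>c > 0\<close> by (simp only: o_def ball_simps)
      qed
      then obtain N where N: "\<And>n y. n \<ge> N \<Longrightarrow> y \<in> cball x \<delta> \<Longrightarrow> dist (the (iterate f (r n) (Fin y))) (l (Fin y)) < c / 4"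
        unfolding eventually_sequentially by blast
      have itx: "iterate f k (Fin x) = Some (Fin ((g ^^ k) x))" for k using it x by blast
      \<comment> \<open>the orbit of \<open>x\<close> escapes\<close>
      obtain n where n: "n \<ge> N" "dist (Fin ((g ^^ r n) x)) Infinity < c / 4"
      proof -
        obtain n0 where n0: "(8 / c + \<rho>) / (3 * \<rho>) < real n0" using reals_Archimedean2 by blast
        define n where "n = max N n0"
        have "real n0 \<le> real (r n)" using seq_suble[OF r, of n] by (simp add: n_def)
        then have "real n0 * (3 * \<rho>) \<le> real (r n) * (3 * \<rho>)"
          using \<rho>(1) by (intro mult_right_mono) auto
        moreover have "8 / c + \<rho> < real n0 * (3 * \<rho>)"
          using n0 \<rho>(1) by (simp add: pos_divide_less_eq)
        ultimately have "8 / c + \<rho> < 3 * \<rho> * real (r n)" by (simp add: mult_ac)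
        moreover have "3 * \<rho> * real (r n) - \<rho> < cmod ((g ^^ r n) x)"
          using gX[OF x, of "r n"] cmod_in_wander_disc(1) by blast
        ultimately have "8 / c < cmod ((g ^^ r n) x)" by linarith
        also have "\<dots> \<le> sqrt (1 + (cmod ((g ^^ r n) x))\<^sup>2)" by (intro real_le_rsqrt) simp
        finally have q: "8 / c < sqrt (1 + (cmod ((g ^^ r n) x))\<^sup>2)" (is "_ < ?q") .
        have "?q > 0" using one_plus_cmod_sq_pos[of "(g ^^ r n) x"] by simp
        with q have "2 / ?q < c / 4" using \<open>c > 0\<close> by (simp add: field_simps)
        then have "dist (Fin ((g ^^ r n) x)) Infinity < c / 4" by (simp only: dist_Fin_Infinity)
        then show ?thesis using that[of n] by (simp add: n_def)
      qed
      have "isCont (\<lambda>y. Fin ((g ^^ r n) y)) x"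
        using gX[OF x] by (intro isCont_o2[OF isCont_funpow isCont_Fin]) blast
      then obtain d where d: "d > 0" "\<And>y. dist y x < d \<Longrightarrow> dist (Fin ((g ^^ r n) y)) (Fin ((g ^^ r n) x)) < c / 4"
        using \<open>c > 0\<close> unfolding continuous_at_eps_delta by (metis zero_less_divide_iff zero_less_numeral)
      \<comment> \<open>a point near \<open>x\<close> whose orbit ends in the trap\<close>
      have "\<not> ball x (min d \<delta>) \<subseteq> X"
        using \<open>interior X = {}\<close> d(1) \<delta>(1) by (metis empty_iff mem_interior min_less_iff_conj)
      then obtain q where q: "q \<in> ball x (min d \<delta>)" "q \<notin> X" by blast
      have "infdist q X > 0"
        using q(2) \<open>closed X\<close> \<open>X \<noteq> {}\<close> by (metis in_closed_iff_infdist_zero infdist_nonneg less_eq_real_def)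
      then obtain m where m: "t m < infdist q X" using small by blast
      obtain y where y: "y \<in> ball x (min d \<delta>)" "infdist y X = t m"
        using connected_attains_infdist[OF connected_ball, of x x "min d \<delta>" X q "t m"] x q(1) m d(1) \<delta>(1) st(1,2)[of m]
        by (metis centre_in_ball less_eq_real_def less_trans min_less_iff_conj)
      have ysh: "y \<in> shell X (s m) (t m)" using y(2) st(2)[of m] by (simp add: shell_def)
      have ity: "iterate f k (Fin y) = Some (Fin ((g ^^ k) y))" for k using it ysh by blast
      have yd: "y \<in> cball x \<delta>" "dist y x < d" using y(1) by (auto simp: dist_commute)
      define n' where "n' = max N (Suc m)"
      have "Suc m \<le> r n'" using seq_suble[OF r, of n'] by (simp add: n'_def)
      then have "c \<le> dist (Fin ((g ^^ r n') y)) Infinity" by (intro c R trapped[OF ysh])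
      moreover have "dist (Fin ((g ^^ r n') y)) (l (Fin y)) < c / 4"
        using N[of n' y] yd by (simp add: ity n'_def)
      moreover have "dist (Fin ((g ^^ r n) y)) (l (Fin y)) < c / 4"
        using N[OF n(1) yd(1)] by (simp add: ity)
      moreover note d(2)[OF yd(2)] n(2)
      moreover have "dist (Fin ((g ^^ r n') y)) Infinity \<le> dist (Fin ((g ^^ r n') y)) (l (Fin y))
          + dist (Fin ((g ^^ r n) y)) (l (Fin y))
          + dist (Fin ((g ^^ r n) y)) (Fin ((g ^^ r n) x)) + dist (Fin ((g ^^ r n) x)) Infinity"
        using dist_triangle[of "Fin ((g ^^ r n') y)" Infinity "l (Fin y)"]
          dist_triangle3[of "l (Fin y)" Infinity "Fin ((g ^^ r n) y)"]
          dist_triangle[of "Fin ((g ^^ r n) y)" Infinity "Fin ((g ^^ r n) x)"] by linarith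
      ultimately show False by linarith
    qed
  qed
  moreover have "d \<subseteq> X" if d: "X \<subseteq> d" "d \<subseteq> Julia_set f" "connected d" for d
  proof
    fix y assume "y \<in> d"
    obtain x where "x \<in> X" using \<open>X \<noteq> {}\<close> by blast
    show "y \<in> X"
    proof (rule ccontr)
      assume "y \<notin> X"
      then have "infdist y X > 0"
        using \<open>closed X\<close> \<open>X \<noteq> {}\<close> by (metis in_closed_iff_infdist_zero infdist_nonneg less_eq_real_def)
      then obtain n where n: "t n < infdist y X" using small by blast
      define m where "m = (s n + t n) / 2"
      have m: "s n < m" "m < t n" "0 \<le> m" "m \<le> infdist y X"
        using n st(1,2)[of n] by (auto simp: m_def)
      obtain z where "z \<in> d" "infdist z X = m"
        using connected_attains_infdist[OF d(3) _ \<open>x \<in> X\<close> \<open>y \<in> d\<close> m(3,4)] \<open>x \<in> X\<close> d(1) by blast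
      then show False using Fatou[of n z] m d(2) by (auto simp: Julia_set_def)
    qed
  qed
  ultimately have "X \<in> components (Julia_set f)"
    using assms unfolding in_components_maximal by blast
  with \<open>meromorphic_fun f\<close> show ?thesis by blast
qed

section \<open>Meromorphic functions that omit an open set near infinity\<close>

lemma cmod_poly_le:
  fixes p :: "complex poly"
  obtains C where "C > 0" "\<And>z. 1 \<le> cmod z \<Longrightarrow> cmod (poly p z) \<le> C * cmod z ^ degree p"
proof
  let ?C = "1 + (\<Sum>i\<le>degree p. cmod (coeff p i))"
  show "?C > 0" by (intro add_pos_nonneg sum_nonneg) auto
  fix z :: complex assume z: "1 \<le> cmod z"
  have "cmod (poly p z) \<le> (\<Sum>i\<le>degree p. cmod (coeff p i * z ^ i))"
    unfolding poly_altdef by (rule norm_sum)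
  also have "\<dots> \<le> (\<Sum>i\<le>degree p. cmod (coeff p i) * cmod z ^ degree p)"
    using z by (intro sum_mono) (auto simp: norm_mult norm_power intro!: mult_left_mono power_increasing)
  also have "\<dots> \<le> ?C * cmod z ^ degree p"
    by (simp add: sum_distrib_right[symmetric] mult_right_mono)
  finally show "cmod (poly p z) \<le> ?C * cmod z ^ degree p" .
qed

lemma pole_cancel:
  assumes "g meromorphic_on {p}" "is_pole g p"
  shows "\<exists>n c. ((\<lambda>z. g z * (z - p) ^ n) \<longlongrightarrow> c) (at p)"
proof -
  obtain r0 where r0: "r0 > 0" "g holomorphic_on ball p r0 - {p}"
    using meromorphic_on_isolated_singularity[OF assms(1)]
    by (auto simp: isolated_singularity_at_def intro: analytic_imp_holomorphic)
  define n where "n = nat (- zorder g p)"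
  obtain r where r: "r > 0" "zor_poly g p holomorphic_on cball p r"
    "\<And>w. w \<in> cball p r - {p} \<Longrightarrow> g w = zor_poly g p w / (w - p) ^ n"
    using zorder_exist_pole[OF r0(2) _ _ assms(2)] r0(1) unfolding n_def by auto
  have "isCont (zor_poly g p) p"
    using r(1) by (intro continuous_on_interior[OF holomorphic_on_imp_continuous_on[OF r(2)]]) simp
  then have "(zor_poly g p \<longlongrightarrow> zor_poly g p p) (at p)" by (simp add: isCont_def)
  moreover have "\<forall>\<^sub>F w in at p. zor_poly g p w = g w * (w - p) ^ n"
  proof -
    have "\<forall>\<^sub>F w in at p. w \<in> ball p r - {p}" using r(1) by (intro eventually_at_in_open) auto
    then show ?thesis by eventually_elim (use r(3) in auto)
  qed
  ultimately have "((\<lambda>z. g z * (z - p) ^ n) \<longlongrightarrow> zor_poly g p p) (at p)"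
    by (rule Lim_transform_eventually)
  then show ?thesis by blast
qed

text \<open>
  Clear denominators and apply Liouville's theorem.  The exponents are one larger than necessary, so that
  the cleared denominator vanishes at every pole and nothing has to be said about the values of \<open>g\<close> there.
\<close>

lemma rational_if_polynomial_growth:
  assumes g: "g nicely_meromorphic_on UNIV" and fin: "finite {z. is_pole g z}"
    and growth: "\<And>z. A \<le> cmod z \<Longrightarrow> cmod (g z) \<le> B * cmod z ^ m"
  shows "\<exists>p q. q \<noteq> 0 \<and> (\<forall>z. poly q z \<noteq> 0 \<longrightarrow> \<not> is_pole g z \<and> g z = poly p z / poly q z)"
proof -
  define P where "P = {z. is_pole g z}"
  have mero: "g meromorphic_on S" for S
    using g unfolding nicely_meromorphic_on_def by (blast intro: meromorphic_on_subset)
  have "\<forall>p\<in>P. \<exists>n c. ((\<lambda>z. g z * (z - p) ^ n) \<longlongrightarrow> c) (at p)"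
    using pole_cancel[OF mero] by (auto simp: P_def)
  then obtain n c where nc: "\<And>p. p \<in> P \<Longrightarrow> ((\<lambda>z. g z * (z - p) ^ n p) \<longlongrightarrow> c p) (at p)"
    by metis
  define Q where "Q = (\<Prod>p\<in>P. [:- p, 1:] ^ (Suc (n p)))"
  have Q: "poly Q z = (\<Prod>p\<in>P. (z - p) ^ Suc (n p))" for z
    by (simp add: Q_def poly_prod poly_power algebra_simps)
  have "Q \<noteq> 0" unfolding Q_def using fin by (auto simp: P_def simp del: power_Suc)
  have root: "poly Q p = 0" if "p \<in> P" for p
    unfolding Q using fin that by (intro prod_zero) (auto simp: P_def)
  define G where "G z = g z * poly Q z" for z
  define e where "e = remove_sings G"
  have anQ: "poly Q analytic_on S" for S
  proof (rule analytic_on_subset)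
    have "(\<lambda>z. poly Q z) holomorphic_on UNIV" unfolding poly_altdef by (intro holomorphic_intros)
    then show "poly Q analytic_on UNIV" by (simp add: analytic_on_open)
  qed simp
  have meroG: "G meromorphic_on S" for S
    unfolding G_def by (intro meromorphic_intros mero analytic_on_imp_meromorphic_on anQ)
  have anG: "G analytic_on {z}" if "z \<notin> P" for z
    unfolding G_def using that
    by (intro analytic_on_mult nicely_meromorphic_on_imp_analytic_at[OF g] anQ) (auto simp: P_def)
  have e_eq: "e z = g z * poly Q z" if "z \<notin> P" for z
    unfolding e_def using anG[OF that] by (simp add: G_def)
  have "e analytic_on {z}" for z
  proof (cases "z \<in> P")
    case False
    then show ?thesis unfolding e_def by (intro remove_sings_analytic_on anG)
  next
    case True
    have "G w = (g w * (w - z) ^ n z) * ((w - z) * (\<Prod>p\<in>P - {z}. (w - p) ^ Suc (n p)))" for w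
      unfolding G_def Q using fin True
      by (simp add: P_def[symmetric] prod.remove[of P z] mult_ac)
    moreover have "((\<lambda>w. (g w * (w - z) ^ n z) * ((w - z) * (\<Prod>p\<in>P - {z}. (w - p) ^ Suc (n p))))
       \<longlongrightarrow> c z * ((z - z) * (\<Prod>p\<in>P - {z}. (z - p) ^ Suc (n p)))) (at z)"
      by (intro tendsto_intros nc True)
    ultimately have "(G \<longlongrightarrow> c z * ((z - z) * (\<Prod>p\<in>P - {z}. (z - p) ^ Suc (n p)))) (at z)"
      by (subst (asm) filterlim_cong[OF refl refl always_eventually, of _ G]) (auto intro: ext)
    then show ?thesis
      unfolding e_def by (intro remove_sings_analytic_at meromorphic_on_isolated_singularity meroG)
  qed
  then have hole: "e holomorphic_on UNIV"
    using analytic_on_analytic_at analytic_imp_holomorphic by blast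
  obtain C where C: "C > 0" "\<And>z. 1 \<le> cmod z \<Longrightarrow> cmod (poly Q z) \<le> C * cmod z ^ degree Q"
    using cmod_poly_le by blast
  obtain R where R: "\<And>p. p \<in> P \<Longrightarrow> cmod p < R"
    using finite_imp_bounded[OF fin] unfolding bounded_iff P_def by (metis gt_ex order.strict_trans1)
  have "e z = (\<Sum>k\<le>m + degree Q. (deriv ^^ k) e 0 / fact k * z ^ k)" for z
  proof (rule Liouville_polynomial[OF hole])
    fix z assume z: "max (max A 1) R \<le> cmod z"
    then have "z \<notin> P" using R by force
    then have "cmod (e z) = cmod (g z) * cmod (poly Q z)" by (simp add: e_eq norm_mult)
    also have "\<dots> \<le> (B * cmod z ^ m) * (C * cmod z ^ degree Q)"
      using z growth[of z] C(2)[of z] by (intro mult_mono) (auto intro: order_trans[OF norm_ge_zero])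
    finally show "cmod (e z) \<le> (B * C) * cmod z ^ (m + degree Q)" by (simp add: power_add mult_ac)
  qed
  moreover define p where "p = (\<Sum>k\<le>m + degree Q. monom ((deriv ^^ k) e 0 / fact k) k)"
  ultimately have ep: "e z = poly p z" for z by (simp add: poly_sum poly_monom)
  have "\<not> is_pole g z \<and> g z = poly p z / poly Q z" if "poly Q z \<noteq> 0" for z
  proof -
    have "z \<notin> P" using root that by blast
    then show ?thesis using e_eq[of z] that by (simp add: P_def ep)
  qed
  with \<open>Q \<noteq> 0\<close> show ?thesis by blast
qed

text \<open>
  A form of the Casorati-Weierstrass theorem in which poles may accumulate at infinity.  If \<open>g\<close> stays away
  from \<open>a\<close> near infinity, then \<open>1 / (g - a)\<close> is bounded there, so its singularity at infinity is removable; the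
  order of its zero at infinity bounds the growth of \<open>g\<close>, and its zeros, the poles of \<open>g\<close>, cannot accumulate.
\<close>

lemma rational_if_omits_near_infinity:
  assumes g: "g nicely_meromorphic_on UNIV" and "\<rho> > 0" "R > 0"
    and omit: "\<And>z. R < cmod z \<Longrightarrow> \<not> is_pole g z \<Longrightarrow> \<rho> \<le> cmod (g z - a)"
  shows "\<exists>p q. q \<noteq> 0 \<and> (\<forall>z. poly q z \<noteq> 0 \<longrightarrow> \<not> is_pole g z \<and> g z = poly p z / poly q z)"
proof -
  have mero: "g meromorphic_on S" for S
    using g unfolding nicely_meromorphic_on_def by (blast intro: meromorphic_on_subset)
  define \<kappa> where "\<kappa> z = (if is_pole g z then 0 else inverse (g z - a))" for z
  have bd: "cmod (\<kappa> z) \<le> 1 / \<rho>" if "R < cmod z" for z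
  proof (cases "is_pole g z")
    case False
    then have "inverse (cmod (g z - a)) \<le> inverse \<rho>"
      by (intro le_imp_inverse_le omit that \<open>\<rho> > 0\<close>)
    then show ?thesis using False by (simp add: \<kappa>_def norm_inverse divide_inverse)
  qed (use \<open>\<rho> > 0\<close> in \<open>simp add: \<kappa>_def\<close>)
  have nonzero: "\<kappa> z \<noteq> 0" if "R < cmod z" "\<not> is_pole g z" for z
    using omit[OF that] that \<open>\<rho> > 0\<close> by (auto simp: \<kappa>_def)
  have openR: "open {z. R < cmod z}" by (intro open_Collect_less continuous_intros)
  have an\<kappa>: "\<kappa> analytic_on {z}" if z: "R < cmod z" for z
  proof -
    have "isolated_singularity_at g z" by (intro meromorphic_on_isolated_singularity mero)
    then have ev: "\<forall>\<^sub>F w in at z. \<not> is_pole g w" by (rule eventually_not_pole)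
    obtain d where d: "d > 0" "\<And>w. w \<in> ball z d \<Longrightarrow> R < cmod w" "\<And>w. w \<in> ball z d - {z} \<Longrightarrow> \<not> is_pole g w"
    proof -
      obtain d1 where "d1 > 0" "\<And>w. w \<in> ball z d1 \<Longrightarrow> R < cmod w"
        using openR z by (metis (mono_tags, lifting) mem_Collect_eq openE subsetD)
      moreover obtain d2 where "d2 > 0" "\<And>w. w \<noteq> z \<Longrightarrow> dist w z < d2 \<Longrightarrow> \<not> is_pole g w"
        using ev by (auto simp: eventually_at)
      ultimately show ?thesis using that[of "min d1 d2"] by (auto simp: dist_commute)
    qed
    have hol: "(\<lambda>w. g w - a) holomorphic_on ball z d - {z}"
    proof (intro holomorphic_intros analytic_imp_holomorphic)
      have "g analytic_on {w}" if "w \<in> ball z d - {z}" for w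
        using d(3)[OF that] by (intro nicely_meromorphic_on_imp_analytic_at[OF g]) auto
      then show "g analytic_on ball z d - {z}" using analytic_on_analytic_at by blast
    qed
    have nz: "g w - a \<noteq> 0" if "w \<in> ball z d" "\<not> is_pole g w" for w
      using omit[of w] d(2) that \<open>\<rho> > 0\<close> by auto
    have "\<kappa> holomorphic_on ball z d"
    proof (cases "is_pole g z")
      case True
      have "is_pole (\<lambda>w. g w - a) z"
        using tendsto_add_filterlim_at_infinity[OF tendsto_const[of "- a"], of g "at z"] True
        unfolding is_pole_def by simp
      then have "(\<lambda>x. if x = z then 0 else inverse (g x - a)) holomorphic_on ball z d"
        using d nz by (intro is_pole_inverse_holomorphic hol) auto
      then show ?thesis
        by (rule holomorphic_transform) (use True d in \<open>auto simp: \<kappa>_def\<close>)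
    next
      case False
      have "g analytic_on {w}" if "w \<in> ball z d" for w
        using d(3) False that by (intro nicely_meromorphic_on_imp_analytic_at[OF g]) auto
      then have "g holomorphic_on ball z d" using analytic_on_analytic_at analytic_imp_holomorphic by blast
      then have "(\<lambda>x. inverse (g x - a)) holomorphic_on ball z d"
        using d False nz by (intro holomorphic_intros) blast+
      then show ?thesis
        by (rule holomorphic_transform) (use False d in \<open>auto simp: \<kappa>_def\<close>)
    qed
    then show ?thesis unfolding analytic_at using d(1) by (intro exI[of _ "ball z d"]) auto
  qed
  define D where "D = ball (0 :: complex) (1 / R)"
  have D: "R < cmod (inverse w)" if "w \<in> D - {0}" for w
  proof -
    have "0 < cmod w" "cmod w < 1 / R" using that by (auto simp: D_def)
    then have "R < inverse (cmod w)" using \<open>R > 0\<close> by (simp add: field_simps)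
    then show ?thesis by (simp only: norm_inverse)
  qed
  have "(\<kappa> \<circ> inverse) analytic_on D - {0}"
  proof (rule analytic_on_compose)
    show "inverse analytic_on D - {0}" by (intro analytic_intros) auto
    have "\<kappa> analytic_on {z}" if "z \<in> inverse ` (D - {0})" for z using that D an\<kappa> by blast
    then show "\<kappa> analytic_on inverse ` (D - {0})" using analytic_on_analytic_at by blast
  qed
  then have holK: "(\<lambda>w. \<kappa> (inverse w)) holomorphic_on D - {0}"
    by (simp add: analytic_imp_holomorphic o_def)
  have ev0: "\<forall>\<^sub>F w in at 0. w \<in> D - {0}"
    using \<open>R > 0\<close> by (intro eventually_at_in_open) (auto simp: D_def)
  then have "\<forall>\<^sub>F w in at 0. cmod (\<kappa> (inverse w)) \<le> 1 / \<rho>"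
    by eventually_elim (use bd D in auto)
  moreover have "0 \<in> interior D" using \<open>R > 0\<close> by (simp add: D_def)
  ultimately obtain k where k: "k holomorphic_on D" "\<And>w. w \<in> D - {0} \<Longrightarrow> k w = \<kappa> (inverse w)"
    using holomorphic_on_extend_bounded[OF holK] by blast
  have "\<exists>w\<in>D. k w \<noteq> 0"
  proof -
    have "isolated_singularity_at g (of_real (2 * R))" by (intro meromorphic_on_isolated_singularity mero)
    then have "\<forall>\<^sub>F w in at (of_real (2 * R)). \<not> is_pole g w" by (rule eventually_not_pole)
    moreover have "\<forall>\<^sub>F w in at (of_real (2 * R)). w \<in> {z. R < cmod z}"
      using \<open>R > 0\<close> by (intro eventually_at_in_open' openR) auto
    ultimately have "\<forall>\<^sub>F w in at (complex_of_real (2 * R)). \<not> is_pole g w \<and> R < cmod w"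
      by eventually_elim auto
    then obtain w where w: "\<not> is_pole g w" "R < cmod w"
      using eventually_happens' at_neq_bot by (metis (mono_tags, lifting))
    have "inverse (cmod w) < 1 / R" using less_imp_inverse_less[OF w(2) \<open>R > 0\<close>] by (simp add: inverse_eq_divide)
    moreover have "w \<noteq> 0" using w(2) \<open>R > 0\<close> by auto
    ultimately have "inverse w \<in> D - {0}" by (simp add: D_def norm_inverse)
    then show ?thesis using k(2)[of "inverse w"] nonzero[OF w(2,1)] by (intro bexI[of _ "inverse w"]) auto
  qed
  moreover have "open D" "connected D" "0 \<in> D" using \<open>R > 0\<close> by (auto simp: D_def)
  ultimately obtain r where r: "r > 0" "cball 0 r \<subseteq> D" "zor_poly k 0 holomorphic_on cball 0 r"
    "\<And>w. w \<in> cball 0 r \<Longrightarrow> k w = zor_poly k 0 w * (w - 0) ^ nat (zorder k 0) \<and> zor_poly k 0 w \<noteq> 0"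
    using conjunct2[OF zorder_exist_zero[OF k(1)]] by blast
  define m where "m = nat (zorder k 0)"
  have "continuous_on (cball 0 r) (\<lambda>w. inverse (zor_poly k 0 w))"
    using r by (intro continuous_intros holomorphic_on_imp_continuous_on) auto
  from compact_imp_bounded[OF compact_continuous_image[OF this]]
  obtain C where C: "C > 0" "\<And>w. w \<in> cball 0 r \<Longrightarrow> cmod (inverse (zor_poly k 0 w)) \<le> C"
    by (auto simp: bounded_pos)
  have far: "\<not> is_pole g z \<and> cmod (g z) \<le> (cmod a + C) * cmod z ^ m" if z: "max 1 (1 / r) \<le> cmod z" for z
  proof -
    have "z \<noteq> 0" using z by auto
    have w: "inverse z \<in> cball 0 r" "inverse z \<in> cball 0 r - {0}"
    proof -
      have "1 / r \<le> cmod z" using z by simp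
      then have "inverse (cmod z) \<le> r" using r(1) \<open>z \<noteq> 0\<close> by (simp add: field_simps)
      then show "inverse z \<in> cball 0 r" "inverse z \<in> cball 0 r - {0}"
        using \<open>z \<noteq> 0\<close> by (simp_all add: norm_inverse)
    qed
    have kz: "\<kappa> z = zor_poly k 0 (inverse z) * inverse z ^ m"
      using r(4)[OF w(1)] k(2)[of "inverse z"] w(2) r(2) by (auto simp: m_def)
    then have "\<kappa> z \<noteq> 0" using r(4)[OF w(1)] \<open>z \<noteq> 0\<close> by simp
    then have np: "\<not> is_pole g z" and inv: "g z - a = inverse (\<kappa> z)" by (auto simp: \<kappa>_def split: if_splits)
    have "cmod (g z - a) = cmod (inverse (zor_poly k 0 (inverse z))) * cmod z ^ m"
      unfolding inv kz by (simp only: inverse_mult_distrib power_inverse inverse_inverse_eq norm_mult norm_power)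
    also have "\<dots> \<le> C * cmod z ^ m" using C(2)[OF w(1)] by (intro mult_right_mono) auto
    finally have "cmod (g z - a) \<le> C * cmod z ^ m" .
    moreover have "cmod a * 1 \<le> cmod a * cmod z ^ m" using z by (intro mult_left_mono one_le_power) auto
    moreover have "cmod (g z) \<le> cmod (g z - a) + cmod a" using norm_triangle_ineq[of "g z - a" a] by simp
    ultimately have "cmod (g z) \<le> (cmod a + C) * cmod z ^ m" by (simp add: distrib_right)
    with np show ?thesis by blast
  qed
  have "{z. is_pole g z} sparse_in UNIV"
    using not_islimpt_poles mero meromorphic_on_isolated_singularity by (metis UNIV_I open_UNIV sparse_in_open)
  then have "{z. is_pole g z} sparse_in cball 0 (max 1 (1 / r))" by (rule sparse_in_subset) simp
  from sparse_in_compact_finite[OF this compact_cball]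
  have "finite (cball 0 (max 1 (1 / r)) \<inter> {z. is_pole g z})" .
  moreover have "{z. is_pole g z} \<subseteq> cball 0 (max 1 (1 / r)) \<inter> {z. is_pole g z}"
  proof (intro subsetI IntI)
    fix z assume "z \<in> {z. is_pole g z}"
    then have "\<not> max 1 (1 / r) \<le> cmod z" using far by blast
    then show "z \<in> cball 0 (max 1 (1 / r))" by (simp only: mem_cball_0)
  qed
  ultimately have "finite {z. is_pole g z}" by (rule finite_subset[rotated])
  then show ?thesis using far by (intro rational_if_polynomial_growth[OF g]) blast+
qed

section \<open>Meromorphic functions as continuous partial maps of the sphere\<close>

lemma tendsto_Fin_Infinity:
  assumes "filterlim h at_infinity F"
  shows "((\<lambda>z. Fin (h z)) \<longlongrightarrow> Infinity) F"
proof (rule tendstoI)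
  fix e :: real assume "e > 0"
  have "0 < 2 / e + 1" using \<open>e > 0\<close> by (simp add: add_pos_pos)
  then have "\<forall>\<^sub>F z in F. 2 / e + 1 \<le> cmod (h z)"
    using assms filterlim_at_infinity[of 0 h F] by blast
  then show "\<forall>\<^sub>F z in F. dist (Fin (h z)) Infinity < e"
  proof eventually_elim
    case (elim z)
    have "2 / e < cmod (h z)" using elim by linarith
    also have "\<dots> \<le> sqrt (1 + (cmod (h z))\<^sup>2)" by (intro real_le_rsqrt) simp
    finally have q: "2 / e < sqrt (1 + (cmod (h z))\<^sup>2)" (is "_ < ?q") .
    have "?q > 0" using one_plus_cmod_sq_pos[of "h z"] by simp
    with q \<open>e > 0\<close> have "2 / ?q < e" by (simp add: field_simps)
    then show ?case by (simp only: dist_Fin_Infinity)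
  qed
qed

lemma tendsto_at_Infinity:
  fixes L :: "'b::metric_space"
  assumes "(h \<longlongrightarrow> L) at_infinity"
  shows "((\<lambda>x. h (unFin x)) \<longlongrightarrow> L) (at Infinity)"
proof (rule tendstoI)
  fix e :: real assume "e > 0"
  from tendstoD[OF assms this] obtain b where b: "\<And>z. b \<le> cmod z \<Longrightarrow> dist (h z) L < e"
    unfolding eventually_at_infinity by blast
  define c where "c = 2 / sqrt (1 + b\<^sup>2)"
  have pos: "sqrt (1 + b\<^sup>2) > 0" using one_plus_cmod_sq_pos[of "of_real b"] by simp
  show "\<forall>\<^sub>F x in at Infinity. dist (h (unFin x)) L < e"
    unfolding eventually_at
  proof (intro exI[of _ c] conjI ballI impI)
    show "c > 0" using pos by (simp add: c_def)
    fix x assume x: "x \<noteq> Infinity \<and> dist x Infinity < c"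
    then obtain z where z: "x = Fin z" by (cases x) auto
    have "\<not> cmod z < b"
    proof
      assume "cmod z < b"
      then have "sqrt (1 + (cmod z)\<^sup>2) \<le> sqrt (1 + b\<^sup>2)" by (simp add: power_mono)
      moreover have "sqrt (1 + (cmod z)\<^sup>2) > 0" using one_plus_cmod_sq_pos[of z] by simp
      ultimately have "c \<le> dist x Infinity"
        unfolding z dist_Fin_Infinity c_def by (intro divide_left_mono mult_pos_pos) (use pos in auto)
      with x show False by simp
    qed
    then show "dist (h (unFin x)) L < e" by (simp add: z b)
  qed
qed

lemma isCont_meromorphic_fun:
  assumes g: "g nicely_meromorphic_on UNIV" and f: "\<And>z. f z = (if is_pole g z then Infinity else Fin (g z))"
  shows "isCont f z"
proof -
  have iso: "isolated_singularity_at g z"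
    using g unfolding nicely_meromorphic_on_def
    by (metis UNIV_I meromorphic_on_isolated_singularity meromorphic_on_meromorphic_at)
  have ev: "\<forall>\<^sub>F w in at z. Fin (g w) = f w"
    using eventually_not_pole[OF iso] by eventually_elim (simp add: f)
  show ?thesis
  proof (cases "is_pole g z")
    case True
    then have "((\<lambda>w. Fin (g w)) \<longlongrightarrow> Infinity) (at z)" unfolding is_pole_def by (rule tendsto_Fin_Infinity)
    then have "(f \<longlongrightarrow> Infinity) (at z)" by (rule Lim_transform_eventually[OF _ ev])
    then show ?thesis using True by (simp add: isCont_def f)
  next
    case False
    have "isCont g z"
      by (intro analytic_at_imp_isCont nicely_meromorphic_on_imp_analytic_at[OF g] False) auto
    then have "((\<lambda>w. Fin (g w)) \<longlongrightarrow> Fin (g z)) (at z)"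
      by (intro isCont_tendsto_compose[OF isCont_Fin]) (simp add: isCont_def)
    then have "(f \<longlongrightarrow> Fin (g z)) (at z)" by (rule Lim_transform_eventually[OF _ ev])
    then show ?thesis using False by (simp add: isCont_def f)
  qed
qed

text \<open>
  In the coordinate \<open>1 / z\<close> a rational function is meromorphic at \<open>0\<close>, hence has a finite or infinite limit there.
\<close>

lemma rational_fun_tendsto_at_infinity:
  assumes "rational_fun f"
  shows "(f \<longlongrightarrow> Lim at_infinity f) at_infinity"
proof -
  obtain p q where "q \<noteq> 0" and pq: "\<And>z. poly q z \<noteq> 0 \<Longrightarrow> f z = Fin (poly p z / poly q z)"
    using assms unfolding rational_fun_def by blast
  define h where "h w = poly p (inverse w) / poly q (inverse w)" for w
  have "h meromorphic_on {0}"
    unfolding h_def poly_altdef by (intro meromorphic_intros)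
  then have "not_essential h 0" by (rule meromorphic_on_not_essential)
  then obtain L where L: "((\<lambda>w. Fin (h w)) \<longlongrightarrow> L) (at 0)"
  proof (cases "is_pole h 0")
    case True
    then show ?thesis using that tendsto_Fin_Infinity unfolding is_pole_def by blast
  next
    case False
    then obtain c where "(h \<longlongrightarrow> c) (at 0)" using \<open>not_essential h 0\<close> unfolding not_essential_def by blast
    then show ?thesis using that isCont_tendsto_compose[OF isCont_Fin] by blast
  qed
  have "finite {z. poly q z = 0}" using \<open>q \<noteq> 0\<close> by (rule poly_roots_finite)
  then have "finite (inverse ` {z. poly q z = 0})" by simp
  then have "\<not> 0 islimpt (inverse ` {z. poly q z = 0})" by (rule islimpt_finite)
  then have "\<forall>\<^sub>F w in at 0. w \<notin> inverse ` {z. poly q z = 0}" by (simp add: islimpt_iff_eventually)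
  then have ev: "\<forall>\<^sub>F w in at 0. Fin (h w) = (f \<circ> inverse) w"
  proof eventually_elim
    case (elim w)
    then have "poly q (inverse w) \<noteq> 0" by (force simp: image_iff)
    then show ?case by (simp add: pq h_def)
  qed
  have "((f \<circ> inverse) \<longlongrightarrow> L) (at 0)" by (rule Lim_transform_eventually[OF L ev])
  then have lim: "(f \<longlongrightarrow> L) at_infinity"
    by (simp add: tendsto_compose_filtermap at_to_infinity filtermap_filtermap)
  then have "Lim at_infinity f = L" by (intro tendsto_Lim trivial_limit_at_infinity)
  with lim show ?thesis by simp
qed

lemma dom_sphere_map: "dom (sphere_map f) = (if rational_fun f then UNIV else - {Infinity})"
proof -
  have "x \<in> dom (sphere_map f) \<longleftrightarrow> rational_fun f \<or> x \<noteq> Infinity" for x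
    by (cases x) (auto simp: dom_def)
  then show ?thesis by auto
qed

lemma open_dom_sphere_map: "open (dom (sphere_map f))"
  by (simp add: dom_sphere_map open_Compl)

lemma continuous_on_sphere_map:
  assumes "meromorphic_fun f"
  shows "continuous_on (dom (sphere_map f)) (\<lambda>x. the (sphere_map f x))"
proof -
  obtain g where g: "g nicely_meromorphic_on UNIV" "\<And>z. f z = (if is_pole g z then Infinity else Fin (g z))"
    using assms unfolding meromorphic_fun_def by blast
  have eq: "\<forall>\<^sub>F y in at x. f (unFin y) = the (sphere_map f y)" for x
  proof -
    have "\<forall>\<^sub>F y in at x. y \<noteq> Infinity"
      by (cases "x = Infinity") (auto intro: eventually_neq_at_within eventually_neq_at_within)
    then show ?thesis
    proof eventually_elim
      case (elim y)
      then show ?case by (cases y) auto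
    qed
  qed
  have "isCont (\<lambda>x. the (sphere_map f x)) x" if "x \<in> dom (sphere_map f)" for x
  proof (cases x)
    case (Fin z)
    have "isCont unFin x"
      using continuous_on_unFin Fin by (simp add: continuous_on_eq_continuous_at open_Compl)
    then have "((\<lambda>y. f (unFin y)) \<longlongrightarrow> f (unFin x)) (at x)"
      by (intro isCont_tendsto_compose[OF isCont_meromorphic_fun[OF g]]) (simp add: isCont_def)
    then have "((\<lambda>y. the (sphere_map f y)) \<longlongrightarrow> f (unFin x)) (at x)"
      by (rule Lim_transform_eventually[OF _ eq])
    then show ?thesis by (simp add: isCont_def Fin)
  next
    case Infinity
    then have "rational_fun f" using that dom_sphere_map[of f] by (metis ComplD singletonI)
    from tendsto_at_Infinity[OF rational_fun_tendsto_at_infinity[OF this]]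
    have "((\<lambda>y. the (sphere_map f y)) \<longlongrightarrow> Lim at_infinity f) (at Infinity)"
      by (rule Lim_transform_eventually[OF _ eq])
    then show ?thesis using \<open>rational_fun f\<close> by (simp add: isCont_def Infinity)
  qed
  then show ?thesis by (simp add: continuous_at_imp_continuous_on)
qed

lemma iterate_Suc_right: "iterate f (Suc n) = iterate f n \<circ>\<^sub>m sphere_map f"
proof (induction n)
  case 0
  show ?case by (auto simp: map_comp_def fun_eq_iff split: option.splits)
next
  case (Suc n)
  have "iterate f (Suc (Suc n)) = sphere_map f \<circ>\<^sub>m (iterate f n \<circ>\<^sub>m sphere_map f)"
    using Suc by (metis iterate.simps(2))
  also have "\<dots> = (sphere_map f \<circ>\<^sub>m iterate f n) \<circ>\<^sub>m sphere_map f"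
    by (auto simp: map_comp_def fun_eq_iff split: option.splits)
  finally show ?case by simp
qed

section \<open>Invariance of the Fatou set\<close>

lemma uniform_limit_compose_image:
  assumes "uniform_limit (\<phi> ` K) s l F"
  shows "uniform_limit K (\<lambda>n x. s n (\<phi> x)) (\<lambda>x. l (\<phi> x)) F"
  using assms unfolding uniform_limit_iff by simp

text \<open>
  Composing with the map itself turns normality near \<open>y\<close> into normality near \<open>x\<close>.  A sequence of iterates
  cannot be pulled back if it contains the identity; if that happens infinitely often, there is a
  constant subsequence, and otherwise finitely many terms are dropped.
\<close>

lemma Fatou_set_backward:
  assumes f: "meromorphic_fun f" and x: "sphere_map f x = Some y" and y: "y \<in> Fatou_set f"
  shows "x \<in> Fatou_set f"
proof -
  define G where "G x = the (sphere_map f x)" for x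
  obtain U where U: "open U" "y \<in> U" "iterates_normal_on f U"
    using y by (auto simp: Fatou_set_def)
  define V where "V = dom (sphere_map f) \<inter> G -` U"
  have contG: "continuous_on (dom (sphere_map f)) G"
    unfolding G_def by (rule continuous_on_sphere_map[OF f])
  have "open V"
    unfolding V_def by (rule continuous_open_preimage[OF contG open_dom_sphere_map U(1)])
  have GV: "sphere_map f v = Some (G v)" "G v \<in> U" if "v \<in> V" for v
    using that by (auto simp: V_def G_def)
  have it: "iterate f (Suc n) v = iterate f n (G v)" if "v \<in> V" for n v
    unfolding iterate_Suc_right using GV(1)[OF that] by simp
  have Udom: "U \<subseteq> dom (iterate f n)" for n using U(3) by (simp add: iterates_normal_on_def)
  have "iterates_normal_on f V"
    unfolding iterates_normal_on_def
  proof
    show "\<forall>n. V \<subseteq> dom (iterate f n)"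
    proof
      fix n show "V \<subseteq> dom (iterate f n)"
      proof (cases n)
        case (Suc m)
        then show ?thesis using it GV(2) Udom by (metis domIff subsetD subsetI)
      qed auto
    qed
    show "normal_family_on V (range (\<lambda>n x. the (iterate f n x)))"
      unfolding normal_family_on_def
    proof (intro allI impI)
      fix s :: "nat \<Rightarrow> riemann_sphere \<Rightarrow> riemann_sphere"
      assume "range s \<subseteq> range (\<lambda>n x. the (iterate f n x))"
      then have "\<forall>i. \<exists>k. s i = (\<lambda>x. the (iterate f k x))" by blast
      then obtain k where k: "\<And>i. s i = (\<lambda>x. the (iterate f (k i) x))" by metis
      show "\<exists>r l. strict_mono r \<and> (\<forall>K. compact K \<and> K \<subseteq> V \<longrightarrow> uniform_limit K (s \<circ> r) l sequentially)"
      proof (cases "infinite {i. k i = 0}")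
        case True
        define r where "r = enumerate {i. k i = 0}"
        have "k (r n) = 0" for n using enumerate_in_set[OF True, of n] by (simp add: r_def)
        then have "uniform_limit K (s \<circ> r) (\<lambda>x. x) sequentially" for K
          by (simp add: uniform_limit_iff k)
        moreover have "strict_mono r" unfolding r_def using True by (rule strict_mono_enumerate)
        ultimately show ?thesis by blast
      next
        case False
        then have "finite {i. k i = 0}" by simp
        then obtain i0 where "\<forall>i\<in>{i. k i = 0}. i < i0"
          unfolding finite_nat_set_iff_bounded by blast
        then have i0: "\<And>i. k i = 0 \<Longrightarrow> i < i0" by blast
        define s' where "s' i = (\<lambda>x. the (iterate f (k (i + i0) - 1) x))" for i
        have "range s' \<subseteq> range (\<lambda>n x. the (iterate f n x))" by (auto simp: s'_def)
        then obtain r l where r: "strict_mono (r :: nat \<Rightarrow> nat)" and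
          l: "\<And>K. compact K \<Longrightarrow> K \<subseteq> U \<Longrightarrow> uniform_limit K (s' \<circ> r) l sequentially"
          using U(3) unfolding iterates_normal_on_def normal_family_on_def by metis
        have ss': "s (i + i0) v = s' i (G v)" if "v \<in> V" for i v
        proof -
          have "k (i + i0) \<noteq> 0" using i0[of "i + i0"] by auto
          then show ?thesis using it[OF that, of "k (i + i0) - 1"] by (simp add: k s'_def)
        qed
        show ?thesis
        proof (intro exI conjI allI impI)
          show "strict_mono (\<lambda>n. r n + i0)" using r by (simp add: strict_mono_def)
          fix K assume K: "compact K \<and> K \<subseteq> V"
          have "compact (G ` K)"
            using K by (intro compact_continuous_image continuous_on_subset[OF contG]) (auto simp: V_def)
          then have "uniform_limit (G ` K) (s' \<circ> r) l sequentially"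
            using K GV(2) by (intro l) auto
          from uniform_limit_compose_image[OF this]
          show "uniform_limit K (s \<circ> (\<lambda>n. r n + i0)) (\<lambda>x. l (G x)) sequentially"
            unfolding uniform_limit_iff o_def using K ss' by (simp add: subset_iff)
        qed
      qed
    qed
  qed
  moreover have "x \<in> V" using x U(2) by (auto simp: V_def G_def)
  ultimately show ?thesis using \<open>open V\<close> Fatou_setI by blast
qed

lemma Fatou_set_backward_iterate:
  assumes f: "meromorphic_fun f" and "iterate f n x = Some y" "y \<in> Fatou_set f"
  shows "x \<in> Fatou_set f"
  using assms(2,3)
proof (induction n arbitrary: y)
  case (Suc n)
  then obtain u where u: "iterate f n x = Some u" "sphere_map f u = Some y"
    by (auto simp: map_comp_Some_iff)
  then show ?case using Suc Fatou_set_backward[OF f u(2)] by blast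
qed auto

section \<open>A Julia set with interior is the whole plane\<close>

text \<open>
  The Moebius coordinate in which \<open>a\<close> is at infinity.
\<close>

definition inv_chart :: "complex \<Rightarrow> riemann_sphere \<Rightarrow> complex" where
  "inv_chart a x = (case x of Fin w \<Rightarrow> inverse (w - a) | Infinity \<Rightarrow> 0)"

definition inv_param :: "complex \<Rightarrow> complex \<Rightarrow> riemann_sphere" where
  "inv_param a w = (if w = 0 then Infinity else Fin (a + inverse w))"

lemma inv_param_inv_chart: "x \<noteq> Fin a \<Longrightarrow> inv_param a (inv_chart a x) = x"
  by (cases x) (auto simp: inv_param_def inv_chart_def)

lemma continuous_on_inv_param: "continuous_on UNIV (inv_param a)"
proof -
  have "isCont (inv_param a) w" for w
  proof (cases "w = 0")
    case True
    have "filterlim (\<lambda>w. a + inverse w) at_infinity (at (0 :: complex))"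
      by (intro tendsto_add_filterlim_at_infinity[OF tendsto_const] filterlim_inverse_at_infinity)
    then have "((\<lambda>w. Fin (a + inverse w)) \<longlongrightarrow> Infinity) (at 0)" by (rule tendsto_Fin_Infinity)
    moreover have "\<forall>\<^sub>F w in at 0. Fin (a + inverse w) = inv_param a w"
      by (auto simp: inv_param_def eventually_at_filter)
    ultimately have "(inv_param a \<longlongrightarrow> Infinity) (at 0)" by (rule Lim_transform_eventually)
    then show ?thesis using True by (simp add: isCont_def inv_param_def)
  next
    case False
    have cont: "isCont (\<lambda>w. Fin (a + inverse w)) w"
      using False by (intro isCont_o2[OF _ isCont_Fin] continuous_intros) auto
    have ev: "\<forall>\<^sub>F v in nhds w. Fin (a + inverse v) = inv_param a v"
      using t1_space_nhds[OF False] by eventually_elim (simp add: inv_param_def)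
    show ?thesis using isCont_cong[OF ev] cont by (rule iffD1)
  qed
  then show ?thesis by (simp add: continuous_at_imp_continuous_on)
qed

lemma continuous_on_inv_chart: "continuous_on (- {Fin a}) (inv_chart a)"
proof -
  have ev: "\<forall>\<^sub>F y in at x. inverse (unFin y - a) = inv_chart a y" for x
  proof -
    have "\<forall>\<^sub>F y in at x. y \<noteq> Infinity"
      by (cases "x = Infinity") (auto intro: eventually_neq_at_within)
    then show ?thesis
    proof eventually_elim
      case (elim y)
      then show ?case by (cases y) (auto simp: inv_chart_def)
    qed
  qed
  have "isCont (inv_chart a) x" if "x \<noteq> Fin a" for x
  proof (cases x)
    case (Fin z)
    have "isCont unFin x"
      using continuous_on_unFin Fin by (simp add: continuous_on_eq_continuous_at open_Compl)
    then have "((\<lambda>y. inverse (unFin y - a)) \<longlongrightarrow> inverse (unFin x - a)) (at x)"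
      using that Fin by (intro tendsto_intros) (auto simp: isCont_def)
    then have "(inv_chart a \<longlongrightarrow> inverse (unFin x - a)) (at x)"
      by (rule Lim_transform_eventually[OF _ ev])
    then show ?thesis by (simp add: isCont_def Fin inv_chart_def)
  next
    case Infinity
    have "((\<lambda>z. inverse (z - a)) \<longlongrightarrow> 0) at_infinity"
    proof -
      have "filterlim (\<lambda>z. - a + z) at_infinity at_infinity"
        by (intro tendsto_add_filterlim_at_infinity[OF tendsto_const] filterlim_ident)
      from filterlim_compose[OF tendsto_inverse_0 this] show ?thesis by simp
    qed
    from tendsto_at_Infinity[OF this]
    have "(inv_chart a \<longlongrightarrow> 0) (at Infinity)" by (rule Lim_transform_eventually[OF _ ev])
    then show ?thesis by (simp add: isCont_def Infinity inv_chart_def)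
  qed
  then show ?thesis by (simp add: continuous_at_imp_continuous_on)
qed

lemma dom_iterate_Suc: "dom (iterate f (Suc n)) \<subseteq> dom (iterate f n)"
  by (auto simp: map_comp_def split: option.splits)

lemma continuous_on_iterate:
  assumes f: "meromorphic_fun f" and "A \<subseteq> dom (iterate f n)"
  shows "continuous_on A (\<lambda>x. the (iterate f n x))"
  using assms(2)
proof (induction n)
  case (Suc n)
  then have A: "A \<subseteq> dom (iterate f n)" using dom_iterate_Suc by blast
  have sub: "(\<lambda>x. the (iterate f n x)) ` A \<subseteq> dom (sphere_map f)"
  proof
    fix y assume "y \<in> (\<lambda>x. the (iterate f n x)) ` A"
    then obtain x where x: "x \<in> A" "y = the (iterate f n x)" by blast
    then obtain z where "iterate f (Suc n) x = Some z" using Suc.prems by blast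
    then show "y \<in> dom (sphere_map f)" using x by (auto simp: map_comp_Some_iff)
  qed
  have "continuous_on A (\<lambda>x. the (sphere_map f (the (iterate f n x))))"
    by (rule continuous_on_compose2[OF continuous_on_sphere_map[OF f] Suc.IH[OF A] sub])
  moreover have "the (iterate f (Suc n) x) = the (sphere_map f (the (iterate f n x)))" if "x \<in> A" for x
    using A that by (auto simp: map_comp_def split: option.splits)
  ultimately show ?case by (simp cong: continuous_on_cong)
qed auto

text \<open>
  In the coordinate \<open>inv_chart a\<close> the iterates are uniformly bounded.  They are continuous, and holomorphic
  except at finitely many points whose orbit has met infinity; these are removable singularities.
\<close>

lemma iterates_normal_on_if_omit_ball:
  assumes f: "meromorphic_fun f" and "open U" "\<rho> > 0"
    and dom: "\<And>k. Fin ` U \<subseteq> dom (iterate f k)"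
    and fin: "\<And>k. finite {z\<in>U. iterate f k (Fin z) = Some Infinity}"
    and omit: "\<And>k z w. z \<in> U \<Longrightarrow> iterate f k (Fin z) = Some (Fin w) \<Longrightarrow> \<rho> \<le> cmod (w - a)"
  shows "iterates_normal_on f (Fin ` U)"
proof -
  obtain g where g: "g nicely_meromorphic_on UNIV" "\<And>z. f z = (if is_pole g z then Infinity else Fin (g z))"
    using f unfolding meromorphic_fun_def by blast
  define F where "F k z = the (iterate f k (Fin z))" for k z
  have itF: "iterate f k (Fin z) = Some (F k z)" if "z \<in> U" for k z
    using dom[of k] that by (auto simp: F_def)
  have Fa: "F k z \<noteq> Fin a" if "z \<in> U" for k z
    using omit[OF that, of k a] itF[OF that, of k] \<open>\<rho> > 0\<close> by auto
  define h where "h k z = inv_chart a (F k z)" for k z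
  have bd: "cmod (h k z) \<le> 1 / \<rho>" if "z \<in> U" for k z
  proof (cases "F k z")
    case (Fin w)
    then have "\<rho> \<le> cmod (w - a)" using omit[OF that] itF[OF that] by simp
    then have "inverse (cmod (w - a)) \<le> inverse \<rho>" using \<open>\<rho> > 0\<close> by (intro le_imp_inverse_le)
    then show ?thesis by (simp add: h_def inv_chart_def Fin norm_inverse divide_inverse)
  qed (use \<open>\<rho> > 0\<close> in \<open>simp add: h_def inv_chart_def\<close>)
  have hol: "h k holomorphic_on U" for k
  proof -
    define E where "E = (\<Union>j\<le>k. {z\<in>U. iterate f j (Fin z) = Some Infinity})"
    have "finite E" unfolding E_def using fin by blast
    have "continuous_on U (h k)"
    proof -
      have "continuous_on U (\<lambda>z. the (iterate f k (Fin z)))"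
        by (rule continuous_on_compose2[OF continuous_on_iterate[OF f dom[of k]] continuous_on_Fin]) auto
      then show ?thesis
        unfolding h_def[abs_def] F_def[symmetric]
        by (rule continuous_on_compose2[OF continuous_on_inv_chart]) (use not_sym[OF Fa] in auto)
    qed
    moreover have "h k holomorphic_on U - E"
    proof -
      have openUE: "open (U - E)" using \<open>open U\<close> \<open>finite E\<close> by (intro open_Diff finite_imp_closed)
      have orb: "F j z = Fin ((g ^^ j) z)" if z: "z \<in> U - E" and "j \<le> k" for j z
        using that(2)
      proof (induction j)
        case 0
        then show ?case by (simp add: F_def)
      next
        case (Suc j)
        have "iterate f (Suc j) (Fin z) = Some (f ((g ^^ j) z))"
          using Suc itF[of z j] z by auto
        moreover have "iterate f (Suc j) (Fin z) \<noteq> Some Infinity"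
          using z Suc.prems unfolding E_def by (auto simp del: iterate.simps)
        ultimately show ?case by (auto simp: F_def g(2) split: if_splits)
      qed
      have an: "g analytic_on {(g ^^ j) z}" if z: "z \<in> U - E" and "j < k" for j z
      proof (rule nicely_meromorphic_on_imp_analytic_at[OF g(1)])
        have "iterate f (Suc j) (Fin z) = Some (f ((g ^^ j) z))"
          using orb[OF z, of j] itF[of z j] z that(2) by auto
        moreover have "iterate f (Suc j) (Fin z) \<noteq> Some Infinity"
          using z that(2) unfolding E_def by (auto simp del: iterate.simps)
        ultimately show "\<not> is_pole g ((g ^^ j) z)" by (auto simp: g(2))
      qed auto
      have "(\<lambda>z. inverse ((g ^^ k) z - a)) holomorphic_on U - E"
        using holomorphic_funpow[OF openUE an] orb[of _ k] Fa[of _ k]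
        by (intro holomorphic_intros) auto
      then show ?thesis
        by (rule holomorphic_transform) (use orb[of _ k] in \<open>auto simp: h_def inv_chart_def\<close>)
    qed
    ultimately show ?thesis using \<open>open U\<close> \<open>finite E\<close> by (rule no_isolated_singularity)
  qed
  show ?thesis
  proof (rule iterates_normal_on_chart[where h = h, OF \<open>open U\<close> continuous_on_inv_param hol])
    show "iterate f k (Fin z) = Some (inv_param a (h k z))" if "z \<in> U" for k z
      using itF[OF that] Fa[OF that] by (simp add: h_def inv_param_inv_chart)
    show "\<exists>B. \<forall>k. \<forall>z\<in>K. cmod (h k z) \<le> B" if "compact K" "K \<subseteq> U" for K
      using bd that by blast
  qed
qed

text \<open>
  A point has finitely many preimages under a rational function, unless the function is constant; a constant
  function has finite values only.
\<close>

lemma finite_poles_of_iterates_rational: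
  assumes "rational_fun f"
  shows "finite {z. iterate f k (Fin z) = Some Infinity}"
proof -
  have mf: "meromorphic_fun f" using assms by (simp add: rational_fun_def)
  obtain p q where "q \<noteq> 0" and pq: "\<And>z. poly q z \<noteq> 0 \<Longrightarrow> f z = Fin (poly p z / poly q z)"
    using assms unfolding rational_fun_def by blast
  have finq: "finite {z. poly q z = 0}" using \<open>q \<noteq> 0\<close> by (rule poly_roots_finite)
  show ?thesis
  proof (cases "\<exists>w. p = smult w q")
    case True
    then obtain w where w: "\<And>z. poly q z \<noteq> 0 \<Longrightarrow> f z = Fin w" using pq by auto
    obtain g where g: "g nicely_meromorphic_on UNIV" "\<And>z. f z = (if is_pole g z then Infinity else Fin (g z))"
      using mf unfolding meromorphic_fun_def by blast
    have const: "f z = Fin w" for z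
    proof -
      have "\<not> z islimpt {z. poly q z = 0}" using finq by (rule islimpt_finite)
      then have "\<forall>\<^sub>F v in at z. f v = Fin w"
        unfolding islimpt_iff_eventually by (simp add: eventually_mono w)
      then have "(f \<longlongrightarrow> Fin w) (at z)" by (rule tendsto_eventually)
      moreover have "(f \<longlongrightarrow> f z) (at z)" using isCont_meromorphic_fun[OF g] by (simp add: isCont_def)
      ultimately show ?thesis using tendsto_unique at_neq_bot by blast
    qed
    have "\<exists>v. iterate f k (Fin z) = Some (Fin v)" for z
      by (induction k) (auto simp: const)
    then have "iterate f k (Fin z) \<noteq> Some Infinity" for z by (metis option.inject riemann_sphere.distinct(1))
    then have "{z. iterate f k (Fin z) = Some Infinity} = {}" by simp
    then show ?thesis by simp
  next
    case False
    have pre: "finite {z. f z = y}" for y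
    proof (cases y)
      case (Fin w)
      have "p - smult w q \<noteq> 0" using False by auto
      then have "finite ({z. poly q z = 0} \<union> {z. poly (p - smult w q) z = 0})"
        using finq poly_roots_finite by blast
      moreover have "{z. f z = y} \<subseteq> {z. poly q z = 0} \<union> {z. poly (p - smult w q) z = 0}"
      proof
        fix z assume "z \<in> {z. f z = y}"
        then have "poly p z / poly q z = w" if "poly q z \<noteq> 0" using pq[OF that] Fin by simp
        then show "z \<in> {z. poly q z = 0} \<union> {z. poly (p - smult w q) z = 0}" by (auto simp: field_simps)
      qed
      ultimately show ?thesis by (rule finite_subset[rotated])
    next
      case Infinity
      then have "{z. f z = y} \<subseteq> {z. poly q z = 0}" using pq by force
      then show ?thesis using finq by (rule finite_subset)
    qed
    have pre_sphere: "finite {x. sphere_map f x = Some y}" for y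
    proof -
      have "{x. sphere_map f x = Some y} \<subseteq> insert Infinity (Fin ` {z. f z = y})"
      proof
        fix x assume "x \<in> {x. sphere_map f x = Some y}"
        then show "x \<in> insert Infinity (Fin ` {z. f z = y})" by (cases x) auto
      qed
      then show ?thesis using pre by (meson finite_imageI finite_insert finite_subset)
    qed
    have "finite {x. iterate f k x = Some y}" for y
    proof (induction k arbitrary: y)
      case (Suc k)
      have "{x. iterate f (Suc k) x = Some y} \<subseteq> (\<Union>u\<in>{u. sphere_map f u = Some y}. {x. iterate f k x = Some u})"
        by (auto simp: map_comp_Some_iff)
      then show ?case using Suc pre_sphere by (meson finite_UN finite_subset)
    qed auto
    then have "finite (Fin -` {x. iterate f k x = Some Infinity})"
      by (intro finite_vimageI) (auto simp: inj_def)
    then show ?thesis by (simp add: vimage_def)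
  qed
qed

text \<open>
  The open mapping theorem for the reciprocal of \<open>g\<close>.
\<close>

lemma large_values_near_pole:
  assumes g: "g nicely_meromorphic_on UNIV" and "is_pole g p" "open V" "p \<in> V"
  obtains R where "R > 0" "\<And>w. R < cmod w \<Longrightarrow> \<exists>v\<in>V. \<not> is_pole g v \<and> g v = w"
proof -
  have iso: "isolated_singularity_at g p"
    using g unfolding nicely_meromorphic_on_def
    by (metis UNIV_I meromorphic_on_isolated_singularity meromorphic_on_meromorphic_at)
  have "\<forall>\<^sub>F w in at p. \<not> is_pole g w \<and> g w \<noteq> 0 \<and> w \<in> V"
    using eventually_not_pole[OF iso] non_zero_neighbour_pole[OF \<open>is_pole g p\<close>]
      eventually_at_in_open'[OF \<open>open V\<close> \<open>p \<in> V\<close>]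
    by eventually_elim auto
  then obtain d where d: "d > 0" "\<And>w. w \<noteq> p \<Longrightarrow> dist w p < d \<Longrightarrow> \<not> is_pole g w \<and> g w \<noteq> 0 \<and> w \<in> V"
    by (auto simp: eventually_at)
  define h where "h w = (if w = p then 0 else inverse (g w))" for w
  have "g analytic_on {w}" if "w \<in> ball p d - {p}" for w
    using d(2)[of w] that by (intro nicely_meromorphic_on_imp_analytic_at[OF g]) (auto simp: dist_commute)
  then have "g analytic_on ball p d - {p}" using analytic_on_analytic_at by blast
  then have "g holomorphic_on ball p d - {p}" by (rule analytic_imp_holomorphic)
  then have holh: "h holomorphic_on ball p d"
    unfolding h_def using d by (intro is_pole_inverse_holomorphic \<open>is_pole g p\<close>) (auto simp: dist_commute)
  have "\<not> h constant_on ball p d"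
  proof
    assume "h constant_on ball p d"
    then obtain c where c: "\<And>w. w \<in> ball p d \<Longrightarrow> h w = c" unfolding constant_on_def by blast
    have q: "p + of_real (d / 2) \<in> ball p d" "p + of_real (d / 2) \<noteq> p" using d(1) by (auto simp: dist_norm)
    have "h p = h (p + of_real (d / 2))" using c q(1) d(1) by simp
    then show False using d(2)[OF q(2)] q by (simp add: h_def dist_commute)
  qed
  then have "open (h ` ball p d)"
    by (intro open_mapping_thm[OF holh]) auto
  moreover have "0 \<in> h ` ball p d" using d(1) by (force simp: h_def image_iff)
  ultimately obtain e where e: "e > 0" "ball 0 e \<subseteq> h ` ball p d" using openE by blast
  show ?thesis
  proof (rule that[of "1 / e"])
    show "1 / e > 0" using e by simp
    fix w assume w: "1 / e < cmod w"
    then have "w \<noteq> 0" using e(1) by (auto simp: field_simps)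
    have "inverse (cmod w) < e"
      using less_imp_inverse_less[OF w] e(1) by (simp add: inverse_eq_divide)
    then have "inverse w \<in> h ` ball p d" using e(2) by (auto simp: norm_inverse subset_iff)
    then obtain v where v: "v \<in> ball p d" "inverse w = h v" by blast
    have "v \<noteq> p" using v(2) \<open>w \<noteq> 0\<close> by (auto simp: h_def)
    moreover have "g v = w" using v(2) \<open>v \<noteq> p\<close> by (simp add: h_def)
    ultimately show "\<exists>v\<in>V. \<not> is_pole g v \<and> g v = w"
      using d(2)[of v] v(1) by (auto simp: dist_commute)
  qed
qed

text \<open>
  Let \<open>U\<close> be a disc in the Julia set.  By backward invariance its orbit stays in the Julia set, so if the Fatou
  set contains a disc in the plane, the orbit of \<open>U\<close> omits it.  If all iterates are defined on \<open>U\<close>, they are normal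
  there by Montel's theorem.  Otherwise \<open>f\<close> is not rational, and some iterate on \<open>U\<close> has a pole; its image then
  contains a neighbourhood of infinity, on which \<open>f\<close> omits the disc.  But this makes \<open>f\<close> rational.
\<close>

lemma interior_Julia_set:
  assumes f: "meromorphic_fun f" and int: "interior (Julia_set f) \<noteq> {}"
  shows "Julia_set f = UNIV"
proof (rule ccontr)
  assume "Julia_set f \<noteq> UNIV"
  then obtain a where a: "Fin a \<in> Fatou_set f" by (auto simp: Julia_set_def)
  obtain g where g: "g nicely_meromorphic_on UNIV" "\<And>z. f z = (if is_pole g z then Infinity else Fin (g z))"
    using f unfolding meromorphic_fun_def by blast
  have "open (Fatou_set f)" by (auto simp: Fatou_set_def)
  then have "open (Fin -` Fatou_set f)" using continuous_open_vimage isCont_Fin by blast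
  then obtain \<rho> where \<rho>: "\<rho> > 0" "ball a \<rho> \<subseteq> Fin -` Fatou_set f" using a openE by (metis vimageI)
  have far: "\<rho> \<le> cmod (w - a)" if "Fin w \<notin> Fatou_set f" for w
  proof (rule ccontr)
    assume "\<not> \<rho> \<le> cmod (w - a)"
    then have "w \<in> ball a \<rho>" by (simp add: dist_norm norm_minus_commute)
    with \<rho>(2) that show False by blast
  qed
  obtain c where c: "c \<in> interior (Julia_set f)" using int by blast
  obtain \<delta> where \<delta>: "\<delta> > 0" "ball c \<delta> \<subseteq> Julia_set f" using c by (meson mem_interior)
  define U where "U = ball c \<delta>"
  have U: "open U" "connected U" "c \<in> U" using \<delta>(1) by (auto simp: U_def)
  have UJ: "Fin z \<notin> Fatou_set f" if "z \<in> U" for z using \<delta>(2) that by (auto simp: U_def Julia_set_def)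
  have orbit: "y \<notin> Fatou_set f" if "z \<in> U" "iterate f k (Fin z) = Some y" for z k y
    using Fatou_set_backward_iterate[OF f that(2)] UJ[OF that(1)] by blast
  have contra: False
    if "\<And>k. Fin ` U \<subseteq> dom (iterate f k)" "\<And>k. finite {z\<in>U. iterate f k (Fin z) = Some Infinity}"
  proof -
    have "iterates_normal_on f (Fin ` U)"
      by (rule iterates_normal_on_if_omit_ball[OF f U(1) \<rho>(1) that]) (use far orbit in blast)
    then have "Fin c \<in> Fatou_set f" using Fatou_setI[OF open_Fin_image[OF U(1)]] U(3) by blast
    with UJ U(3) show False by blast
  qed
  show False
  proof (cases "rational_fun f")
    case True
    have "iterate f k x \<noteq> None" for k x
    proof (induction k)
      case (Suc k)
      then obtain y where y: "iterate f k x = Some y" by blast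
      have "sphere_map f y \<noteq> None" using True by (cases y) auto
      then show ?case using y by simp
    qed auto
    moreover have "finite {z\<in>U. iterate f k (Fin z) = Some Infinity}" for k
      by (rule finite_subset[OF _ finite_poles_of_iterates_rational[OF True, of k]]) auto
    ultimately show False by (intro contra) auto
  next
    case False
    have not_rat: "\<nexists>p q. q \<noteq> 0 \<and> (\<forall>z. poly q z \<noteq> 0 \<longrightarrow> \<not> is_pole g z \<and> g z = poly p z / poly q z)"
      using False f g(2) unfolding rational_fun_def by metis
    define finite_upto where "finite_upto k \<longleftrightarrow> (\<forall>z\<in>U. \<exists>w. iterate f k (Fin z) = Some (Fin w))" for k
    show False
    proof (cases "\<forall>k. finite_upto k")
      case True
      have empty: "{z \<in> U. iterate f k (Fin z) = Some Infinity} = {}" for k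
      proof -
        have "iterate f k (Fin z) \<noteq> Some Infinity" if "z \<in> U" for z
          using True that unfolding finite_upto_def by (metis option.inject riemann_sphere.distinct(1))
        then show ?thesis by blast
      qed
      show False
      proof (rule contra)
        show "Fin ` U \<subseteq> dom (iterate f k)" for k using True by (force simp: finite_upto_def)
        show "finite {z \<in> U. iterate f k (Fin z) = Some Infinity}" for k by (simp only: empty finite.emptyI)
      qed
    next
      case False
      then obtain k' where "\<not> finite_upto k'" "\<And>j. j < k' \<Longrightarrow> finite_upto j"
        using exists_least_iff[of "\<lambda>k. \<not> finite_upto k"] by blast
      moreover have "k' \<noteq> 0" using \<open>\<not> finite_upto k'\<close> by (auto simp: finite_upto_def intro!: gr0I)
      ultimately obtain k where k: "\<not> finite_upto (Suc k)" "\<And>j. j \<le> k \<Longrightarrow> finite_upto j"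
        by (metis less_Suc_eq_le not0_implies_Suc)
      have orb: "iterate f j (Fin z) = Some (Fin ((g ^^ j) z))" if z: "z \<in> U" and jk: "j \<le> k" for z j
        using jk
      proof (induction j)
        case (Suc j)
        then have "iterate f (Suc j) (Fin z) = Some (f ((g ^^ j) z))" by simp
        moreover obtain w where w: "iterate f (Suc j) (Fin z) = Some (Fin w)"
          using k(2)[OF Suc.prems] z unfolding finite_upto_def by blast
        ultimately have "Fin w = f ((g ^^ j) z)" by (metis option.inject)
        then have "w = g ((g ^^ j) z)" using g(2)[of "(g ^^ j) z"] by (simp split: if_splits)
        then show ?case using w by simp
      qed auto
      have nopole: "\<not> is_pole g ((g ^^ j) z)" if "z \<in> U" "j < k" for z j
        using orb[OF that(1), of j] orb[OF that(1), of "Suc j"] that(2) by (auto simp: g(2) split: if_splits)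
      \<comment> \<open>the images of \<open>U\<close> stay open, since \<open>g\<close> is constant on no open set\<close>
      have img: "open ((g ^^ j) ` U) \<and> connected ((g ^^ j) ` U)" if "j \<le> k" for j
        using that
      proof (induction j)
        case 0
        then show ?case using U by simp
      next
        case (Suc j)
        define S where "S = (g ^^ j) ` U"
        have S: "open S" "connected S" "(g ^^ j) c \<in> S" using Suc U(3) by (auto simp: S_def)
        have "g analytic_on {s}" if "s \<in> S" for s
          using nopole[of _ j] Suc.prems that
          by (intro nicely_meromorphic_on_imp_analytic_at[OF g(1)]) (auto simp: S_def)
        then have hol: "g holomorphic_on S" using analytic_on_analytic_at analytic_imp_holomorphic by blast
        have "\<not> g constant_on S"
        proof
          assume "g constant_on S"
          then obtain b where b: "\<And>s. s \<in> S \<Longrightarrow> g s = b" unfolding constant_on_def by blast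
          have "\<forall>\<^sub>F s in at ((g ^^ j) c). g s = b"
            using eventually_at_in_open'[OF S(1,3)] by eventually_elim (rule b)
          then have "\<exists>\<^sub>F s in at ((g ^^ j) c). g s = b" by (rule eventually_frequently[OF at_neq_bot])
          from frequently_eq_meromorphic_imp_constant[OF this g(1)]
          have gb: "g w = b" for w by auto
          then have "g = (\<lambda>_. b)" by auto
          then have "\<not> is_pole g w" for w by (simp add: analytic_at_imp_no_pole)
          then have "(1 :: complex poly) \<noteq> 0 \<and>
              (\<forall>z. poly 1 z \<noteq> 0 \<longrightarrow> \<not> is_pole g z \<and> g z = poly [:b:] z / poly 1 z)"
            using gb by simp
          then show False using not_rat by blast
        qed
        then have "open (g ` S)" using S by (intro open_mapping_thm[OF hol S(1,2)]) auto
        moreover have "connected (g ` S)"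
          by (intro connected_continuous_image holomorphic_on_imp_continuous_on hol S)
        ultimately show ?case by (simp add: S_def image_image)
      qed
      obtain z where z: "z \<in> U" "\<nexists>w. iterate f (Suc k) (Fin z) = Some (Fin w)"
        using k(1) by (auto simp: finite_upto_def)
      then have "is_pole g ((g ^^ k) z)" using orb[OF z(1), of k] by (auto simp: g(2) split: if_splits)
      then obtain R where R: "R > 0" "\<And>w. R < cmod w \<Longrightarrow> \<exists>v\<in>(g ^^ k) ` U. \<not> is_pole g v \<and> g v = w"
        using large_values_near_pole[OF g(1) _ conjunct1[OF img[of k]]] z(1) by blast
      have "\<rho> \<le> cmod (g w - a)" if w: "R < cmod w" "\<not> is_pole g w" for w
      proof -
        obtain u where u: "u \<in> U" "\<not> is_pole g ((g ^^ k) u)" "g ((g ^^ k) u) = w"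
          using R(2)[OF w(1)] by blast
        have "iterate f (Suc k) (Fin u) = Some (Fin w)"
          using orb[OF u(1), of k] u by (simp add: g(2))
        then have "iterate f (Suc (Suc k)) (Fin u) = Some (Fin (g w))"
          using w(2) by (simp add: g(2))
        then show ?thesis using orbit[OF u(1)] far by blast
      qed
      then show False
        using rational_if_omits_near_infinity[OF g(1) \<rho>(1) R(1)] not_rat by blast
    qed
  qed
qed

section \<open>Bounded Julia components\<close>

theorem theorem1p2:
  fixes X :: "complex set"
  assumes "X \<noteq> {}" and "closed X" and "connected X" and "bounded X"
  shows "interior X = {} \<longleftrightarrow>
         (\<exists>f :: complex \<Rightarrow> riemann_sphere. meromorphic_fun f \<and> X \<in> components (Julia_set f))"
proof
  assume "interior X = {}"
  with assms show "\<exists>f. meromorphic_fun f \<and> X \<in> components (Julia_set f)"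
    by (rule Julia_component_if_empty_interior)
next
  assume "\<exists>f. meromorphic_fun f \<and> X \<in> components (Julia_set f)"
  then obtain f where f: "meromorphic_fun f" "X \<in> components (Julia_set f)" by blast
  show "interior X = {}"
  proof (rule ccontr)
    assume "interior X \<noteq> {}"
    moreover have "interior X \<subseteq> interior (Julia_set f)"
      using f(2) by (intro interior_mono in_components_subset)
    ultimately have "Julia_set f = UNIV" using interior_Julia_set[OF f(1)] by blast
    then have "X = UNIV" using f(2) by simp
    then show False using \<open>bounded X\<close> not_bounded_UNIV by blast
  qed
qed

end
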